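(* Let $N\ge 1$, $0<s\le 1$ and $1<p<\infty$ be such that $s\,p>N$. Then \[ \mathfrak{m}_{s,p}(\mathbb{R}^N)=\inf_{\varphi\in \mathcal{W}^{s,p}(\mathbb{R}^N)} \Big\{[\varphi]_{W^{s,p}(\mathbb{R}^N)}^p\, : \, [\varphi]_{C^{0,\alpha_{s,p}}(\mathbb{R}^N)}=1\Big\}, \] and the infimum on the right-hand side is attained.
   Context: For $0<s<1$, $[\varphi]_{W^{s,p}(\mathbb{R}^N)}=\left(\iint_{\mathbb{R}^N\times\mathbb{R}^N}\frac{|\varphi(x)-\varphi(y)|^p}{|x-y|^{N+s\,p}}dx\,dy\right)^{1/p}$, and for $s=1$, $[\varphi]_{W^{1,p}(\mathbb{R}^N)}=\|\nabla\varphi\|_{L^p(\mathbb{R}^N)}$. $[\varphi]_{C^{0,\alpha}(\mathbb{R}^N)}=\sup_{x\ne y}\frac{|\varphi(x)-\varphi(y)|}{|x-y|^\alpha}$ and $\alpha_{s,p}=s-N/p$. $\mathfrak{m}_{s,p}(\mathbb{R}^N)=\inf\{[\varphi]^p_{W^{s,p}(\mathbb{R}^N)}:\varphi\in C^\infty_0(\mathbb{R}^N),\ [\varphi]_{C^{0,\alpha_{s,p}}(\mathbb{R}^N)}=1\}$. The space $\mathcal{W}^{s,p}(\mathbb{R}^N)$ consists of all continuous $\varphi:\mathbb{R}^N\to\mathbb{R}$ with $[\varphi]_{C^{0,\alpha_{s,p}}(\mathbb{R}^N)}<\infty$ and $[\varphi]_{W^{s,p}(\mathbb{R}^N)}<\infty$.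 *)

theory Defs
  imports "HOL-Analysis.Analysis"
begin

coinductive smooth_fun :: "('a::euclidean_space \<Rightarrow> real) \<Rightarrow> bool" where
  "\<lbrakk> \<forall>x. f differentiable (at x);
     \<forall>v. smooth_fun (\<lambda>x. frechet_derivative f (at x) v) \<rbrakk> \<Longrightarrow> smooth_fun f"

definition test_fun :: "('a::euclidean_space \<Rightarrow> real) \<Rightarrow> bool" where
  "test_fun \<phi> \<longleftrightarrow> smooth_fun \<phi> \<and> compact (closure {x. \<phi> x \<noteq> 0})"

definition holder_seminorm :: "real \<Rightarrow> ('a::euclidean_space \<Rightarrow> real) \<Rightarrow> ennreal" where
  "holder_seminorm \<alpha> \<phi> =
     (SUP xy \<in> {(x, y). x \<noteq> y}. ennreal (\<bar>\<phi> (fst xy) - \<phi> (snd xy)\<bar> / dist (fst xy) (snd xy) powr \<alpha>))"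

definition alpha_sp :: "real \<Rightarrow> real \<Rightarrow> 'a::euclidean_space itself \<Rightarrow> real" where
  "alpha_sp s p TYPE('a) = s - real DIM('a) / p"

definition gagliardo_p :: "real \<Rightarrow> real \<Rightarrow> ('a::euclidean_space \<Rightarrow> real) \<Rightarrow> ennreal" where
  "gagliardo_p s p \<phi> =
     (\<integral>\<^sup>+ x. \<integral>\<^sup>+ y. ennreal (\<bar>\<phi> x - \<phi> y\<bar> powr p / norm (x - y) powr (real DIM('a) + s * p))
        \<partial>lborel \<partial>lborel)"

definition weak_gradient :: "('a::euclidean_space \<Rightarrow> real) \<Rightarrow> ('a \<Rightarrow> 'a) \<Rightarrow> bool" where
  "weak_gradient \<phi> g \<longleftrightarrow> g \<in> borel_measurable lborel \<and>
     (\<forall>\<psi>. test_fun \<psi> \<longrightarrow> (\<forall>i\<in>Basis.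
        integrable lborel (\<lambda>x. \<phi> x * frechet_derivative \<psi> (at x) i) \<and>
        integrable lborel (\<lambda>x. (g x \<bullet> i) * \<psi> x) \<and>
        (\<integral>x. \<phi> x * frechet_derivative \<psi> (at x) i \<partial>lborel) = - (\<integral>x. (g x \<bullet> i) * \<psi> x \<partial>lborel)))"

text \<open>||grad phi||_{L^p}^p with the weak gradient (\<infinity> if phi has no weak gradient).\<close>
definition grad_Lp_p :: "real \<Rightarrow> ('a::euclidean_space \<Rightarrow> real) \<Rightarrow> ennreal" where
  "grad_Lp_p p \<phi> = (INF g \<in> {g. weak_gradient \<phi> g}. \<integral>\<^sup>+ x. ennreal (norm (g x) powr p) \<partial>lborel)"

definition Wsp_seminorm_p :: "real \<Rightarrow> real \<Rightarrow> ('a::euclidean_space \<Rightarrow> real) \<Rightarrow> ennreal" where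
  "Wsp_seminorm_p s p \<phi> = (if s = 1 then grad_Lp_p p \<phi> else gagliardo_p s p \<phi>)"

definition m_sp :: "real \<Rightarrow> real \<Rightarrow> 'a::euclidean_space itself \<Rightarrow> ennreal" where
  "m_sp s p TYPE('a) = (INF \<phi> \<in> {\<phi> :: 'a \<Rightarrow> real. test_fun \<phi> \<and>
       holder_seminorm (alpha_sp s p TYPE('a)) \<phi> = 1}. Wsp_seminorm_p s p \<phi>)"

definition W_space :: "real \<Rightarrow> real \<Rightarrow> ('a::euclidean_space \<Rightarrow> real) set" where
  "W_space s p = {\<phi>. continuous_on UNIV \<phi> \<and>
      holder_seminorm (alpha_sp s p TYPE('a)) \<phi> < \<infinity> \<and> Wsp_seminorm_p s p \<phi> < \<infinity>}"

end

theory Submission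
  imports Defs "HOL-Complex_Analysis.Great_Picard"
begin

text \<open>
  Only lower bounds on the Hoelder seminorm are needed: if \<open>u\<close> approximates \<open>\<phi>\<close> at two points where the
  Hoelder quotient of \<open>\<phi>\<close> is nearly 1 and its energy is at most that of \<open>\<phi>\<close> plus \<open>\<epsilon>\<close>, then homogeneity
  of the quotient gives \<open>m \<le> [\<phi>]\<^sup>p\<close>. Mollification does not increase the energy (Jensen). Cutting off is
  critical: by scaling, cut-offs at radius \<open>R\<close> have energy bounded uniformly in \<open>R\<close> but not converging to
  that of \<open>\<phi>\<close>. Their errors are bounded in \<open>L\<^sup>p\<close> and tend to 0 pointwise, so finite averages of them tend
  to 0 in \<open>L\<^sup>p\<close> (a Banach-Saks argument), and averages of cut-offs do the job. For \<open>s < 1\<close> the cut-off is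
  clipping between \<open>\<plusminus>R\<^sup>\<alpha> w(x/R)\<close> with a bump \<open>w\<close>, for \<open>s = 1\<close> it is multiplication by a bump.

  For attainment, translate, dilate and change sign in a minimising sequence so that the Hoelder quotient
  is nearly attained between 0 and a unit vector; a subsequence then converges pointwise to some \<open>\<phi>\<close> with
  Hoelder seminorm 1. For \<open>s < 1\<close> conclude by Fatou. For \<open>s = 1\<close> midpoints of the sequence also have
  Hoelder seminorm close to 1, hence nearly minimal energy, so uniform convexity makes the gradients Cauchy
  in \<open>L\<^sup>p\<close>, and their limit is a weak gradient of \<open>\<phi>\<close>.
\<close>

section \<open>Smooth functions\<close>

text \<open>Since alpha p = s p - N, replacing u by R^alpha u(x/R) changes neither the Hoelder
  seminorm nor the energy. This invariance is why cut-offs are merely bounded in energy and why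
  minimising sequences must be normalised. The two cut-offs differ for a reason. Increments of a
  clipped function are dominated pointwise by those of phi or of the clipping profile, which
  controls a nonlocal energy without any product rule; the result is only continuous and is
  mollified afterwards. For s = 1 mollification comes first, so that the product rule is classical;
  the term containing the gradient of the bump is controlled by the growth |x|^alpha that the
  Hoelder bound allows once a constant is subtracted. Fatou settles the limit for s < 1 because
  difference quotients converge pointwise along with the functions. Gradients need not, hence the
  detour through uniform convexity. It needs midpoints that still nearly attain the Hoelder
  quotient, so all members of the sequence must nearly attain it in one common direction and with
  one sign.\<close>

lemma smooth_fun_differentiable: "smooth_fun f \<Longrightarrow> f differentiable (at x)"
  by (erule smooth_fun.cases) auto

lemma smooth_fun_derivative: "smooth_fun f \<Longrightarrow> smooth_fun (\<lambda>x. frechet_derivative f (at x) v)"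
  by (erule smooth_fun.cases) auto

lemma smooth_fun_has_derivative:
  "smooth_fun f \<Longrightarrow> (f has_derivative frechet_derivative f (at x)) (at x)"
  using smooth_fun_differentiable frechet_derivative_works by blast

lemma smooth_fun_continuous: "smooth_fun f \<Longrightarrow> continuous_on S f"
  by (meson continuous_at_imp_continuous_on differentiable_imp_continuous_within
      smooth_fun_differentiable)

text \<open>The functions \<open>q(1/t) e\<^sup>-\<^sup>1\<^sup>/\<^sup>t\<close>, extended by 0, form a class closed under differentiation.\<close>

definition flat_exp :: "real poly \<Rightarrow> real \<Rightarrow> real" where
  "flat_exp q t = (if t > 0 then poly q (1 / t) * exp (- (1 / t)) else 0)"

lemma poly_div_exp_tendsto_0:
  fixes q :: "real poly"
  shows "((\<lambda>u. poly q u * exp (- u)) \<longlongrightarrow> 0) at_top"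
proof -
  have "((\<lambda>u. \<Sum>i\<le>degree q. coeff q i * (u ^ i / exp u)) \<longlongrightarrow> (\<Sum>i\<le>degree q. coeff q i * 0)) at_top"
    by (intro tendsto_sum tendsto_mult tendsto_const tendsto_power_div_exp_0)
  moreover have "(\<Sum>i\<le>degree q. coeff q i * (u ^ i / exp u)) = poly q u * exp (- u)" for u
    by (simp add: poly_altdef sum_distrib_right exp_minus divide_inverse mult.assoc)
  ultimately show ?thesis by simp
qed

text \<open>With u = 1/t the derivative of q(u) exp(-u) in t is u^2 (q(u) - q'(u)) exp(-u);
  \<open>[:0,0,1:]\<close> is the polynomial u^2. Only t = 0 needs a limit argument.\<close>

lemma flat_exp_has_derivative:
  "(flat_exp q has_real_derivative flat_exp ([:0,0,1:] * (q - pderiv q)) t) (at t)"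
proof -
  consider "t > 0" | "t < 0" | "t = 0" by linarith
  then show ?thesis
  proof cases
    case 1
    have "((\<lambda>t. poly q (1 / t) * exp (- (1 / t))) has_real_derivative
        flat_exp ([:0,0,1:] * (q - pderiv q)) t) (at t)"
      using 1 by (auto intro!: derivative_eq_intros poly_DERIV[THEN DERIV_chain2]
          simp: flat_exp_def field_simps power2_eq_square)
    then show ?thesis
      by (rule has_field_derivative_transform_within_open[where S="{0<..}"])
         (use 1 in \<open>auto simp: flat_exp_def\<close>)
  next
    case 2
    have "((\<lambda>t. 0) has_real_derivative flat_exp ([:0,0,1:] * (q - pderiv q)) t) (at t)"
      using 2 by (simp add: flat_exp_def)
    then show ?thesis
      by (rule has_field_derivative_transform_within_open[where S="{..<0}"])
         (use 2 in \<open>auto simp: flat_exp_def\<close>)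
  next
    case 3
    \<comment> \<open>From the right, the difference quotient at 0 is u q(u) exp(-u) with u = 1/h,
      and \<open>pCons 0 q\<close> is the polynomial u q(u).\<close>
    have "((\<lambda>h. poly (pCons 0 q) (inverse h) * exp (- inverse h)) \<longlongrightarrow> 0) (at_right (0::real))"
      using poly_div_exp_tendsto_0[of "pCons 0 q"] filterlim_inverse_at_top_right
      by (rule filterlim_compose)
    then have r: "((\<lambda>h. flat_exp q h / h) \<longlongrightarrow> 0) (at_right 0)"
      by (rule Lim_transform_eventually)
         (auto simp: flat_exp_def field_simps intro!: eventually_at_right_less[THEN eventually_mono])
    have l: "((\<lambda>h. flat_exp q h / h) \<longlongrightarrow> 0) (at_left 0)"
      by (rule Lim_transform_eventually[OF tendsto_const])
         (auto simp: flat_exp_def eventually_at_filter)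
    have "((\<lambda>h. flat_exp q h / h) \<longlongrightarrow> 0) (at 0)"
      using l r by (simp add: filterlim_at_split)
    then show ?thesis
      using 3 by (simp add: DERIV_def flat_exp_def)
  qed
qed

text \<open>An algebra closed under derivatives, serving as an invariant for the coinductive definition of smoothness.\<close>

inductive smooth_alg :: "('a::euclidean_space \<Rightarrow> real) \<Rightarrow> bool" where
  base: "smooth_fun f \<Longrightarrow> smooth_alg f"
| const: "smooth_alg (\<lambda>x. c)"
| inner: "smooth_alg (\<lambda>x. x \<bullet> v)"
| flat: "smooth_alg (\<lambda>x. flat_exp q (r - x \<bullet> x))"
| add: "smooth_alg f \<Longrightarrow> smooth_alg g \<Longrightarrow> smooth_alg (\<lambda>x. f x + g x)"
| mult: "smooth_alg f \<Longrightarrow> smooth_alg g \<Longrightarrow> smooth_alg (\<lambda>x. f x * g x)"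
| affine: "smooth_alg f \<Longrightarrow> smooth_alg (\<lambda>x. f (t + c *\<^sub>R x))"

text \<open>This is the step that the coinduction needs. The rule \<open>base\<close> puts every
  smooth function into the algebra, so all closure properties of smoothness follow from a single
  coinduction; \<open>flat\<close> ranges over all \<open>q\<close> because differentiation changes
  the polynomial.\<close>

lemma smooth_alg_derivative:
  assumes "smooth_alg f"
  shows "\<exists>f'. (\<forall>x. (f has_derivative f' x) (at x)) \<and> (\<forall>v. smooth_alg (\<lambda>x. f' x v))"
  using assms
proof induction
  case (base f)
  then show ?case
    by (intro exI[of _ "\<lambda>x. frechet_derivative f (at x)"])
       (simp add: smooth_fun_has_derivative smooth_fun_derivative smooth_alg.base)
next
  case (const c)
  then show ?case
    by (intro exI[of _ "\<lambda>_ _. 0"]) (simp add: smooth_alg.const)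
next
  case (inner v)
  have "((\<lambda>x. x \<bullet> v) has_derivative (\<lambda>h. h \<bullet> v)) (at x)" for x :: 'a
    by (auto intro!: derivative_eq_intros)
  then show ?case
    by (intro exI[of _ "\<lambda>_ h. h \<bullet> v"]) (simp add: smooth_alg.const)
next
  case (flat q r)
  let ?q' = "[:0,0,1:] * (q - pderiv q)"
  \<comment> \<open>The chain rule factor -2 (x, h) is written as an inner product with the fixed
    vector -2 h, so that the rule \<open>inner\<close> applies to it as a function of x.\<close>
  have "((\<lambda>x. flat_exp q (r - x \<bullet> x)) has_derivative
      (\<lambda>h. (x \<bullet> (- 2 *\<^sub>R h)) * flat_exp ?q' (r - x \<bullet> x))) (at x)" (is "?P x") for x :: 'a
  proof -
    have "((\<lambda>x. r - x \<bullet> x) has_derivative (\<lambda>h. - 2 * (x \<bullet> h))) (at x)"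
      by (auto intro!: derivative_eq_intros simp: inner_commute)
    from has_derivative_compose[OF this flat_exp_has_derivative[unfolded has_field_derivative_def]]
    show ?thesis by (simp add: mult.commute)
  qed
  then show ?case
    by (intro exI[of _ "\<lambda>x h. (x \<bullet> (- 2 *\<^sub>R h)) * flat_exp ?q' (r - x \<bullet> x)"])
       (intro conjI allI smooth_alg.mult[OF smooth_alg.inner smooth_alg.flat])
next
  case (add f g)
  then obtain f' g' where "\<forall>x. (f has_derivative f' x) (at x)" "\<forall>v. smooth_alg (\<lambda>x. f' x v)"
    "\<forall>x. (g has_derivative g' x) (at x)" "\<forall>v. smooth_alg (\<lambda>x. g' x v)" by blast
  then show ?case
    by (intro exI[of _ "\<lambda>x h. f' x h + g' x h"])
       (simp add: smooth_alg.add has_derivative_add)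
next
  case (mult f g)
  then obtain f' g' where "\<forall>x. (f has_derivative f' x) (at x)" "\<forall>v. smooth_alg (\<lambda>x. f' x v)"
    "\<forall>x. (g has_derivative g' x) (at x)" "\<forall>v. smooth_alg (\<lambda>x. g' x v)" by blast
  with mult show ?case
    by (intro exI[of _ "\<lambda>x h. f x * g' x h + f' x h * g x"])
       (simp add: smooth_alg.add smooth_alg.mult has_derivative_mult)
next
  case (affine f t c)
  then obtain f' where f': "\<forall>x. (f has_derivative f' x) (at x)" "\<forall>v. smooth_alg (\<lambda>x. f' x v)"
    by blast
  have "((\<lambda>x. f (t + c *\<^sub>R x)) has_derivative (\<lambda>h. f' (t + c *\<^sub>R x) (c *\<^sub>R h))) (at x)" for x
  proof -
    have "((\<lambda>x. t + c *\<^sub>R x) has_derivative (\<lambda>h. c *\<^sub>R h)) (at x)"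
      by (auto intro!: derivative_eq_intros)
    from has_derivative_compose[OF this f'(1)[rule_format]] show ?thesis .
  qed
  moreover have "smooth_alg (\<lambda>x. f' (t + c *\<^sub>R x) (c *\<^sub>R v))" for v
    using smooth_alg.affine[OF f'(2)[rule_format, of "c *\<^sub>R v"]] .
  ultimately show ?case
    by (intro exI[of _ "\<lambda>x h. f' (t + c *\<^sub>R x) (c *\<^sub>R h)"]) auto
qed

lemma smooth_alg_imp_smooth_fun: "smooth_alg f \<Longrightarrow> smooth_fun f"
proof (coinduction arbitrary: f rule: smooth_fun.coinduct)
  case smooth_fun
  from smooth_alg_derivative[OF this] obtain f'
    where f': "\<And>x. (f has_derivative f' x) (at x)" "\<And>v. smooth_alg (\<lambda>x. f' x v)" by blast
  have "frechet_derivative f (at x) = f' x" for x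
    using f'(1) frechet_derivative_at by metis
  then show ?case
    using f' by (auto simp: differentiable_def)
qed

lemma smooth_fun_const: "smooth_fun (\<lambda>x. c)"
  and smooth_fun_add: "smooth_fun f \<Longrightarrow> smooth_fun g \<Longrightarrow> smooth_fun (\<lambda>x. f x + g x)"
  and smooth_fun_mult: "smooth_fun f \<Longrightarrow> smooth_fun g \<Longrightarrow> smooth_fun (\<lambda>x. f x * g x)"
  and smooth_fun_affine: "smooth_fun f \<Longrightarrow> smooth_fun (\<lambda>x. f (t + c *\<^sub>R x))"
  and smooth_fun_flat_exp: "smooth_fun (\<lambda>x. flat_exp q (r - x \<bullet> x))"
  by (simp_all add: smooth_alg_imp_smooth_fun smooth_alg.const smooth_alg.add smooth_alg.mult
      smooth_alg.affine smooth_alg.flat smooth_alg.base)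

section \<open>Test functions\<close>

lemma test_fun_smooth: "test_fun f \<Longrightarrow> smooth_fun f"
  by (simp add: test_fun_def)

lemma test_fun_continuous: "test_fun f \<Longrightarrow> continuous_on S f"
  by (simp add: test_fun_def smooth_fun_continuous)

lemma test_fun_measurable: "test_fun f \<Longrightarrow> f \<in> borel_measurable borel"
  by (simp add: borel_measurable_continuous_onI test_fun_continuous)

lemma test_funI:
  assumes "smooth_fun f" "\<And>x. f x \<noteq> 0 \<Longrightarrow> norm x \<le> R"
  shows "test_fun f"
proof -
  have "bounded {x. f x \<noteq> 0}"
    using assms(2) by (auto simp: bounded_iff)
  then show ?thesis
    using assms(1) by (simp add: test_fun_def bounded_closure compact_closure)
qed

lemma test_funE:
  assumes "test_fun f"
  obtains R where "R > 0" "\<And>x. f x \<noteq> 0 \<Longrightarrow> norm x < R"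
proof -
  have "bounded {x. f x \<noteq> 0}"
    using assms by (auto simp: test_fun_def intro: bounded_subset[OF compact_imp_bounded closure_subset])
  then obtain B where "B > 0" "\<And>x. f x \<noteq> 0 \<Longrightarrow> norm x < B"
    by (auto simp: bounded_pos_less)
  then show ?thesis using that by blast
qed

lemma frechet_derivative_eq_0_outside:
  fixes f :: "'a::real_normed_vector \<Rightarrow> real"
  assumes "\<And>x. f x \<noteq> 0 \<Longrightarrow> norm x < R" "R < norm x"
  shows "frechet_derivative f (at x) v = 0"
proof -
  have "((\<lambda>_. 0) has_derivative (\<lambda>_. 0)) (at x)" by simp
  then have "(f has_derivative (\<lambda>_. 0)) (at x)"
  proof (rule has_derivative_transform_within_open[where s="{y. R < norm y}"])
    show "open {y::'a. R < norm y}"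
      by (intro open_Collect_less continuous_intros)
    show "0 = f y" if "y \<in> {y. R < norm y}" for y
      using assms(1)[of y] that by force
  qed (use assms in auto)
  then show ?thesis by (metis frechet_derivative_at)
qed

lemma test_fun_derivative:
  assumes "test_fun f"
  shows "test_fun (\<lambda>x. frechet_derivative f (at x) v)"
proof -
  obtain R where R: "R > 0" "\<And>x. f x \<noteq> 0 \<Longrightarrow> norm x < R"
    using test_funE[OF assms] by blast
  show ?thesis
  proof (rule test_funI[where R=R])
    show "norm x \<le> R" if "frechet_derivative f (at x) v \<noteq> 0" for x
      using frechet_derivative_eq_0_outside[where f=f and x=x and v=v, OF R(2)] that by force
  qed (simp add: assms smooth_fun_derivative test_fun_smooth)
qed

lemma test_fun_mult_smooth:
  assumes "test_fun f" "smooth_fun g"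
  shows "test_fun (\<lambda>x. g x * f x)"
proof -
  obtain R where R: "R > 0" "\<And>x. f x \<noteq> 0 \<Longrightarrow> norm x < R"
    using test_funE[OF assms(1)] by blast
  show ?thesis
  proof (rule test_funI[where R=R])
    show "norm x \<le> R" if "g x * f x \<noteq> 0" for x
      using R(2)[of x] that by simp
  qed (simp add: assms smooth_fun_mult test_fun_smooth)
qed

lemma test_fun_cmult: "test_fun f \<Longrightarrow> test_fun (\<lambda>x. c * f x)"
  using test_fun_mult_smooth smooth_fun_const by blast

lemma test_fun_zero: "test_fun (\<lambda>x. 0)"
  by (rule test_funI[where R=0]) (auto intro: smooth_fun_const)

lemma test_fun_add:
  assumes "test_fun f" "test_fun g"
  shows "test_fun (\<lambda>x. f x + g x)"
proof -
  obtain R where R: "R > 0" "\<And>x. f x \<noteq> 0 \<Longrightarrow> norm x < R"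
    using test_funE[OF assms(1)] by blast
  obtain S where S: "S > 0" "\<And>x. g x \<noteq> 0 \<Longrightarrow> norm x < S"
    using test_funE[OF assms(2)] by blast
  show ?thesis
  proof (rule test_funI[where R="max R S"])
    show "norm x \<le> max R S" if "f x + g x \<noteq> 0" for x
      using R(2)[of x] S(2)[of x] that by (cases "f x = 0") auto
  qed (simp add: assms smooth_fun_add test_fun_smooth)
qed

lemma test_fun_sum:
  "finite I \<Longrightarrow> (\<And>i. i \<in> I \<Longrightarrow> test_fun (f i)) \<Longrightarrow> test_fun (\<lambda>x. \<Sum>i\<in>I. f i x)"
  by (induction I rule: finite_induct) (auto intro: test_fun_add test_fun_zero)

lemma test_fun_affine:
  assumes "test_fun f" "c \<noteq> 0"
  shows "test_fun (\<lambda>x. f (t + c *\<^sub>R x))"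
proof -
  obtain R where R: "R > 0" "\<And>x. f x \<noteq> 0 \<Longrightarrow> norm x < R"
    using test_funE[OF assms(1)] by blast
  show ?thesis
  proof (rule test_funI[where R="(R + norm t) / \<bar>c\<bar>"])
    fix x assume "f (t + c *\<^sub>R x) \<noteq> 0"
    then have "norm (t + c *\<^sub>R x) < R" by (rule R)
    moreover have "norm (c *\<^sub>R x) \<le> norm (t + c *\<^sub>R x) + norm t"
      by (metis add.commute add_diff_cancel_left' norm_triangle_ineq4)
    ultimately have "\<bar>c\<bar> * norm x \<le> R + norm t" by simp
    then show "norm x \<le> (R + norm t) / \<bar>c\<bar>"
      using assms(2) by (simp add: field_simps)
  qed (simp add: assms smooth_fun_affine test_fun_smooth)
qed

lemma frechet_derivative_affine:
  fixes f :: "'a::euclidean_space \<Rightarrow> real"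
  assumes "smooth_fun f"
  shows "frechet_derivative (\<lambda>x. f (t + c *\<^sub>R x)) (at x) v = c * frechet_derivative f (at (t + c *\<^sub>R x)) v"
proof -
  have "((\<lambda>x. t + c *\<^sub>R x) has_derivative (\<lambda>h. c *\<^sub>R h)) (at x)"
    by (auto intro!: derivative_eq_intros)
  from has_derivative_compose[OF this smooth_fun_has_derivative[OF assms]]
  have "frechet_derivative (\<lambda>x. f (t + c *\<^sub>R x)) (at x) =
      (\<lambda>h. frechet_derivative f (at (t + c *\<^sub>R x)) (c *\<^sub>R h))"
    by (metis frechet_derivative_at)
  moreover have "linear (frechet_derivative f (at (t + c *\<^sub>R x)))"
    by (simp add: assms linear_frechet_derivative smooth_fun_differentiable)
  ultimately show ?thesis by (simp add: linear_scale)
qed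

lemma frechet_derivative_mult:
  assumes "smooth_fun f" "smooth_fun g"
  shows "frechet_derivative (\<lambda>x. f x * g x) (at x) v =
    f x * frechet_derivative g (at x) v + frechet_derivative f (at x) v * g x"
  using has_derivative_mult[OF smooth_fun_has_derivative[OF assms(1)] smooth_fun_has_derivative[OF assms(2)], of x]
  by (metis (no_types, lifting) frechet_derivative_at)

lemma test_fun_bounded:
  assumes "test_fun f"
  obtains B where "B > 0" "\<And>x. \<bar>f x\<bar> \<le> B"
proof -
  obtain R where R: "R > 0" "\<And>x. f x \<noteq> 0 \<Longrightarrow> norm x < R"
    using test_funE[OF assms] by blast
  have "compact (f ` cball 0 R)"
    by (simp add: assms compact_continuous_image test_fun_continuous)
  then obtain B where B: "B > 0" "\<And>x. x \<in> cball 0 R \<Longrightarrow> \<bar>f x\<bar> \<le> B"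
    using compact_imp_bounded bounded_pos by (metis image_eqI real_norm_def)
  have "\<bar>f x\<bar> \<le> B" for x
    using B R(2)[of x] by (cases "f x = 0") auto
  with B(1) show ?thesis using that by blast
qed

text \<open>By linearity only the finitely many partial derivatives have to be bounded, and each of
  them is a test function.\<close>

lemma test_fun_derivative_bounded:
  assumes "test_fun f"
  obtains B where "B > 0" "\<And>x v. \<bar>frechet_derivative f (at x) v\<bar> \<le> B * norm v"
proof -
  let ?D = "\<lambda>x v. frechet_derivative f (at x) v"
  have "\<exists>B>0. \<forall>x. \<bar>?D x i\<bar> \<le> B" for i
    using test_fun_bounded[OF test_fun_derivative[OF assms]] by metis
  then obtain B where B: "\<And>i. B i > 0" "\<And>i x. \<bar>?D x i\<bar> \<le> B i" by metis
  have "\<bar>?D x v\<bar> \<le> (\<Sum>i\<in>Basis. B i) * norm v" for x v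
  proof -
    have lin: "linear (?D x)"
      by (simp add: assms linear_frechet_derivative smooth_fun_differentiable test_fun_smooth)
    have "?D x v = ?D x (\<Sum>i\<in>Basis. (v \<bullet> i) *\<^sub>R i)" by (simp add: euclidean_representation)
    also have "\<dots> = (\<Sum>i\<in>Basis. (v \<bullet> i) * ?D x i)"
      using lin by (simp add: linear_sum linear_scale)
    also have "\<bar>\<dots>\<bar> \<le> (\<Sum>i\<in>Basis. norm v * B i)"
      by (intro order_trans[OF sum_abs] sum_mono)
         (auto simp: abs_mult intro!: mult_mono B Basis_le_norm)
    finally show ?thesis by (simp add: sum_distrib_left mult.commute)
  qed
  moreover have "(\<Sum>i\<in>(Basis::'a set). B i) > 0"
    using B by (intro sum_pos) auto
  ultimately show ?thesis using that by blast
qed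

lemma test_fun_lipschitz:
  assumes "test_fun f"
  obtains L where "L > 0" "\<And>x y. \<bar>f x - f y\<bar> \<le> L * norm (x - y)"
proof -
  obtain B where B: "B > 0" "\<And>x v. \<bar>frechet_derivative f (at x) v\<bar> \<le> B * norm v"
    using test_fun_derivative_bounded[OF assms] by blast
  have "norm (f x - f y) \<le> B * norm (x - y)" for x y
  proof (rule differentiable_bound[where S=UNIV and f'="\<lambda>x. frechet_derivative f (at x)"])
    show "onorm (frechet_derivative f (at x)) \<le> B" for x
      using B by (intro onorm_bound) auto
  qed (auto intro!: smooth_fun_has_derivative test_fun_smooth assms)
  then show ?thesis using that B by auto
qed

section \<open>Integrability of continuous functions against test functions\<close>

lemma integrable_continuous_bounded_support:
  fixes f :: "'a::euclidean_space \<Rightarrow> real"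
  assumes "continuous_on UNIV f" "\<And>x. f x \<noteq> 0 \<Longrightarrow> norm x \<le> R"
  shows "integrable lborel f"
proof -
  have "integrable lborel (\<lambda>x. indicator (cball 0 R) x *\<^sub>R f x)"
    by (rule borel_integrable_compact) (auto intro: continuous_on_subset[OF assms(1)])
  moreover have "(\<lambda>x. indicator (cball 0 R) x *\<^sub>R f x) = f"
    using assms(2) by (force simp: indicator_def)
  ultimately show ?thesis by simp
qed

lemma integrable_continuous_mult_test_fun:
  assumes "continuous_on UNIV \<phi>" "test_fun f"
  shows "integrable lborel (\<lambda>x. \<phi> x * f x)"
proof -
  obtain R where R: "R > 0" "\<And>x. f x \<noteq> 0 \<Longrightarrow> norm x < R"
    using test_funE[OF assms(2)] by blast
  show ?thesis
  proof (rule integrable_continuous_bounded_support[where R=R])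
    show "norm x \<le> R" if "\<phi> x * f x \<noteq> 0" for x
      using R(2)[of x] that by simp
  qed (intro continuous_intros assms test_fun_continuous)
qed

lemma integrable_test_fun: "test_fun f \<Longrightarrow> integrable lborel f"
  using integrable_continuous_mult_test_fun[of "\<lambda>_. 1" f] by simp

lemma smooth_fun_measurable: "smooth_fun f \<Longrightarrow> f \<in> borel_measurable borel"
  by (simp add: borel_measurable_continuous_onI smooth_fun_continuous)

section \<open>Change of variables and integration by parts\<close>

lemma nn_integral_lborel_affine:
  fixes t :: "'a::euclidean_space"
  assumes [measurable]: "f \<in> borel_measurable borel" and "c \<noteq> 0"
  shows "(\<integral>\<^sup>+x. f x \<partial>lborel) = ennreal (\<bar>c\<bar> ^ DIM('a)) * (\<integral>\<^sup>+x. f (t + c *\<^sub>R x) \<partial>lborel)"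
  by (subst lborel_affine[OF assms(2), of t])
     (simp add: nn_integral_density nn_integral_distr nn_integral_cmult)

lemma lborel_integrable_affine:
  fixes t :: "'a::euclidean_space" and f :: "'a \<Rightarrow> 'b::{banach, second_countable_topology}"
  assumes "integrable lborel f" and "c \<noteq> 0"
  shows "integrable lborel (\<lambda>x. f (t + c *\<^sub>R x))"
proof -
  have [measurable]: "f \<in> borel_measurable borel"
    using assms(1) by auto
  have "ennreal (\<bar>c\<bar> ^ DIM('a)) * (\<integral>\<^sup>+x. norm (f (t + c *\<^sub>R x)) \<partial>lborel) < \<infinity>"
    using assms nn_integral_lborel_affine[of "\<lambda>x. ennreal (norm (f x))" c t]
    by (simp add: integrable_iff_bounded)
  then show ?thesis
    using assms(2) by (auto simp: integrable_iff_bounded ennreal_mult_less_top)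
qed

lemma lborel_integral_affine:
  fixes t :: "'a::euclidean_space" and f :: "'a \<Rightarrow> 'b::{banach, second_countable_topology}"
  assumes "integrable lborel f" and "c \<noteq> 0"
  shows "(\<integral>x. f x \<partial>lborel) = (\<bar>c\<bar> ^ DIM('a)) *\<^sub>R (\<integral>x. f (t + c *\<^sub>R x) \<partial>lborel)"
proof -
  have [measurable]: "f \<in> borel_measurable borel"
    using assms(1) by auto
  show ?thesis
    by (subst lborel_affine[OF assms(2), of t])
       (simp add: integral_density integral_distr)
qed

lemma directional_derivative:
  fixes f :: "'a::euclidean_space \<Rightarrow> real"
  assumes "smooth_fun f"
  shows "((\<lambda>h. (f (x + h *\<^sub>R v) - f x) / h) \<longlongrightarrow> frechet_derivative f (at x) v) (at 0)"
proof -
  have "((\<lambda>h. x + h *\<^sub>R v) has_derivative (\<lambda>h. h *\<^sub>R v)) (at 0)"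
    by (auto intro!: derivative_eq_intros)
  from has_derivative_compose[OF this, of f "frechet_derivative f (at x)"]
  have "((\<lambda>h. f (x + h *\<^sub>R v)) has_derivative (\<lambda>h. frechet_derivative f (at x) (h *\<^sub>R v))) (at 0)"
    using smooth_fun_has_derivative[OF assms] by simp
  moreover have "(\<lambda>h. frechet_derivative f (at x) (h *\<^sub>R v)) = (*) (frechet_derivative f (at x) v)"
    using linear_frechet_derivative[OF smooth_fun_differentiable[OF assms]]
    by (simp add: linear_scale fun_eq_iff)
  ultimately have "((\<lambda>h. f (x + h *\<^sub>R v)) has_real_derivative frechet_derivative f (at x) v) (at 0)"
    by (simp add: has_field_derivative_def)
  then show ?thesis
    by (simp add: DERIV_def)
qed

text \<open>Difference quotients of f in direction v have integral 0 by translation invariance, and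
  they converge to the directional derivative under a common bound.\<close>

lemma integral_derivative_test_fun:
  assumes "test_fun f"
  shows "(\<integral>x. frechet_derivative f (at x) v \<partial>lborel) = 0"
proof -
  obtain R where R: "R > 0" "\<And>x. f x \<noteq> 0 \<Longrightarrow> norm x < R"
    using test_funE[OF assms] by blast
  obtain L where L: "L > 0" "\<And>x y. \<bar>f x - f y\<bar> \<le> L * norm (x - y)"
    using test_fun_lipschitz[OF assms] by blast
  have [measurable]: "f \<in> borel_measurable borel"
    "(\<lambda>x. frechet_derivative f (at x) v) \<in> borel_measurable borel"
    using assms by (auto intro: test_fun_measurable test_fun_derivative)
  define h where "h n = inverse (real (Suc n))" for n
  have h: "h n > 0" "h n \<le> 1" for n
    by (auto simp: h_def field_simps)
  have hlim: "filterlim h (at 0) sequentially"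
    using LIMSEQ_inverse_real_of_nat h(1)
    by (auto simp: filterlim_at h_def[abs_def] less_imp_neq[THEN not_sym] simp del: of_nat_Suc)
  let ?q = "\<lambda>n x. (f (x + h n *\<^sub>R v) - f x) / h n"
  have "(\<lambda>n. \<integral>x. ?q n x \<partial>lborel) \<longlonglongrightarrow> (\<integral>x. frechet_derivative f (at x) v \<partial>lborel)"
  \<comment> \<open>As the steps \<open>h n\<close> are at most 1, all translates are supported in
    the ball of radius R + |v|; there the Lipschitz constant bounds the quotients.\<close>
  proof (rule integral_dominated_convergence[where w="\<lambda>x. indicator (cball 0 (R + norm v)) x *\<^sub>R (L * norm v)"])
    show "integrable lborel (\<lambda>x::'a. indicator (cball 0 (R + norm v)) x *\<^sub>R (L * norm v))"
      by (rule borel_integrable_compact) auto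
    show "AE x in lborel. (\<lambda>n. ?q n x) \<longlonglongrightarrow> frechet_derivative f (at x) v"
      using filterlim_compose[OF directional_derivative[OF test_fun_smooth[OF assms]] hlim] by simp
    have "norm (?q n x) \<le> indicator (cball 0 (R + norm v)) x *\<^sub>R (L * norm v)" for n x
    proof (cases "norm x \<le> R + norm v")
      case True
      have "\<bar>f (x + h n *\<^sub>R v) - f x\<bar> \<le> L * norm v * h n"
        using L(2)[of "x + h n *\<^sub>R v" x] h[of n] by (simp add: mult_ac)
      then show ?thesis
        using True h[of n] by (simp add: field_simps)
    next
      case False
      have "norm x \<le> norm (x + h n *\<^sub>R v) + norm (h n *\<^sub>R v)"
        by (metis add_diff_cancel_right' norm_triangle_ineq4)
      moreover have "norm (h n *\<^sub>R v) \<le> norm v"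
        using h[of n] by (simp add: mult_left_le_one_le)
      ultimately have "f (x + h n *\<^sub>R v) = 0" "f x = 0"
        using False R(2)[of x] R(2)[of "x + h n *\<^sub>R v"] norm_ge_zero[of v] by linarith+
      then show ?thesis using L by simp
    qed
    then show "AE x in lborel. norm (?q n x) \<le> indicator (cball 0 (R + norm v)) x *\<^sub>R (L * norm v)" for n
      by simp
  qed measurable
  moreover have "(\<integral>x. ?q n x \<partial>lborel) = 0" for n
  proof -
    have "integrable lborel (\<lambda>x. f (x + h n *\<^sub>R v))"
      using lborel_integrable_affine[OF integrable_test_fun[OF assms], of 1 "h n *\<^sub>R v"]
      by (simp add: add.commute)
    moreover have "(\<integral>x. f (x + h n *\<^sub>R v) \<partial>lborel) = (\<integral>x. f x \<partial>lborel)"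
      using lborel_integral_affine[OF integrable_test_fun[OF assms], of 1 "h n *\<^sub>R v"]
      by (simp add: add.commute)
    ultimately show ?thesis
      using integrable_test_fun[OF assms] by simp
  qed
  ultimately have "(\<lambda>n. 0) \<longlonglongrightarrow> (\<integral>x. frechet_derivative f (at x) v \<partial>lborel)"
    by (simp only:)
  from LIMSEQ_unique[OF this tendsto_const] show ?thesis .
qed

lemma integration_by_parts:
  assumes "smooth_fun f" "test_fun g"
  shows "(\<integral>x. f x * frechet_derivative g (at x) v \<partial>lborel) =
    - (\<integral>x. frechet_derivative f (at x) v * g x \<partial>lborel)"
proof -
  have "integrable lborel (\<lambda>x. f x * frechet_derivative g (at x) v)"
    "integrable lborel (\<lambda>x. frechet_derivative f (at x) v * g x)"
    using assms by (auto intro!: integrable_continuous_mult_test_fun smooth_fun_continuous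
        test_fun_derivative smooth_fun_derivative)
  then show ?thesis
    using integral_derivative_test_fun[OF test_fun_mult_smooth[OF assms(2,1)], of v]
    by (simp add: frechet_derivative_mult assms test_fun_smooth)
qed

section \<open>Weak gradients\<close>

definition gradient :: "('a::euclidean_space \<Rightarrow> real) \<Rightarrow> 'a \<Rightarrow> 'a" where
  "gradient f x = (\<Sum>i\<in>Basis. frechet_derivative f (at x) i *\<^sub>R i)"

lemma gradient_inner: "i \<in> Basis \<Longrightarrow> gradient f x \<bullet> i = frechet_derivative f (at x) i"
  by (simp add: gradient_def)

lemma gradient_measurable:
  "smooth_fun f \<Longrightarrow> gradient f \<in> borel_measurable borel"
  unfolding gradient_def[abs_def]
  by (intro borel_measurable_sum borel_measurable_scaleR smooth_fun_measurable smooth_fun_derivative) auto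

lemma weak_gradient_test_fun:
  assumes "test_fun u"
  shows "weak_gradient u (gradient u)"
  unfolding weak_gradient_def
  using assms
  by (auto simp: gradient_inner integration_by_parts test_fun_smooth
      intro!: integrable_continuous_mult_test_fun test_fun_continuous smooth_fun_continuous
        smooth_fun_derivative test_fun_derivative gradient_measurable)

text \<open>Testing the composed function with psi amounts to testing phi with psi composed with the
  inverse affine map. The constant k disappears because derivatives of test functions have integral
  0.\<close>

lemma weak_gradient_affine:
  fixes \<phi> :: "'a::euclidean_space \<Rightarrow> real"
  assumes wg: "weak_gradient \<phi> g" and c: "c \<noteq> 0"
  shows "weak_gradient (\<lambda>x. a * (\<phi> (t + c *\<^sub>R x) - k)) (\<lambda>x. (a * c) *\<^sub>R g (t + c *\<^sub>R x))"
  unfolding weak_gradient_def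
proof (intro conjI allI impI ballI)
  have g: "g \<in> borel_measurable borel"
    using wg by (simp add: weak_gradient_def)
  then show "(\<lambda>x. (a * c) *\<^sub>R g (t + c *\<^sub>R x)) \<in> borel_measurable lborel"
    by simp
  fix \<psi> :: "'a \<Rightarrow> real" and i :: 'a
  assume \<psi>: "test_fun \<psi>" and i: "i \<in> Basis"
  define \<psi>' where "\<psi>' y = \<psi> (- (1 / c) *\<^sub>R t + (1 / c) *\<^sub>R y)" for y
  have \<psi>': "test_fun \<psi>'"
    unfolding \<psi>'_def using \<psi> c by (intro test_fun_affine) auto
  have ev: "\<psi>' (t + c *\<^sub>R x) = \<psi> x" for x
    using c by (simp add: \<psi>'_def algebra_simps)
  have D: "frechet_derivative \<psi>' (at (t + c *\<^sub>R x)) i = (1 / c) * frechet_derivative \<psi> (at x) i" for x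
  proof -
    have "frechet_derivative \<psi>' (at (t + c *\<^sub>R x)) i =
        (1 / c) * frechet_derivative \<psi> (at (- (1 / c) *\<^sub>R t + (1 / c) *\<^sub>R (t + c *\<^sub>R x))) i"
      unfolding \<psi>'_def[abs_def] by (rule frechet_derivative_affine[OF test_fun_smooth[OF \<psi>]])
    also have "- (1 / c) *\<^sub>R t + (1 / c) *\<^sub>R (t + c *\<^sub>R x) = x"
      using c by (simp add: algebra_simps)
    finally show ?thesis .
  qed
  have I: "integrable lborel (\<lambda>x. \<phi> x * frechet_derivative \<psi>' (at x) i)"
    "integrable lborel (\<lambda>x. (g x \<bullet> i) * \<psi>' x)"
    "(\<integral>x. \<phi> x * frechet_derivative \<psi>' (at x) i \<partial>lborel) = - (\<integral>x. (g x \<bullet> i) * \<psi>' x \<partial>lborel)"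
    using wg \<psi>' i by (auto simp: weak_gradient_def)
  have i1: "integrable lborel (\<lambda>x. \<phi> (t + c *\<^sub>R x) * (1 / c * frechet_derivative \<psi> (at x) i))"
    using lborel_integrable_affine[OF I(1) c, of t] unfolding D .
  then have "integrable lborel (\<lambda>x. c * (\<phi> (t + c *\<^sub>R x) * (1 / c * frechet_derivative \<psi> (at x) i)))"
    by (rule integrable_mult_right)
  then have i1': "integrable lborel (\<lambda>x. \<phi> (t + c *\<^sub>R x) * frechet_derivative \<psi> (at x) i)"
    using c by simp
  have i2: "integrable lborel (\<lambda>x. (g (t + c *\<^sub>R x) \<bullet> i) * \<psi> x)"
    using lborel_integrable_affine[OF I(2) c, of t] unfolding ev .
  have i3: "integrable lborel (\<lambda>x. frechet_derivative \<psi> (at x) i)"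
    by (intro integrable_test_fun test_fun_derivative \<psi>)
  have eq: "(\<lambda>x. a * (\<phi> (t + c *\<^sub>R x) - k) * frechet_derivative \<psi> (at x) i) =
     (\<lambda>x. a * (\<phi> (t + c *\<^sub>R x) * frechet_derivative \<psi> (at x) i) - a * k * frechet_derivative \<psi> (at x) i)"
    by (auto simp: algebra_simps)
  have eq2: "(\<lambda>x. ((a * c) *\<^sub>R g (t + c *\<^sub>R x) \<bullet> i) * \<psi> x) = (\<lambda>x. a * c * ((g (t + c *\<^sub>R x) \<bullet> i) * \<psi> x))"
    by (auto simp: algebra_simps)
  show "integrable lborel (\<lambda>x. a * (\<phi> (t + c *\<^sub>R x) - k) * frechet_derivative \<psi> (at x) i)"
    unfolding eq using i1' i3 by (intro Bochner_Integration.integrable_diff integrable_mult_right)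
  show "integrable lborel (\<lambda>x. ((a * c) *\<^sub>R g (t + c *\<^sub>R x) \<bullet> i) * \<psi> x)"
    unfolding eq2 using i2 by (intro integrable_mult_right)
  \<comment> \<open>Both sides of the identity for phi pick up the same Jacobian, which is cancelled
    next.\<close>
  have "\<bar>c\<bar> ^ DIM('a) * (\<integral>x. \<phi> (t + c *\<^sub>R x) * (1 / c * frechet_derivative \<psi> (at x) i) \<partial>lborel) =
      - (\<bar>c\<bar> ^ DIM('a) * (\<integral>x. (g (t + c *\<^sub>R x) \<bullet> i) * \<psi> x \<partial>lborel))"
    using I(3) lborel_integral_affine[OF I(1) c, of t] lborel_integral_affine[OF I(2) c, of t]
    unfolding D ev by simp
  then have "\<bar>c\<bar> ^ DIM('a) * ((\<integral>x. \<phi> (t + c *\<^sub>R x) * (1 / c * frechet_derivative \<psi> (at x) i) \<partial>lborel) +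
      (\<integral>x. (g (t + c *\<^sub>R x) \<bullet> i) * \<psi> x \<partial>lborel)) = 0"
    by (simp add: distrib_left)
  then have "(\<integral>x. \<phi> (t + c *\<^sub>R x) * (1 / c * frechet_derivative \<psi> (at x) i) \<partial>lborel) =
      - (\<integral>x. (g (t + c *\<^sub>R x) \<bullet> i) * \<psi> x \<partial>lborel)"
    using c by (simp add: eq_neg_iff_add_eq_0)
  moreover have "(\<integral>x. \<phi> (t + c *\<^sub>R x) * frechet_derivative \<psi> (at x) i \<partial>lborel) =
      c * (\<integral>x. \<phi> (t + c *\<^sub>R x) * (1 / c * frechet_derivative \<psi> (at x) i) \<partial>lborel)"
    using c by (subst integral_mult_right_zero[symmetric]) (simp del: integral_mult_right_zero)
  ultimately have "(\<integral>x. \<phi> (t + c *\<^sub>R x) * frechet_derivative \<psi> (at x) i \<partial>lborel) =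
      - c * (\<integral>x. (g (t + c *\<^sub>R x) \<bullet> i) * \<psi> x \<partial>lborel)"
    by (simp only: mult_minus_right mult_minus_left)
  then show "(\<integral>x. a * (\<phi> (t + c *\<^sub>R x) - k) * frechet_derivative \<psi> (at x) i \<partial>lborel) =
      - (\<integral>x. ((a * c) *\<^sub>R g (t + c *\<^sub>R x) \<bullet> i) * \<psi> x \<partial>lborel)"
    unfolding eq eq2
    using Bochner_Integration.integral_diff[OF integrable_mult_right[OF i1', of a]
        integrable_mult_right[OF i3, of "a * k"]]
    by (simp add: integral_derivative_test_fun[OF \<psi>])
qed

lemma weak_gradient_cmult:
  assumes "weak_gradient \<phi> g"
  shows "weak_gradient (\<lambda>x. a * \<phi> x) (\<lambda>x. a *\<^sub>R g x)"
  using weak_gradient_affine[OF assms, of 1 a 0 0] by simp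

lemma weak_gradient_add:
  assumes "weak_gradient \<phi> g" "weak_gradient \<psi> h"
  shows "weak_gradient (\<lambda>x. \<phi> x + \<psi> x) (\<lambda>x. g x + h x)"
  using assms unfolding weak_gradient_def by (auto simp: inner_add_left distrib_right)

section \<open>Mollification\<close>

definition conv :: "('a::euclidean_space \<Rightarrow> real) \<Rightarrow> ('a \<Rightarrow> real) \<Rightarrow> 'a \<Rightarrow> real" where
  "conv \<phi> \<eta> x = (\<integral>y. \<phi> y * \<eta> (x - y) \<partial>lborel)"

lemma test_fun_reflect: "test_fun \<eta> \<Longrightarrow> test_fun (\<lambda>y. \<eta> (x - y))"
  using test_fun_affine[of \<eta> "-1" x] by simp

lemma integrable_conv:
  "continuous_on UNIV \<phi> \<Longrightarrow> test_fun \<eta> \<Longrightarrow> integrable lborel (\<lambda>y. \<phi> y * \<eta> (x - y))"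
  by (intro integrable_continuous_mult_test_fun test_fun_reflect)

lemma conv_alt:
  assumes "continuous_on UNIV \<phi>" "test_fun \<eta>"
  shows "integrable lborel (\<lambda>z. \<phi> (x - z) * \<eta> z)" "conv \<phi> \<eta> x = (\<integral>z. \<phi> (x - z) * \<eta> z \<partial>lborel)"
  using lborel_integral_affine[OF integrable_conv[OF assms, of x], of "-1" x]
    lborel_integrable_affine[OF integrable_conv[OF assms, of x], of "-1" x]
  by (simp_all add: conv_def)

text \<open>As phi is only continuous, the derivative falls on the kernel. Differentiability is
  tested along sequences \<open>X\<close> because dominated convergence is a statement about
  sequences.\<close>

lemma conv_has_derivative:
  fixes \<phi> :: "'a::euclidean_space \<Rightarrow> real"
  assumes \<phi>: "continuous_on UNIV \<phi>" and \<eta>: "test_fun \<eta>"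
  shows "(conv \<phi> \<eta> has_derivative (\<lambda>v. conv \<phi> (\<lambda>z. frechet_derivative \<eta> (at z) v) x)) (at x)"
proof -
  let ?D = "\<lambda>z v. frechet_derivative \<eta> (at z) v"
  obtain R where R: "R > 0" "\<And>x. \<eta> x \<noteq> 0 \<Longrightarrow> norm x < R"
    using test_funE[OF \<eta>] by blast
  obtain L where L: "L > 0" "\<And>x y. \<bar>\<eta> x - \<eta> y\<bar> \<le> L * norm (x - y)"
    using test_fun_lipschitz[OF \<eta>] by blast
  obtain B where B: "B > 0" "\<And>x v. \<bar>?D x v\<bar> \<le> B * norm v"
    using test_fun_derivative_bounded[OF \<eta>] by blast
  have lin: "linear (?D z)" for z
    by (simp add: \<eta> linear_frechet_derivative smooth_fun_differentiable test_fun_smooth)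
  note int = integrable_conv[OF \<phi> \<eta>] integrable_conv[OF \<phi> test_fun_derivative[OF \<eta>]]
  have "linear (\<lambda>v. conv \<phi> (\<lambda>z. ?D z v) x)"
    by (rule linearI)
       (use int in \<open>simp_all add: conv_def linear_add[OF lin] linear_scale[OF lin] distrib_left mult.left_commute\<close>)
  then have bl: "bounded_linear (\<lambda>v. conv \<phi> (\<lambda>z. ?D z v) x)"
    by (rule linear_conv_bounded_linear[THEN iffD1])
  have lim: "(\<lambda>n. ((conv \<phi> \<eta> (X n) - conv \<phi> \<eta> x) - conv \<phi> (\<lambda>z. ?D z (X n - x)) x) /\<^sub>R norm (X n - x)) \<longlonglongrightarrow> 0"
    if X: "\<And>n. X n \<noteq> x" "X \<longlonglongrightarrow> x" for X
  proof -
    have "bounded (range X)"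
      using X(2) convergent_imp_bounded by blast
    then obtain K where K: "K > 0" "\<And>n. norm (X n) \<le> K"
      by (auto simp: bounded_pos)
    \<comment> \<open>\<open>X\<close> converges and hence stays in a ball of radius K; outside
      radius K + |x| + R both kernels and the derivative term vanish for all n.\<close>
    define \<rho> where "\<rho> = K + norm x + R"
    have \<rho>: "\<rho> > 0" using K R by (simp add: \<rho>_def add_pos_nonneg add_nonneg_pos)
    let ?s = "\<lambda>n y. (\<phi> y * \<eta> (X n - y) - \<phi> y * \<eta> (x - y) - \<phi> y * ?D (x - y) (X n - x)) / norm (X n - x)"
    have "(\<lambda>n. \<integral>y. ?s n y \<partial>lborel) \<longlonglongrightarrow> (\<integral>y. 0 \<partial>(lborel :: 'a measure))"
    proof (rule integral_dominated_convergence[where w="\<lambda>y. indicator (cball 0 \<rho>) y *\<^sub>R (\<bar>\<phi> y\<bar> * (L + B))"])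
      show "integrable lborel (\<lambda>y. indicator (cball 0 \<rho>) y *\<^sub>R (\<bar>\<phi> y\<bar> * (L + B)))"
        by (rule borel_integrable_compact)
           (auto intro!: continuous_intros continuous_on_subset[OF \<phi>])
      show "?s n \<in> borel_measurable lborel" for n
        by (intro borel_measurable_integrable Bochner_Integration.integrable_diff
            integrable_divide_zero int)
      show "AE y in lborel. (\<lambda>n. ?s n y) \<longlonglongrightarrow> 0"
      proof (rule AE_I2)
        fix y
        have "((\<lambda>z. \<eta> (z - y)) has_derivative ?D (x - y)) (at x)"
        proof -
          have "((\<lambda>z. z - y) has_derivative (\<lambda>z. z)) (at x)"
            by (auto intro!: derivative_eq_intros)
          from has_derivative_compose[OF this smooth_fun_has_derivative[OF test_fun_smooth[OF \<eta>]]]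
          show ?thesis .
        qed
        then have "((\<lambda>z. \<phi> y * \<eta> (z - y)) has_derivative (\<lambda>v. \<phi> y * ?D (x - y) v)) (at x)"
          by (rule has_derivative_mult_right)
        then have "((\<lambda>z. (\<phi> y * \<eta> (z - y) - \<phi> y * \<eta> (x - y) - \<phi> y * ?D (x - y) (z - x)) /\<^sub>R norm (z - x)) \<longlongrightarrow> 0) (at x)"
          by (simp add: has_derivative_def Lim_ident_at)
        then show "(\<lambda>n. ?s n y) \<longlonglongrightarrow> 0"
          using X by (simp add: tendsto_at_iff_sequentially comp_def divide_inverse mult.commute)
      qed
      have "norm (?s n y) \<le> indicator (cball 0 \<rho>) y *\<^sub>R (\<bar>\<phi> y\<bar> * (L + B))" for n y
      proof (cases "norm y \<le> \<rho>")
        case True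
        have "\<bar>\<eta> (X n - y) - \<eta> (x - y)\<bar> \<le> L * norm (X n - x)"
          using L(2)[of "X n - y" "x - y"] by simp
        with B(2)[of "x - y" "X n - x"]
        have "\<bar>\<eta> (X n - y) - \<eta> (x - y) - ?D (x - y) (X n - x)\<bar> \<le> (L + B) * norm (X n - x)"
          by (simp add: distrib_right)
        then have "\<bar>\<phi> y\<bar> * \<bar>\<eta> (X n - y) - \<eta> (x - y) - ?D (x - y) (X n - x)\<bar> \<le> \<bar>\<phi> y\<bar> * ((L + B) * norm (X n - x))"
          by (intro mult_left_mono) auto
        then have "\<bar>\<phi> y * \<eta> (X n - y) - \<phi> y * \<eta> (x - y) - \<phi> y * ?D (x - y) (X n - x)\<bar>
            \<le> \<bar>\<phi> y\<bar> * (L + B) * norm (X n - x)"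
          by (simp add: abs_mult[symmetric] right_diff_distrib mult.assoc)
        then show ?thesis
          using True X(1)[of n] by (simp add: divide_le_eq)
      next
        case False
        have "norm y \<le> norm (X n - y) + norm (X n)" "norm y \<le> norm (x - y) + norm x"
          using norm_triangle_sub[of y "X n"] norm_triangle_sub[of y x] by (simp_all add: norm_minus_commute)
        then have "norm (X n - y) > R" "norm (x - y) > R"
          using False K(2)[of n] K(1) norm_ge_zero[of x] unfolding \<rho>_def by linarith+
        then have "\<eta> (X n - y) = 0" "\<eta> (x - y) = 0" "?D (x - y) (X n - x) = 0"
          using R(2)[of "X n - y"] R(2)[of "x - y"] frechet_derivative_eq_0_outside[where f=\<eta>, OF R(2)]
          by force+
        then show ?thesis using False by simp
      qed
      then show "AE y in lborel. norm (?s n y) \<le> indicator (cball 0 \<rho>) y *\<^sub>R (\<bar>\<phi> y\<bar> * (L + B))" for n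
        by simp
    qed simp
    moreover have "(\<integral>y. ?s n y \<partial>lborel) =
        ((conv \<phi> \<eta> (X n) - conv \<phi> \<eta> x) - conv \<phi> (\<lambda>z. ?D z (X n - x)) x) /\<^sub>R norm (X n - x)" for n
      using int by (simp add: conv_def divide_inverse mult.commute)
    ultimately show ?thesis by simp
  qed
  show ?thesis
    unfolding has_derivative_def
    using bl lim by (auto simp: tendsto_at_iff_sequentially Lim_ident_at comp_def)
qed

text \<open>Derivatives of the convolution are convolutions with derivatives of the kernel, which
  are again test functions; the family over all test kernels is therefore invariant under
  differentiation.\<close>

lemma smooth_fun_conv:
  assumes \<phi>: "continuous_on UNIV \<phi>" and "test_fun \<eta>"
  shows "smooth_fun (conv \<phi> \<eta>)"
proof -
  show ?thesis
    using \<open>test_fun \<eta>\<close>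
  proof (coinduction arbitrary: \<eta> rule: smooth_fun.coinduct)
    case smooth_fun
    have "frechet_derivative (conv \<phi> \<eta>) (at x) v = conv \<phi> (\<lambda>z. frechet_derivative \<eta> (at z) v) x" for x v
      using conv_has_derivative[OF \<phi> smooth_fun] by (metis (no_types, lifting) frechet_derivative_at)
    then have "(\<lambda>x. frechet_derivative (conv \<phi> \<eta>) (at x) v) = conv \<phi> (\<lambda>z. frechet_derivative \<eta> (at z) v)" for v
      by (simp add: fun_eq_iff)
    moreover have "conv \<phi> \<eta> differentiable (at x)" for x
      using conv_has_derivative[OF \<phi> smooth_fun, of x] unfolding differentiable_def by blast
    ultimately show ?case
      using test_fun_derivative[OF smooth_fun] by (metis (no_types, lifting))
  qed
qed

lemma frechet_derivative_conv:
  assumes "continuous_on UNIV \<phi>" "test_fun \<eta>"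
  shows "frechet_derivative (conv \<phi> \<eta>) (at x) v = conv \<phi> (\<lambda>z. frechet_derivative \<eta> (at z) v) x"
  using conv_has_derivative[OF assms] by (metis (no_types, lifting) frechet_derivative_at)

lemma test_fun_conv:
  assumes \<phi>: "continuous_on UNIV \<phi>" "\<And>x. \<phi> x \<noteq> 0 \<Longrightarrow> norm x \<le> S" and \<eta>: "test_fun \<eta>"
  shows "test_fun (conv \<phi> \<eta>)"
proof -
  obtain R where R: "R > 0" "\<And>x. \<eta> x \<noteq> 0 \<Longrightarrow> norm x < R"
    using test_funE[OF \<eta>] by blast
  show ?thesis
  proof (rule test_funI[where R="S + R"])
    fix x assume "conv \<phi> \<eta> x \<noteq> 0"
    then have "(\<lambda>y. \<phi> y * \<eta> (x - y)) \<noteq> (\<lambda>y. 0)"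
      unfolding conv_def by auto
    then obtain y where "\<phi> y \<noteq> 0" "\<eta> (x - y) \<noteq> 0"
      by (auto simp: fun_eq_iff)
    with \<phi>(2) R(2) have "norm y \<le> S" "norm (x - y) < R" by auto
    then show "norm x \<le> S + R"
      using norm_triangle_sub[of x y] by linarith
  qed (rule smooth_fun_conv[OF \<phi>(1) \<eta>])
qed

text \<open>The weak gradient is tested with y |-> eta (x - y). The sign from the reflection and the
  sign from integration by parts cancel.\<close>

lemma gradient_conv:
  assumes \<phi>: "continuous_on UNIV \<phi>" and wg: "weak_gradient \<phi> g" and \<eta>: "test_fun \<eta>"
  shows "integrable lborel (\<lambda>y. \<eta> (x - y) *\<^sub>R g y)"
    "gradient (conv \<phi> \<eta>) x = (\<integral>y. \<eta> (x - y) *\<^sub>R g y \<partial>lborel)"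
proof -
  note \<psi> = test_fun_reflect[OF \<eta>, of x]
  have I: "integrable lborel (\<lambda>y. (g y \<bullet> i) * \<eta> (x - y))"
    "(\<integral>y. \<phi> y * frechet_derivative (\<lambda>y. \<eta> (x - y)) (at y) i \<partial>lborel) = - (\<integral>y. (g y \<bullet> i) * \<eta> (x - y) \<partial>lborel)"
    if "i \<in> Basis" for i
    using wg \<psi> that by (auto simp: weak_gradient_def)
  have D: "frechet_derivative (\<lambda>y. \<eta> (x - y)) (at y) i = - frechet_derivative \<eta> (at (x - y)) i" for y i
    using frechet_derivative_affine[OF test_fun_smooth[OF \<eta>], of x "-1" y i] by simp
  have repr: "\<eta> (x - y) *\<^sub>R g y = (\<Sum>i\<in>Basis. ((g y \<bullet> i) * \<eta> (x - y)) *\<^sub>R i)" for y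
  proof -
    have "\<eta> (x - y) *\<^sub>R g y = \<eta> (x - y) *\<^sub>R (\<Sum>i\<in>Basis. (g y \<bullet> i) *\<^sub>R i)"
      by (simp only: euclidean_representation)
    then show ?thesis by (simp add: scaleR_sum_right mult.commute)
  qed
  show "integrable lborel (\<lambda>y. \<eta> (x - y) *\<^sub>R g y)"
    unfolding repr using I by (intro Bochner_Integration.integrable_sum integrable_scaleR_left) auto
  have "(\<integral>y. \<eta> (x - y) *\<^sub>R g y \<partial>lborel) = (\<Sum>i\<in>Basis. (\<integral>y. (g y \<bullet> i) * \<eta> (x - y) \<partial>lborel) *\<^sub>R i)"
    unfolding repr using I by (subst Bochner_Integration.integral_sum) auto
  also have "\<dots> = gradient (conv \<phi> \<eta>) x"
    unfolding gradient_def
    by (intro sum.cong refl) (use I(2) in \<open>simp add: frechet_derivative_conv[OF \<phi> \<eta>] conv_def D\<close>)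
  finally show "gradient (conv \<phi> \<eta>) x = (\<integral>y. \<eta> (x - y) *\<^sub>R g y \<partial>lborel)" ..
qed

abbreviation Lp_pow :: "real \<Rightarrow> 'b measure \<Rightarrow> ('b \<Rightarrow> 'e::real_normed_vector) \<Rightarrow> ennreal" where
  "Lp_pow p M f \<equiv> (\<integral>\<^sup>+x. ennreal (norm (f x) powr p) \<partial>M)"

section \<open>Inequalities for \<open>p\<close>-th powers\<close>

text \<open>This is a^p >= c^p + p c^(p-1) (a - c), convexity at c, rearranged so that no term is
  negative and it can be integrated in \<open>ennreal\<close>. Young's inequality covers c = 0 as
  well.\<close>

lemma powr_tangent:
  fixes a c p :: real
  assumes "0 \<le> a" "0 \<le> c" "1 < p"
  shows "c powr p + p * c powr (p - 1) * a \<le> a powr p + p * c powr p"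
proof -
  define q where "q = p / (p - 1)"
  have q: "q > 1" "1 / p + 1 / q = 1"
    using assms by (auto simp: q_def field_simps)
  have "a * c powr (p - 1) \<le> a powr p / p + (c powr (p - 1)) powr q / q"
    using assms q by (intro Youngs_inequality) auto
  also have "(c powr (p - 1)) powr q = c powr p"
    using assms by (simp add: powr_powr q_def)
  finally have "p * (a * c powr (p - 1)) \<le> p * (a powr p / p + c powr p / q)"
    using assms by (intro mult_left_mono) auto
  also have "\<dots> = a powr p + (p - 1) * c powr p"
    using assms by (simp add: q_def field_simps)
  finally show ?thesis by (simp add: algebra_simps)
qed

text \<open>The tangent inequality at c, the norm of the mean, is integrated against the probability
  density eta. The mean of the norms is at least c, and the finite common term p c^p cancels even if
  the right-hand side is infinite.\<close>

lemma jensen_powr: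
  fixes f :: "'b \<Rightarrow> 'e::{banach, second_countable_topology}" and \<eta> :: "'b \<Rightarrow> real"
  assumes int: "integrable M (\<lambda>y. \<eta> y *\<^sub>R f y)" and f[measurable]: "f \<in> borel_measurable M"
    and \<eta>: "integrable M \<eta>" "\<And>y. \<eta> y \<ge> 0" "(\<integral>y. \<eta> y \<partial>M) = 1" and p: "1 < p"
  shows "ennreal (norm (\<integral>y. \<eta> y *\<^sub>R f y \<partial>M) powr p) \<le> (\<integral>\<^sup>+y. ennreal (norm (f y) powr p * \<eta> y) \<partial>M)"
proof -
  have [measurable]: "\<eta> \<in> borel_measurable M" using \<eta> by auto
  define c where "c = norm (\<integral>y. \<eta> y *\<^sub>R f y \<partial>M)"
  have c0: "c \<ge> 0" by (simp add: c_def)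
  have int': "integrable M (\<lambda>y. norm (f y) * \<eta> y)"
    using integrable_norm[OF int] \<eta>(2) by (simp add: mult.commute)
  have "c \<le> (\<integral>y. norm (\<eta> y *\<^sub>R f y) \<partial>M)"
    unfolding c_def by (rule integral_norm_bound)
  also have "\<dots> = (\<integral>y. norm (f y) * \<eta> y \<partial>M)"
    using \<eta>(2) by (simp add: mult.commute)
  finally have c: "c \<le> (\<integral>y. norm (f y) * \<eta> y \<partial>M)" .
  have n1: "(\<integral>\<^sup>+y. ennreal (\<eta> y) \<partial>M) = 1"
    using \<eta> by (simp add: nn_integral_eq_integral)
  have n2: "(\<integral>\<^sup>+y. ennreal (norm (f y) * \<eta> y) \<partial>M) \<ge> ennreal c"
    using c \<eta>(2) int' by (simp add: nn_integral_eq_integral ennreal_leI)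
  have k: "p * c powr (p - 1) \<ge> 0" "p * c powr p \<ge> 0" "c powr p \<ge> 0" using p by auto
  have "ennreal (c powr p) + ennreal (p * c powr p)
      = ennreal (c powr p) * 1 + ennreal (p * c powr (p - 1)) * ennreal c"
  proof (cases "c = 0")
    case False
    then have "c powr (p - 1) * c = c powr p"
      using c0 powr_add[of c "p - 1" 1] by simp
    then show ?thesis using k c0 by (simp add: ennreal_mult[symmetric] mult.assoc)
  qed simp
  also have "\<dots> \<le> ennreal (c powr p) * (\<integral>\<^sup>+y. ennreal (\<eta> y) \<partial>M) +
      ennreal (p * c powr (p - 1)) * (\<integral>\<^sup>+y. ennreal (norm (f y) * \<eta> y) \<partial>M)"
    unfolding n1 by (intro add_mono mult_left_mono n2) auto
  also have "\<dots> = (\<integral>\<^sup>+y. ennreal ((c powr p + p * c powr (p - 1) * norm (f y)) * \<eta> y) \<partial>M)"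
  proof -
    have "ennreal ((c powr p + p * c powr (p - 1) * norm (f y)) * \<eta> y) =
        ennreal (c powr p) * ennreal (\<eta> y) + ennreal (p * c powr (p - 1)) * ennreal (norm (f y) * \<eta> y)" for y
      using k \<eta>(2)[of y] unfolding distrib_right mult.assoc[of "p * c powr (p - 1)"]
      by (subst ennreal_plus) (auto simp: ennreal_mult)
    then show ?thesis by (simp add: nn_integral_add nn_integral_cmult)
  qed
  also have "\<dots> \<le> (\<integral>\<^sup>+y. ennreal ((norm (f y) powr p + p * c powr p) * \<eta> y) \<partial>M)"
    by (intro nn_integral_mono ennreal_leI mult_right_mono powr_tangent \<eta> c0 p) auto
  also have "\<dots> = (\<integral>\<^sup>+y. ennreal (norm (f y) powr p * \<eta> y) \<partial>M) + ennreal (p * c powr p) * (\<integral>\<^sup>+y. ennreal (\<eta> y) \<partial>M)"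
  proof -
    have "ennreal ((norm (f y) powr p + p * c powr p) * \<eta> y) =
        ennreal (norm (f y) powr p * \<eta> y) + ennreal (p * c powr p) * ennreal (\<eta> y)" for y
      using k \<eta>(2)[of y] unfolding distrib_right by (subst ennreal_plus) (auto simp: ennreal_mult)
    then show ?thesis by (simp add: nn_integral_add nn_integral_cmult)
  qed
  finally have "ennreal (c powr p) + ennreal (p * c powr p)
      \<le> (\<integral>\<^sup>+y. ennreal (norm (f y) powr p * \<eta> y) \<partial>M) + ennreal (p * c powr p)"
    by (simp add: n1)
  then have "ennreal (p * c powr p) + ennreal (c powr p)
      \<le> ennreal (p * c powr p) + (\<integral>\<^sup>+y. ennreal (norm (f y) powr p * \<eta> y) \<partial>M)"
    by (simp only: add.commute)
  then have "ennreal (c powr p) \<le> (\<integral>\<^sup>+y. ennreal (norm (f y) powr p * \<eta> y) \<partial>M)"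
    by (simp add: ennreal_add_left_cancel_le)
  then show ?thesis
    unfolding c_def .
qed

text \<open>Either |a| <= t |b| or |b| < |a| / t, and one summand absorbs the other. For small t the
  coefficient of |b|^p is close to 1, the price being a large one for |a|^p.\<close>

lemma powr_norm_add_le:
  fixes a b :: "'e::real_normed_vector"
  assumes "0 < t" "0 < p"
  shows "norm (a + b) powr p \<le> (1 + t) powr p * norm b powr p + (1 + 1 / t) powr p * norm a powr p"
proof (cases "norm a \<le> t * norm b")
  case True
  have "norm (a + b) \<le> (1 + t) * norm b"
    using norm_triangle_ineq[of a b] True by (simp add: distrib_right)
  then have "norm (a + b) powr p \<le> ((1 + t) * norm b) powr p"
    using assms by (intro powr_mono2) auto
  then show ?thesis
    using assms by (simp add: powr_mult add_increasing2)
next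
  case False
  then have "norm b \<le> (1 / t) * norm a"
    using assms by (simp add: field_simps)
  then have "norm (a + b) \<le> (1 + 1 / t) * norm a"
    using norm_triangle_ineq[of a b] by (simp add: distrib_right)
  then have "norm (a + b) powr p \<le> ((1 + 1 / t) * norm a) powr p"
    using assms by (intro powr_mono2) auto
  then show ?thesis
    using assms by (simp add: powr_mult add_increasing)
qed

lemma nn_integral_powr_add_le:
  fixes f g :: "'b \<Rightarrow> 'e::{real_normed_vector, second_countable_topology}"
  assumes [measurable]: "f \<in> borel_measurable M" "g \<in> borel_measurable M" and "0 < t" "0 < p"
  shows "Lp_pow p M (\<lambda>x. f x + g x)
    \<le> ennreal ((1 + t) powr p) * Lp_pow p M g
      + ennreal ((1 + 1 / t) powr p) * Lp_pow p M f"
proof -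
  have "Lp_pow p M (\<lambda>x. f x + g x) \<le>
     (\<integral>\<^sup>+x. ennreal ((1 + t) powr p) * ennreal (norm (g x) powr p) + ennreal ((1 + 1 / t) powr p) * ennreal (norm (f x) powr p) \<partial>M)"
    using powr_norm_add_le[OF assms(3,4)]
    by (intro nn_integral_mono) (simp add: ennreal_mult[symmetric] ennreal_plus[symmetric] ennreal_leI del: ennreal_plus)
  also have "\<dots> = ennreal ((1 + t) powr p) * Lp_pow p M g
      + ennreal ((1 + 1 / t) powr p) * Lp_pow p M f"
    by (simp add: nn_integral_add nn_integral_cmult)
  finally show ?thesis .
qed

section \<open>A Banach--Saks property\<close>

text \<open>A Brezis-Lieb type estimate: adding a late \<open>D k\<close> costs at most a fixed amount of energy, so \<open>K\<close> such
  additions cost \<open>O(K)\<close>, while averaging gains the factor \<open>K\<^sup>-\<^sup>p\<close>.\<close>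

lemma banach_saks_step:
  fixes D :: "nat \<Rightarrow> 'b \<Rightarrow> 'e::{real_normed_vector, second_countable_topology}"
  assumes [measurable]: "\<And>k. D k \<in> borel_measurable M" "f \<in> borel_measurable M"
    and bound: "\<And>k. Lp_pow p M (D k) \<le> ennreal C"
    and lim: "\<And>x. x \<in> space M \<Longrightarrow> (\<lambda>k. D k x) \<longlonglongrightarrow> 0"
    and f: "Lp_pow p M f < \<infinity>" and p: "1 < p" and C: "C \<ge> 0"
  shows "\<exists>k\<ge>n0. Lp_pow p M (\<lambda>x. f x + D k x)
    \<le> Lp_pow p M f + ennreal (2 * C + 1)"
proof -
  have "((\<lambda>t. (1 + t) powr p) \<longlongrightarrow> (1 + 0) powr p) (at_right (0::real))"
    by (intro tendsto_intros) auto
  then have "((\<lambda>t. (1 + t) powr p) \<longlongrightarrow> 1) (at_right (0::real))"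
    by simp
  then have "eventually (\<lambda>t. (1 + t) powr p < 2) (at_right (0::real))"
    by (rule order_tendstoD) simp
  then have "eventually (\<lambda>t. (1 + t) powr p < 2 \<and> 0 < t) (at_right (0::real))"
    using eventually_at_right_less eventually_conj by blast
  then obtain t :: real where t: "(1 + t) powr p < 2" "0 < t"
    using eventually_happens'[OF trivial_limit_at_right_real] by blast
  define A where "A = (1 + 1 / t) powr p"
  have A: "A \<ge> 0" by (simp add: A_def)
  \<comment> \<open>The excess over |f|^p + 2 |D k|^p. The choice of t makes it at most A |f|^p, an
    integrable bound independent of k, and it tends to 0 pointwise; a late index has excess below 1,
    which is the 1 in 2 C + 1.\<close>
  define h where "h k x = max 0 (norm (f x + D k x) powr p - 2 * norm (D k x) powr p - norm (f x) powr p)" for k x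
  have hA: "h k x \<le> A * norm (f x) powr p" for k x
  proof -
    have "norm (f x + D k x) powr p \<le> 2 * norm (D k x) powr p + A * norm (f x) powr p"
      using powr_norm_add_le[OF t(2), of p "f x" "D k x"] p t(1)
        mult_right_mono[of "(1 + t) powr p" 2 "norm (D k x) powr p"]
      by (simp add: A_def)
    then show ?thesis
      unfolding h_def using A powr_ge_zero[of "norm (f x)" p]
      by (intro max.boundedI mult_nonneg_nonneg) linarith+
  qed
  have "(\<lambda>k. \<integral>\<^sup>+x. ennreal (h k x) \<partial>M) \<longlonglongrightarrow> (\<integral>\<^sup>+x. 0 \<partial>M)"
  proof (rule nn_integral_dominated_convergence[where w="\<lambda>x. ennreal (A * norm (f x) powr p)"])
    show "(\<lambda>x. ennreal (h k x)) \<in> borel_measurable M" for k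
      unfolding h_def by measurable
    show "(\<integral>\<^sup>+x. ennreal (A * norm (f x) powr p) \<partial>M) < \<infinity>"
      using f A by (simp add: ennreal_mult nn_integral_cmult ennreal_mult_less_top)
    show "AE x in M. ennreal (h k x) \<le> ennreal (A * norm (f x) powr p)" for k
      using hA by (simp add: ennreal_leI)
    show "AE x in M. (\<lambda>k. ennreal (h k x)) \<longlonglongrightarrow> 0"
    proof (rule AE_I2)
      fix x assume "x \<in> space M"
      then have "(\<lambda>k. h k x) \<longlonglongrightarrow> max 0 (norm (f x + 0) powr p - 2 * norm (0::'e) powr p - norm (f x) powr p)"
        unfolding h_def using p
        by (intro tendsto_max tendsto_diff tendsto_mult tendsto_const tendsto_powr' tendsto_norm tendsto_add lim)
           auto
      then have "(\<lambda>k. h k x) \<longlonglongrightarrow> 0" by simp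
      then show "(\<lambda>k. ennreal (h k x)) \<longlonglongrightarrow> 0"
        using tendsto_ennrealI by fastforce
    qed
  qed auto
  then have "eventually (\<lambda>k. (\<integral>\<^sup>+x. ennreal (h k x) \<partial>M) < 1) sequentially"
    by (intro order_tendstoD(2)) auto
  then have "eventually (\<lambda>k. (\<integral>\<^sup>+x. ennreal (h k x) \<partial>M) < 1 \<and> n0 \<le> k) sequentially"
    by (intro eventually_conj eventually_ge_at_top)
  then obtain k where k: "(\<integral>\<^sup>+x. ennreal (h k x) \<partial>M) < 1" "n0 \<le> k"
    using eventually_happens'[OF sequentially_bot] by blast
  have "Lp_pow p M (\<lambda>x. f x + D k x) \<le>
     (\<integral>\<^sup>+x. (ennreal (norm (f x) powr p) + 2 * ennreal (norm (D k x) powr p)) + ennreal (h k x) \<partial>M)"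
  proof (intro nn_integral_mono)
    fix x
    have "norm (f x + D k x) powr p \<le> norm (f x) powr p + 2 * norm (D k x) powr p + h k x"
      unfolding h_def by auto
    then have "ennreal (norm (f x + D k x) powr p) \<le> ennreal (norm (f x) powr p + 2 * norm (D k x) powr p + h k x)"
      by (rule ennreal_leI)
    also have "\<dots> = (ennreal (norm (f x) powr p) + ennreal 2 * ennreal (norm (D k x) powr p)) + ennreal (h k x)"
      by (simp add: h_def ennreal_mult)
    finally show "ennreal (norm (f x + D k x) powr p) \<le> (ennreal (norm (f x) powr p) + 2 * ennreal (norm (D k x) powr p)) + ennreal (h k x)"
      by simp
  qed
  also have "\<dots> = Lp_pow p M f + 2 * Lp_pow p M (D k) + (\<integral>\<^sup>+x. ennreal (h k x) \<partial>M)"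
    by (simp add: nn_integral_add nn_integral_cmult h_def)
  also have "\<dots> \<le> Lp_pow p M f + 2 * ennreal C + 1"
    using k(1) by (intro add_mono mult_left_mono bound) auto
  finally have "Lp_pow p M (\<lambda>x. f x + D k x) \<le> Lp_pow p M f + 2 * ennreal C + 1" .
  moreover have "2 * ennreal C + 1 = ennreal (2 * C + 1)"
    using C by (simp add: ennreal_mult)
  ultimately show ?thesis using k(2) by (auto simp: add.assoc)
qed

text \<open>The p-th power of the average has integral at most K^(1-p) (2 C + 1), which tends to 0
  because p > 1. The threshold \<open>n0\<close> lets pointwise properties that hold for all late
  indices pass to the average.\<close>

lemma banach_saks:
  fixes D :: "nat \<Rightarrow> 'b \<Rightarrow> 'e::{real_normed_vector, second_countable_topology}"
  assumes [measurable]: "\<And>k. D k \<in> borel_measurable M"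
    and bound: "\<And>k. Lp_pow p M (D k) \<le> ennreal C"
    and lim: "\<And>x. x \<in> space M \<Longrightarrow> (\<lambda>k. D k x) \<longlonglongrightarrow> 0"
    and p: "1 < p" and C: "C \<ge> 0" and e: "e > 0"
  obtains K :: nat and r :: "nat \<Rightarrow> nat" where "K > 0" "\<And>j. j < K \<Longrightarrow> n0 \<le> r j"
    "Lp_pow p M (\<lambda>x. (1 / real K) *\<^sub>R (\<Sum>j<K. D (r j) x)) \<le> ennreal e"
proof -
  \<comment> \<open>The indices are found one after the other, since the next one depends on the sum
    already formed; nothing forces them to be distinct.\<close>
  have ex: "\<exists>r. (\<forall>j<K. n0 \<le> r j) \<and>
    Lp_pow p M (\<lambda>x. \<Sum>j<K. D (r j) x) \<le> ennreal (real K * (2 * C + 1))" for K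
  proof (induction K)
    case 0
    then show ?case by simp
  next
    case (Suc K)
    then obtain r :: "nat \<Rightarrow> nat" where r: "\<forall>j<K. n0 \<le> r j"
      "Lp_pow p M (\<lambda>x. \<Sum>j<K. D (r j) x) \<le> ennreal (real K * (2 * C + 1))" by blast
    have fin: "Lp_pow p M (\<lambda>x. \<Sum>j<K. D (r j) x) < \<infinity>"
      using r(2) ennreal_less_top order_le_less_trans by (metis infinity_ennreal_def)
    have meas: "(\<lambda>x. \<Sum>j<K. D (r j) x) \<in> borel_measurable M" by measurable
    obtain k where k: "k \<ge> n0" "Lp_pow p M (\<lambda>x. (\<Sum>j<K. D (r j) x) + D k x)
       \<le> Lp_pow p M (\<lambda>x. \<Sum>j<K. D (r j) x) + ennreal (2 * C + 1)"
      using banach_saks_step[OF assms(1) meas bound lim fin p C, of n0] by blast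
    have "Lp_pow p M (\<lambda>x. (\<Sum>j<K. D (r j) x) + D k x) \<le>
       ennreal (real K * (2 * C + 1)) + ennreal (2 * C + 1)"
      using k(2) r(2) by (meson add_right_mono order_trans)
    also have "\<dots> = ennreal (real (Suc K) * (2 * C + 1))"
      using C by (subst ennreal_plus[symmetric]) (auto simp: algebra_simps)
    finally have "Lp_pow p M (\<lambda>x. \<Sum>j<Suc K. D ((r(K := k)) j) x) \<le> ennreal (real (Suc K) * (2 * C + 1))"
      by simp
    moreover have "\<forall>j<Suc K. n0 \<le> (r(K := k)) j"
      using r(1) k(1) by (auto simp: less_Suc_eq)
    ultimately show ?case by blast
  qed
  have "((\<lambda>K. real K powr (1 - p) * (2 * C + 1)) \<longlongrightarrow> 0 * (2 * C + 1)) sequentially"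
    using p by (intro tendsto_mult tendsto_const tendsto_neg_powr filterlim_real_sequentially) auto
  then have "eventually (\<lambda>K. real K powr (1 - p) * (2 * C + 1) < e) sequentially"
    using e by (intro order_tendstoD(2)) auto
  then have "eventually (\<lambda>K. real K powr (1 - p) * (2 * C + 1) < e \<and> K > 0) sequentially"
    by (intro eventually_conj eventually_gt_at_top)
  then obtain K :: nat where K: "real K powr (1 - p) * (2 * C + 1) < e" "K > 0"
    using eventually_happens'[OF sequentially_bot] by blast
  obtain r :: "nat \<Rightarrow> nat" where r: "\<forall>j<K. n0 \<le> r j"
      "Lp_pow p M (\<lambda>x. \<Sum>j<K. D (r j) x) \<le> ennreal (real K * (2 * C + 1))"
    using ex by blast
  have "Lp_pow p M (\<lambda>x. (1 / real K) *\<^sub>R (\<Sum>j<K. D (r j) x)) =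
      (\<integral>\<^sup>+x. ennreal (real K powr (- p)) * ennreal (norm (\<Sum>j<K. D (r j) x) powr p) \<partial>M)"
    using K(2) by (intro nn_integral_cong) (simp add: powr_mult powr_divide powr_minus_divide ennreal_mult[symmetric])
  also have "\<dots> = ennreal (real K powr (- p)) * Lp_pow p M (\<lambda>x. \<Sum>j<K. D (r j) x)"
    by (rule nn_integral_cmult) measurable
  also have "\<dots> \<le> ennreal (real K powr (- p)) * ennreal (real K * (2 * C + 1))"
    by (intro mult_left_mono r(2)) auto
  also have "\<dots> = ennreal (real K powr (1 - p) * (2 * C + 1))"
    using K(2) C powr_add[of "real K" "-p" 1] by (simp add: ennreal_mult[symmetric] mult.assoc)
  also have "\<dots> \<le> ennreal e"
    using K(1) by (intro ennreal_leI) auto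
  finally show ?thesis
    using that[of K r] K(2) r(1) by blast
qed

section \<open>Uniform convexity\<close>

text \<open>The mean value theorem on the two halves of the interval compares the slopes, and the
  derivative is strictly increasing. It is evaluated at interior points only, so x = 0 is
  allowed.\<close>

lemma powr_midpoint_strict_real:
  fixes x y p :: real
  assumes p: "1 < p" and "0 \<le> x" "0 \<le> y" "x < y"
  shows "((x + y) / 2) powr p < (x powr p + y powr p) / 2"
proof -
  define m where "m = (x + y) / 2"
  have m: "x < m" "m < y" "0 < m" using assms by (auto simp: m_def)
  have mv: "\<exists>\<xi>>a. \<xi> < b \<and> b powr p - a powr p = p * \<xi> powr (p - 1) * (b - a)"
    if "0 \<le> a" "a < b" for a b
  proof -
    have "continuous_on {a..b} (\<lambda>x. x powr p)"
      using p that by (intro continuous_on_powr') (auto intro: continuous_intros)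
    moreover have "((\<lambda>x. x powr p) has_derivative (\<lambda>h. p * \<xi> powr (p - 1) * h)) (at \<xi>)" if "a < \<xi>" for \<xi>
      using has_real_derivative_powr[of \<xi> p] that \<open>0 \<le> a\<close> by (simp add: has_field_derivative_def)
    ultimately show ?thesis
      using mvt[OF that(2), of "\<lambda>x. x powr p" "\<lambda>\<xi> h. p * \<xi> powr (p - 1) * h"] by metis
  qed
  obtain \<xi> where \<xi>: "x < \<xi>" "\<xi> < m" "m powr p - x powr p = p * \<xi> powr (p - 1) * (m - x)"
    using mv[of x m] assms m by auto
  obtain \<zeta> where \<zeta>: "m < \<zeta>" "\<zeta> < y" "y powr p - m powr p = p * \<zeta> powr (p - 1) * (y - m)"
    using mv[of m y] assms m by auto
  have "\<xi> powr (p - 1) < \<zeta> powr (p - 1)"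
    using \<xi> \<zeta> assms by (intro powr_less_mono2) auto
  then have "p * \<xi> powr (p - 1) * (m - x) < p * \<zeta> powr (p - 1) * (m - x)"
    using p m by simp
  also have "m - x = y - m" by (simp add: m_def field_simps)
  finally have "m powr p - x powr p < y powr p - m powr p"
    using \<xi>(3) \<zeta>(3) \<open>m - x = y - m\<close> by simp
  then show ?thesis by (simp add: m_def)
qed

text \<open>Strictness has two sources: a strict triangle inequality, or different norms. If both
  fail, a and b are parallel vectors of equal length and hence equal.\<close>

lemma powr_midpoint_strict:
  fixes a b :: "'e::euclidean_space"
  assumes p: "1 < p" and "a \<noteq> b"
  shows "norm ((1/2) *\<^sub>R (a + b)) powr p < (norm a powr p + norm b powr p) / 2"
proof -
  define c where "c = (norm a + norm b) / 2"
  have c: "c \<ge> 0" "c > 0"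
    using assms(2) by (auto simp: c_def add_pos_nonneg add_nonneg_pos add_nonneg_eq_0_iff order_less_le)
  have le: "norm ((1/2) *\<^sub>R (a + b)) \<le> c"
    using norm_triangle_ineq[of a b] by (simp add: c_def)
  have cc: "c powr (p - 1) * c = c powr p"
    using c powr_add[of c "p - 1" 1] by simp
  have ta: "c powr p + p * c powr (p - 1) * norm a \<le> norm a powr p + p * c powr p"
    and tb: "c powr p + p * c powr (p - 1) * norm b \<le> norm b powr p + p * c powr p"
    using p c by (auto intro!: powr_tangent)
  have sum: "p * c powr (p - 1) * norm a + p * c powr (p - 1) * norm b = 2 * (p * c powr p)"
  proof -
    have "p * c powr (p - 1) * norm a + p * c powr (p - 1) * norm b = p * c powr (p - 1) * (2 * c)"
      by (simp add: c_def algebra_simps)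
    then show ?thesis using cc by (simp add: algebra_simps)
  qed
  have mid: "c powr p \<le> (norm a powr p + norm b powr p) / 2"
    using ta tb sum by argo
  show ?thesis
  proof (cases "norm ((1/2) *\<^sub>R (a + b)) < c")
    case True
    then have "norm ((1/2) *\<^sub>R (a + b)) powr p < c powr p"
      using p by (intro powr_less_mono2) auto
    then show ?thesis using mid by linarith
  next
    case False
    then have eq: "norm (a + b) = norm a + norm b"
      using le by (simp add: c_def)
    have ne: "norm a \<noteq> norm b"
    proof
      assume n: "norm a = norm b"
      have "norm a *\<^sub>R b = norm b *\<^sub>R a"
        using eq norm_triangle_eq by blast
      then have "a = b" using n by (cases "norm a = 0") auto
      then show False using assms by simp
    qed
    have "c powr p < (norm a powr p + norm b powr p) / 2"
      unfolding c_def
      using powr_midpoint_strict_real[OF p norm_ge_zero norm_ge_zero, of a b]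
        powr_midpoint_strict_real[OF p norm_ge_zero norm_ge_zero, of b a] ne
      by (cases "norm a < norm b") (simp_all add: add.commute)
    then show ?thesis using powr_mono2[OF _ _ le, of p] p by auto
  qed
qed


lemma powr_midpoint:
  fixes a b :: "'e::euclidean_space"
  assumes "1 < p"
  shows "norm ((1/2) *\<^sub>R (a + b)) powr p \<le> (norm a powr p + norm b powr p) / 2"
proof (cases "a = b")
  case True
  then have "(1/2) *\<^sub>R (a + b) = b"
    by (simp add: scaleR_2[symmetric])
  with True show ?thesis by simp
qed (use powr_midpoint_strict[OF assms] in \<open>auto intro: less_imp_le\<close>)

text \<open>All terms are homogeneous of degree p in the pair (a, b), so compactness of the unit
  sphere turns strict convexity into a quantitative estimate. Integrated, this pointwise form serves
  every p > 1, without separate Clarkson inequalities for p below and above 2.\<close>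

lemma uniform_convexity_powr:
  assumes p: "1 < p" and e: "0 < e"
  obtains C where "C \<ge> 0" "\<And>a b :: 'e::euclidean_space.
    norm (a - b) powr p \<le> e * (norm a powr p + norm b powr p)
      + C * ((norm a powr p + norm b powr p) / 2 - norm ((1/2) *\<^sub>R (a + b)) powr p)"
proof -
  define Q where "Q z = norm (fst z) powr p + norm (snd z) powr p" for z :: "'e \<times> 'e"
  define G where "G z = Q z / 2 - norm ((1/2) *\<^sub>R (fst z + snd z)) powr p" for z :: "'e \<times> 'e"
  define N where "N z = norm (fst z - snd z) powr p" for z :: "'e \<times> 'e"
  have cont: "continuous_on S Q" "continuous_on S G" "continuous_on S N" for S
    unfolding Q_def G_def N_def using p by (auto intro!: continuous_intros continuous_on_powr')
  have G0: "G z \<ge> 0" for z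
    using powr_midpoint[OF p, of "fst z" "snd z"] by (simp add: G_def Q_def)
  have Q0: "Q z \<ge> 0" for z by (simp add: Q_def)
  \<comment> \<open>The part of the sphere where the first term alone does not give a strict bound.
    There a and b differ, so the convexity defect G is positive, and compactness bounds it below by
    some c > 0.\<close>
  define T where "T = {z \<in> sphere 0 1. e * Q z \<le> N z}"
  have cl: "closed {z. e * Q z \<le> N z}"
    by (intro closed_Collect_le continuous_intros cont)
  have "compact T"
  proof -
    have "T = sphere 0 1 \<inter> {z. e * Q z \<le> N z}" by (auto simp: T_def)
    then show ?thesis
      using compact_Int_closed[OF compact_sphere cl] by simp
  qed
  have Gpos: "G z > 0" if "z \<in> T" for z
  proof -
    have "fst z \<noteq> snd z"
    proof
      assume eq: "fst z = snd z"
      then have "e * Q z \<le> 0" using that by (simp add: T_def N_def)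
      then have "Q z = 0" using e Q0[of z] by (simp add: mult_le_0_iff)
      then have "snd z = 0" using eq by (simp add: Q_def)
      then have "z = 0" using eq by (simp add: prod_eq_iff)
      then show False using that by (simp add: T_def)
    qed
    then show ?thesis
      using powr_midpoint_strict[OF p] by (simp add: G_def Q_def)
  qed
  obtain c where c: "c > 0" "\<And>z. z \<in> T \<Longrightarrow> c \<le> G z"
  proof (cases "T = {}")
    case True
    then show ?thesis using that[of 1] by auto
  next
    case False
    then obtain z0 where "z0 \<in> T" "\<And>z. z \<in> T \<Longrightarrow> G z0 \<le> G z"
      using continuous_attains_inf[OF \<open>compact T\<close> False cont(2)] by blast
    then show ?thesis using that[of "G z0"] Gpos by blast
  qed
  \<comment> \<open>On the unit sphere |a - b| <= 2, so N <= 2^p = C c <= C G on T.\<close>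
  define C where "C = 2 powr p / c"
  have C: "C \<ge> 0" using c by (simp add: C_def)
  have sph: "N z \<le> e * Q z + C * G z" if "norm z = 1" for z
  proof (cases "z \<in> T")
    case True
    have "norm (fst z - snd z) \<le> 2"
      using norm_triangle_ineq4[of "fst z" "snd z"] norm_fst_le[of "fst z" "snd z"] norm_snd_le[of "snd z" "fst z"] that
      by simp
    then have "N z \<le> 2 powr p"
      unfolding N_def using p by (intro powr_mono2) auto
    also have "2 powr p = C * c" using c by (simp add: C_def)
    also have "\<dots> \<le> C * G z" using c True C by (intro mult_left_mono) auto
    finally show ?thesis using e Q0[of z] by (simp add: add_increasing)
  next
    case False
    then have "N z \<le> e * Q z" using that by (simp add: T_def)
    then show ?thesis using C G0[of z] by (simp add: add_increasing2)
  qed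
  have "N z \<le> e * Q z + C * G z" for z
  proof (cases "z = 0")
    case True
    then show ?thesis by (simp add: N_def Q_def G_def)
  next
    case False
    define r where "r = norm z"
    have r: "r > 0" using False by (simp add: r_def)
    define w where "w = (1 / r) *\<^sub>R z"
    have w: "norm w = 1" using r by (simp add: w_def r_def)
    have z: "z = r *\<^sub>R w" using r by (simp add: w_def)
    have "N z = r powr p * N w"
      using r by (simp add: z N_def powr_mult flip: scaleR_diff_right)
    moreover have Qz: "Q z = r powr p * Q w"
      using r by (simp add: z Q_def powr_mult distrib_left)
    moreover have "G z = r powr p * G w"
    proof -
      have "norm ((1/2) *\<^sub>R (fst z + snd z)) powr p = r powr p * norm ((1/2) *\<^sub>R (fst w + snd w)) powr p"
        using r by (simp add: z powr_mult powr_divide flip: scaleR_add_right)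
      then show ?thesis by (simp add: G_def Qz algebra_simps)
    qed
    moreover have "r powr p * N w \<le> r powr p * (e * Q w + C * G w)"
      by (intro mult_left_mono sph w) auto
    ultimately show ?thesis by (simp add: algebra_simps)
  qed
  from this[of "(_, _)"] show ?thesis
    using C that[of C] by (simp add: N_def Q_def G_def)
qed

section \<open>Mollifiers\<close>

text \<open>The standard bump exp (-1 / (r^2 - |x|^2)) inside the ball of radius r, extended by
  0.\<close>

definition bump :: "real \<Rightarrow> 'a::euclidean_space \<Rightarrow> real" where
  "bump r x = flat_exp 1 (r\<^sup>2 - x \<bullet> x)"

lemma bump_pos_iff: "0 < r \<Longrightarrow> bump r x > 0 \<longleftrightarrow> norm x < r"
  using power_mono_iff[of r "norm x" 2]
  by (auto simp: bump_def flat_exp_def power2_norm_eq_inner[symmetric] not_le[symmetric])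

lemma bump_nonneg: "bump r x \<ge> 0"
  by (simp add: bump_def flat_exp_def)

lemma bump_support: "0 < r \<Longrightarrow> bump r x \<noteq> 0 \<Longrightarrow> norm x < r"
  using bump_pos_iff[of r x] bump_nonneg[of r x] by auto

lemma test_fun_bump: "0 < r \<Longrightarrow> test_fun (bump r)"
  unfolding bump_def[abs_def]
  by (rule test_funI[where R=r])
     (use bump_support[of r] in \<open>auto simp: bump_def intro: smooth_fun_flat_exp less_imp_le\<close>)

definition mollifier :: "real \<Rightarrow> ('a::euclidean_space \<Rightarrow> real) \<Rightarrow> bool" where
  "mollifier r \<eta> \<longleftrightarrow> test_fun \<eta> \<and> (\<forall>x. 0 \<le> \<eta> x) \<and> (\<forall>x. \<eta> x \<noteq> 0 \<longrightarrow> norm x < r) \<and> (\<integral>x. \<eta> x \<partial>lborel) = 1"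

lemma mollifier_exists:
  assumes "0 < r"
  obtains \<eta> :: "'a::euclidean_space \<Rightarrow> real" where "mollifier r \<eta>"
proof -
  define I where "I = (\<integral>x. bump r (x::'a) \<partial>lborel)"
  have "I \<noteq> 0"
  proof
    assume "I = 0"
    then have "AE x in lborel. bump r (x::'a) = 0"
      unfolding I_def
      by (subst (asm) integral_nonneg_eq_0_iff_AE) (auto simp: bump_nonneg integrable_test_fun test_fun_bump assms)
    then have "AE x in lborel. \<not> (x::'a) \<in> ball 0 r"
      by eventually_elim (use bump_pos_iff[OF assms] in force)
    then have "emeasure lborel {x \<in> space lborel. (x::'a) \<in> ball 0 r} = 0"
      by (rule emeasure_eq_0_AE)
    moreover have "{x \<in> space lborel. (x::'a) \<in> ball 0 r} = ball 0 r" by auto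
    ultimately have "measure lborel (ball (0::'a) r) = 0"
      by (simp only: measure_def enn2real_0)
    then show False
      using content_ball_pos[OF assms, of "0::'a"] by simp
  qed
  moreover have "I \<ge> 0"
    unfolding I_def by (rule Bochner_Integration.integral_nonneg) (simp add: bump_nonneg)
  ultimately have I: "I > 0" by simp
  have "mollifier r (\<lambda>x::'a. (1 / I) * bump r x)"
    unfolding mollifier_def
  proof (intro conjI allI impI)
    show "test_fun (\<lambda>x::'a. (1 / I) * bump r x)"
      by (intro test_fun_cmult test_fun_bump assms)
    show "(\<integral>x. (1 / I) * bump r (x::'a) \<partial>lborel) = 1"
      using I by (simp add: I_def)
  qed (use I bump_support[OF assms] in \<open>auto simp: bump_nonneg\<close>)
  then show ?thesis by (rule that)
qed

section \<open>Mollification: closeness, Hoelder bound and energy\<close>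

lemma conv_diff:
  assumes "continuous_on UNIV \<phi>" "test_fun \<eta>"
  shows "integrable lborel (\<lambda>z. \<eta> z *\<^sub>R (\<phi> (x - z) - \<phi> (y - z)))"
    "conv \<phi> \<eta> x - conv \<phi> \<eta> y = (\<integral>z. \<eta> z *\<^sub>R (\<phi> (x - z) - \<phi> (y - z)) \<partial>lborel)"
  using conv_alt[OF assms, of x] conv_alt[OF assms, of y]
  by (simp_all add: right_diff_distrib mult.commute)

lemma mollifier_weighted_bound:
  assumes "mollifier r \<eta>" "integrable lborel (\<lambda>z. \<eta> z *\<^sub>R (h z::real))" "\<And>z. norm z < r \<Longrightarrow> \<bar>h z\<bar> \<le> e"
  shows "\<bar>\<integral>z. \<eta> z *\<^sub>R h z \<partial>lborel\<bar> \<le> e"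
proof -
  have \<eta>: "test_fun \<eta>" "\<And>x. 0 \<le> \<eta> x" "\<And>x. \<eta> x \<noteq> 0 \<Longrightarrow> norm x < r" "(\<integral>x. \<eta> x \<partial>lborel) = 1"
    using assms(1) by (auto simp: mollifier_def)
  have "\<bar>\<integral>z. \<eta> z *\<^sub>R h z \<partial>lborel\<bar> \<le> (\<integral>z. \<bar>\<eta> z *\<^sub>R h z\<bar> \<partial>lborel)"
    by (rule integral_abs_bound)
  also have "\<dots> \<le> (\<integral>z. \<eta> z * e \<partial>lborel)"
  proof (rule integral_mono)
    show "integrable lborel (\<lambda>z. \<eta> z * e)"
      using integrable_test_fun[OF \<eta>(1)] by simp
    show "\<bar>\<eta> z *\<^sub>R h z\<bar> \<le> \<eta> z * e" for z
      using \<eta>(2)[of z] \<eta>(3)[of z] assms(3)[of z] by (cases "\<eta> z = 0") (auto simp: abs_mult mult_left_mono)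
  qed (use assms(2) in auto)
  also have "\<dots> = e" using \<eta>(4) by simp
  finally show ?thesis .
qed

text \<open>The radius comes from continuity of phi at x alone and serves every mollifier of that
  radius, so one mollifier can be used for several points at once.\<close>

lemma conv_close:
  assumes "continuous_on UNIV \<phi>" "e > 0"
  obtains r where "r > 0" "\<And>\<eta> :: 'a::euclidean_space \<Rightarrow> real. mollifier r \<eta> \<Longrightarrow> \<bar>conv \<phi> \<eta> x - \<phi> x\<bar> \<le> e"
proof -
  have "isCont \<phi> x" using assms(1) by (simp add: continuous_on_eq_continuous_at)
  then obtain r where r: "r > 0" "\<And>y. dist y x < r \<Longrightarrow> dist (\<phi> y) (\<phi> x) < e"
    using assms(2) by (metis continuous_at_eps_delta)
  have "\<bar>conv \<phi> \<eta> x - \<phi> x\<bar> \<le> e" if m: "mollifier r \<eta>" for \<eta>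
  proof -
    have \<eta>: "test_fun \<eta>" "(\<integral>x. \<eta> x \<partial>lborel) = 1" using m by (auto simp: mollifier_def)
    note i = conv_alt[OF assms(1) \<eta>(1), of x] integrable_test_fun[OF \<eta>(1)]
    have "integrable lborel (\<lambda>z. \<eta> z *\<^sub>R (\<phi> (x - z) - \<phi> x))"
      "conv \<phi> \<eta> x - \<phi> x = (\<integral>z. \<eta> z *\<^sub>R (\<phi> (x - z) - \<phi> x) \<partial>lborel)"
      using i \<eta>(2) by (simp_all add: right_diff_distrib mult.commute)
    moreover have "\<bar>\<phi> (x - z) - \<phi> x\<bar> \<le> e" if "norm z < r" for z
      using r(2)[of "x - z"] that by (simp add: dist_norm)
    ultimately show ?thesis
      using mollifier_weighted_bound[OF m, of "\<lambda>z. \<phi> (x - z) - \<phi> x" e] by simp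
  qed
  with r(1) show ?thesis using that by blast
qed

lemma conv_holder:
  assumes "continuous_on UNIV \<phi>" "mollifier r \<eta>" "\<And>x y. \<bar>\<phi> x - \<phi> y\<bar> \<le> H * norm (x - y) powr \<alpha>"
  shows "\<bar>conv \<phi> \<eta> x - conv \<phi> \<eta> y\<bar> \<le> H * norm (x - y) powr \<alpha>"
proof -
  have \<eta>: "test_fun \<eta>" using assms(2) by (auto simp: mollifier_def)
  have "\<bar>\<phi> (x - z) - \<phi> (y - z)\<bar> \<le> H * norm (x - y) powr \<alpha>" for z
    using assms(3)[of "x - z" "y - z"] by simp
  then show ?thesis
    unfolding conv_diff(2)[OF assms(1) \<eta>]
    by (intro mollifier_weighted_bound[OF assms(2) conv_diff(1)[OF assms(1) \<eta>]])
qed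

text \<open>Jensen bounds each increment of the convolution by the average over z of increments of
  the translate by z. After Fubini every translate contributes the same energy, because the kernel
  depends on x - y only.\<close>

lemma gagliardo_conv_le:
  fixes \<phi> :: "'a::euclidean_space \<Rightarrow> real"
  assumes \<phi>: "continuous_on UNIV \<phi>" and m: "mollifier r \<eta>" and p: "1 < p"
  shows "gagliardo_p s p (conv \<phi> \<eta>) \<le> gagliardo_p s p \<phi>"
proof -
  have \<eta>: "test_fun \<eta>" "\<And>x. 0 \<le> \<eta> x" "(\<integral>x. \<eta> x \<partial>lborel) = 1" "integrable lborel \<eta>"
    using m by (auto simp: mollifier_def intro: integrable_test_fun)
  have [measurable]: "\<phi> \<in> borel_measurable borel" "\<eta> \<in> borel_measurable borel"
    using \<phi> \<eta> by (auto intro: borel_measurable_continuous_onI test_fun_measurable)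
  define F where "F x y = ennreal (\<bar>\<phi> x - \<phi> y\<bar> powr p / norm (x - y) powr (real DIM('a) + s * p))" for x y
  have [measurable]: "case_prod F \<in> borel_measurable (borel \<Otimes>\<^sub>M borel)"
    unfolding F_def case_prod_beta by measurable
  have [measurable]: "(\<lambda>u. F (f u) (g u)) \<in> borel_measurable M"
    if "f \<in> borel_measurable M" "g \<in> borel_measurable M" for f g and M :: "'b measure"
    unfolding F_def using that by measurable
  have shift: "(\<integral>\<^sup>+x. \<integral>\<^sup>+y. F (x - z) (y - z) \<partial>lborel \<partial>lborel) = gagliardo_p s p \<phi>" for z
  proof -
    have "(\<integral>\<^sup>+y. F x (y - z) \<partial>lborel) = (\<integral>\<^sup>+y. F x y \<partial>lborel)" for x
      using nn_integral_lborel_affine[of "F x" 1 "- z"] by simp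
    then have "(\<integral>\<^sup>+x. \<integral>\<^sup>+y. F (x - z) (y - z) \<partial>lborel \<partial>lborel) = (\<integral>\<^sup>+x. \<integral>\<^sup>+y. F (x - z) y \<partial>lborel \<partial>lborel)"
      by simp
    also have "\<dots> = (\<integral>\<^sup>+x. \<integral>\<^sup>+y. F x y \<partial>lborel \<partial>lborel)"
      using nn_integral_lborel_affine[of "\<lambda>x. \<integral>\<^sup>+y. F x y \<partial>lborel" 1 "- z"] by simp
    finally show ?thesis by (simp add: gagliardo_p_def F_def)
  qed
  have "gagliardo_p s p (conv \<phi> \<eta>) \<le> (\<integral>\<^sup>+x. \<integral>\<^sup>+y. \<integral>\<^sup>+z. F (x - z) (y - z) * ennreal (\<eta> z) \<partial>lborel \<partial>lborel \<partial>lborel)"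
    unfolding gagliardo_p_def
  proof (intro nn_integral_mono)
    fix x y :: 'a
    define k where "k = 1 / norm (x - y) powr (real DIM('a) + s * p)"
    have k: "k \<ge> 0" by (simp add: k_def)
    have "ennreal (\<bar>conv \<phi> \<eta> x - conv \<phi> \<eta> y\<bar> powr p) \<le>
        (\<integral>\<^sup>+z. ennreal (norm (\<phi> (x - z) - \<phi> (y - z)) powr p * \<eta> z) \<partial>lborel)"
      unfolding conv_diff(2)[OF \<phi> \<eta>(1)] real_norm_def[symmetric]
      by (rule jensen_powr[OF conv_diff(1)[OF \<phi> \<eta>(1)] _ \<eta>(4) \<eta>(2) \<eta>(3) p]) measurable
    then have "ennreal k * ennreal (\<bar>conv \<phi> \<eta> x - conv \<phi> \<eta> y\<bar> powr p) \<le>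
        ennreal k * (\<integral>\<^sup>+z. ennreal (norm (\<phi> (x - z) - \<phi> (y - z)) powr p * \<eta> z) \<partial>lborel)"
      by (rule mult_left_mono) simp
    also have "\<dots> = (\<integral>\<^sup>+z. ennreal k * ennreal (norm (\<phi> (x - z) - \<phi> (y - z)) powr p * \<eta> z) \<partial>lborel)"
      by (rule nn_integral_cmult[symmetric]) measurable
    also have "\<dots> = (\<integral>\<^sup>+z. F (x - z) (y - z) * ennreal (\<eta> z) \<partial>lborel)"
      by (intro nn_integral_cong) (simp add: F_def k_def ennreal_mult[symmetric] \<eta>(2))
    finally show "ennreal (\<bar>conv \<phi> \<eta> x - conv \<phi> \<eta> y\<bar> powr p / norm (x - y) powr (real DIM('a) + s * p))
        \<le> (\<integral>\<^sup>+z. F (x - z) (y - z) * ennreal (\<eta> z) \<partial>lborel)"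
      using k by (simp add: ennreal_mult[symmetric] k_def)
  qed
  also have "\<dots> = (\<integral>\<^sup>+x. \<integral>\<^sup>+z. \<integral>\<^sup>+y. F (x - z) (y - z) * ennreal (\<eta> z) \<partial>lborel \<partial>lborel \<partial>lborel)"
    by (intro nn_integral_cong lborel_pair.Fubini') measurable
  also have "\<dots> = (\<integral>\<^sup>+z. \<integral>\<^sup>+x. \<integral>\<^sup>+y. F (x - z) (y - z) * ennreal (\<eta> z) \<partial>lborel \<partial>lborel \<partial>lborel)"
    by (rule lborel_pair.Fubini') measurable
  also have "\<dots> = (\<integral>\<^sup>+z. gagliardo_p s p \<phi> * ennreal (\<eta> z) \<partial>lborel)"
    by (simp add: nn_integral_multc shift)
  also have "\<dots> = gagliardo_p s p \<phi>"
    using \<eta> by (simp add: nn_integral_cmult nn_integral_eq_integral)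
  finally show ?thesis .
qed

text \<open>The gradient of the convolution is an average of g with density eta (x - y), so Jensen
  followed by Fubini gives Young's inequality with constant 1.\<close>

lemma gradient_conv_le:
  fixes \<phi> :: "'a::euclidean_space \<Rightarrow> real"
  assumes \<phi>: "continuous_on UNIV \<phi>" and wg: "weak_gradient \<phi> g" and m: "mollifier r \<eta>" and p: "1 < p"
  shows "Lp_pow p lborel (gradient (conv \<phi> \<eta>)) \<le> Lp_pow p lborel g"
proof -
  have \<eta>: "test_fun \<eta>" "\<And>x. 0 \<le> \<eta> x" "(\<integral>x. \<eta> x \<partial>lborel) = 1" "integrable lborel \<eta>"
    using m by (auto simp: mollifier_def intro: integrable_test_fun)
  have [measurable]: "g \<in> borel_measurable borel" "\<eta> \<in> borel_measurable borel"
    using wg \<eta> by (auto simp: weak_gradient_def intro: test_fun_measurable)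
  have refl: "integrable lborel (\<lambda>y. \<eta> (x - y))" "(\<integral>y. \<eta> (x - y) \<partial>lborel) = 1" for x
    using lborel_integrable_affine[OF \<eta>(4), of "-1" x] lborel_integral_affine[OF \<eta>(4), of "-1" x] \<eta>(3) by auto
  have "Lp_pow p lborel (gradient (conv \<phi> \<eta>))
      \<le> (\<integral>\<^sup>+x. \<integral>\<^sup>+y. ennreal (norm (g y) powr p * \<eta> (x - y)) \<partial>lborel \<partial>lborel)"
    unfolding gradient_conv(2)[OF \<phi> wg \<eta>(1)]
    by (intro nn_integral_mono jensen_powr[OF gradient_conv(1)[OF \<phi> wg \<eta>(1)] _ refl(1) \<eta>(2) refl(2) p]) measurable
  also have "\<dots> = (\<integral>\<^sup>+y. \<integral>\<^sup>+x. ennreal (norm (g y) powr p * \<eta> (x - y)) \<partial>lborel \<partial>lborel)"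
    by (rule lborel_pair.Fubini') measurable
  also have "\<dots> = (\<integral>\<^sup>+y. ennreal (norm (g y) powr p) * (\<integral>\<^sup>+x. ennreal (\<eta> (x - y)) \<partial>lborel) \<partial>lborel)"
    by (simp add: ennreal_mult \<eta>(2) nn_integral_cmult)
  also have "(\<lambda>y. \<integral>\<^sup>+x. ennreal (\<eta> (x - y)) \<partial>lborel) = (\<lambda>y. 1)"
  proof
    fix y
    have "(\<integral>\<^sup>+x. ennreal (\<eta> (x - y)) \<partial>lborel) = (\<integral>\<^sup>+x. ennreal (\<eta> x) \<partial>lborel)"
      using nn_integral_lborel_affine[of "\<lambda>x. ennreal (\<eta> x)" 1 "- y"] by simp
    then show "(\<integral>\<^sup>+x. ennreal (\<eta> (x - y)) \<partial>lborel) = 1"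
      using \<eta> by (simp add: nn_integral_eq_integral)
  qed
  finally show ?thesis by simp
qed

section \<open>Finite Gagliardo energy of test functions\<close>

lemma ex_dyadic_interval:
  fixes t :: real
  assumes "1 \<le> t"
  obtains i :: nat where "2 ^ i \<le> t" "t < 2 ^ Suc i"
proof -
  have ex: "\<exists>n. t < 2 ^ n" using real_arch_pow[of 2 t] by simp
  define n where "n = (LEAST n. t < 2 ^ n)"
  have n: "t < 2 ^ n" unfolding n_def by (rule LeastI_ex[OF ex])
  then have "n \<noteq> 0" using assms by (cases n) auto
  then obtain i where i: "n = Suc i" by (cases n) auto
  have "\<not> t < 2 ^ i"
    using not_less_Least[of i "\<lambda>n. t < 2 ^ n"] i by (simp add: n_def)
  then show ?thesis using that[of i] n i by auto
qed

text \<open>A substitute for polar coordinates: f is dominated by a sum of constants on balls, and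
  constant times volume forms a geometric series.\<close>

lemma nn_integral_dyadic_finite:
  fixes f :: "'a::euclidean_space \<Rightarrow> ennreal" and c \<rho> :: "nat \<Rightarrow> real"
  assumes "\<And>z. f z = 0 \<or> (\<exists>i. f z \<le> ennreal (c i) \<and> norm z \<le> \<rho> i)"
    and "\<And>i. c i \<ge> 0" "\<And>i. \<rho> i \<ge> 0" "\<And>i. c i * \<rho> i ^ DIM('a) = A * \<theta> ^ i" "0 < \<theta>" "\<theta> < 1" "A \<ge> 0"
  shows "(\<integral>\<^sup>+z. f z \<partial>lborel) < \<infinity>"
proof -
  let ?v = "unit_ball_vol (real DIM('a))"
  have [measurable]: "cball (0::'a) R \<in> sets borel" for R by auto
  have "f z \<le> (\<Sum>i. ennreal (c i) * indicator (cball 0 (\<rho> i)) z)" for z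
  proof (cases "f z = 0")
    case False
    then obtain i where i: "f z \<le> ennreal (c i)" "norm z \<le> \<rho> i" using assms(1) by blast
    then have "f z \<le> ennreal (c i) * indicator (cball 0 (\<rho> i)) z" by simp
    also have "\<dots> = (\<Sum>j\<in>{i}. ennreal (c j) * indicator (cball 0 (\<rho> j)) z)" by (simp only: sum.insert sum.empty finite.emptyI empty_iff not_False_eq_True add_0_right)
    also have "\<dots> \<le> (\<Sum>i. ennreal (c i) * indicator (cball 0 (\<rho> i)) z)"
      by (rule sum_le_suminf) auto
    finally show ?thesis .
  qed simp
  then have "(\<integral>\<^sup>+z. f z \<partial>lborel) \<le> (\<integral>\<^sup>+z. (\<Sum>i. ennreal (c i) * indicator (cball 0 (\<rho> i)) (z::'a)) \<partial>lborel)"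
    by (intro nn_integral_mono)
  also have "\<dots> = (\<Sum>i. \<integral>\<^sup>+z. ennreal (c i) * indicator (cball 0 (\<rho> i)) (z::'a) \<partial>lborel)"
    by (rule nn_integral_suminf) measurable
  also have "\<dots> = (\<Sum>i. ennreal (A * ?v * \<theta> ^ i))"
  proof (intro suminf_cong)
    fix i
    have "(\<integral>\<^sup>+z. ennreal (c i) * indicator (cball 0 (\<rho> i)) (z::'a) \<partial>lborel) =
        ennreal (c i) * ennreal (?v * \<rho> i ^ DIM('a))"
      using assms(3)[of i] by (simp add: nn_integral_cmult_indicator emeasure_cball)
    also have "\<dots> = ennreal (?v * (c i * \<rho> i ^ DIM('a)))"
      using assms(2)[of i] assms(3)[of i] by (simp add: ennreal_mult[symmetric] mult_ac)
    finally show "(\<integral>\<^sup>+z. ennreal (c i) * indicator (cball 0 (\<rho> i)) (z::'a) \<partial>lborel) = ennreal (A * ?v * \<theta> ^ i)"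
      unfolding assms(4) by (simp add: mult_ac)
  qed
  also have "\<dots> = ennreal (\<Sum>i. A * ?v * \<theta> ^ i)"
    using assms by (intro suminf_ennreal2) (auto intro!: summable_mult summable_geometric)
  finally show ?thesis
    using ennreal_less_top order_le_less_trans by (metis infinity_ennreal_def)
qed

lemma nn_integral_near_finite:
  fixes \<beta> :: real
  assumes "\<beta> > 0"
  shows "(\<integral>\<^sup>+z. ennreal (norm z powr (\<beta> - real DIM('a))) * indicator (ball 0 1) (z::'a::euclidean_space) \<partial>lborel) < \<infinity>"
proof (rule nn_integral_dyadic_finite[where c="\<lambda>i. (1 / 2 ^ i) powr \<beta> * (2 ^ Suc i) ^ DIM('a)" and \<rho>="\<lambda>i. 1 / 2 ^ i"
      and A="2 ^ DIM('a)" and \<theta>="(1/2) powr \<beta>"])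
  show "ennreal (norm z powr (\<beta> - real DIM('a))) * indicator (ball 0 1) z = 0 \<or>
     (\<exists>i. ennreal (norm z powr (\<beta> - real DIM('a))) * indicator (ball 0 1) z
        \<le> ennreal ((1 / 2 ^ i) powr \<beta> * (2 ^ Suc i) ^ DIM('a)) \<and> norm z \<le> 1 / 2 ^ i)" for z :: 'a
  proof (cases "z \<noteq> 0 \<and> norm z < 1")
    case True
    then have "1 \<le> 1 / norm z" by (simp add: field_simps)
    then obtain i where i: "2 ^ i \<le> 1 / norm z" "1 / norm z < 2 ^ Suc i"
      using ex_dyadic_interval by blast
    have nz: "norm z \<le> 1 / 2 ^ i" using i(1) True by (simp add: field_simps)
    \<comment> \<open>The power is split because the sign of beta - N is unknown: |z|^beta is
      bounded through the outer radius of the dyadic shell and |z|^(-N) through the inner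
      one.\<close>
    have "norm z powr (\<beta> - real DIM('a)) = norm z powr \<beta> * (1 / norm z) ^ DIM('a)"
      using True by (simp add: powr_diff powr_realpow power_divide)
    also have "\<dots> \<le> (1 / 2 ^ i) powr \<beta> * (2 ^ Suc i) ^ DIM('a)"
      using assms nz i(2) by (intro mult_mono powr_mono2 power_mono) auto
    finally show ?thesis using nz True by (auto intro!: exI[of _ i] ennreal_leI)
  qed auto
  show "(1 / 2 ^ i) powr \<beta> * (2 ^ Suc i) ^ DIM('a) * (1 / 2 ^ i) ^ DIM('a) = 2 ^ DIM('a) * ((1 / 2) powr \<beta>) ^ i" for i :: nat
  proof -
    have "((1 / 2) powr \<beta>) ^ i = (1 / 2 ^ i) powr \<beta>"
      by (simp add: powr_realpow[symmetric] powr_powr powr_divide powr_minus mult.commute)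
    then show ?thesis by (simp add: power_mult_distrib power_divide)
  qed
  show "(1 / 2) powr \<beta> < (1::real)" using assms by (simp add: powr_divide)
qed (use assms in auto)

lemma nn_integral_far_finite:
  fixes \<beta> :: real
  assumes "\<beta> > 0"
  shows "(\<integral>\<^sup>+z. ennreal (1 / norm z powr (real DIM('a) + \<beta>)) * indicator (- ball 0 1) (z::'a::euclidean_space) \<partial>lborel) < \<infinity>"
proof (rule nn_integral_dyadic_finite[where c="\<lambda>i. 1 / (2 ^ i) powr (real DIM('a) + \<beta>)" and \<rho>="\<lambda>i. 2 ^ Suc i"
      and A="2 ^ DIM('a)" and \<theta>="(1/2) powr \<beta>"])
  show "ennreal (1 / norm z powr (real DIM('a) + \<beta>)) * indicator (- ball 0 1) z = 0 \<or>
     (\<exists>i. ennreal (1 / norm z powr (real DIM('a) + \<beta>)) * indicator (- ball 0 1) z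
        \<le> ennreal (1 / (2 ^ i) powr (real DIM('a) + \<beta>)) \<and> norm z \<le> 2 ^ Suc i)" for z :: 'a
  proof (cases "1 \<le> norm z")
    case True
    then obtain i where i: "2 ^ i \<le> norm z" "norm z < 2 ^ Suc i"
      using ex_dyadic_interval by blast
    have "1 / norm z powr (real DIM('a) + \<beta>) \<le> 1 / (2 ^ i) powr (real DIM('a) + \<beta>)"
    proof (intro divide_left_mono powr_mono2 mult_pos_pos)
      show "0 < norm z powr (real DIM('a) + \<beta>)" using True by auto
    qed (use assms i(1) in auto)
    then show ?thesis using i(2) True by (auto intro!: exI[of _ i] ennreal_leI)
  qed auto
  show "1 / (2 ^ i) powr (real DIM('a) + \<beta>) * (2 ^ Suc i) ^ DIM('a) = 2 ^ DIM('a) * ((1 / 2) powr \<beta>) ^ i" for i :: nat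
  proof -
    have "((1 / 2) powr \<beta>) ^ i = 1 / (2 ^ i) powr \<beta>"
      by (simp add: powr_realpow[symmetric] powr_powr powr_divide powr_minus mult.commute power_divide)
    moreover have "(2 ^ i) powr (real DIM('a) + \<beta>) = (2 ^ i) ^ DIM('a) * (2 ^ i) powr \<beta>" for i :: nat
      by (simp add: powr_add powr_realpow)
    ultimately show ?thesis by (simp add: power_mult_distrib)
  qed
  show "(1 / 2) powr \<beta> < (1::real)" using assms by (simp add: powr_divide)
qed (use assms in auto)

lemma gagliardo_test_fun_finite:
  fixes w :: "'a::euclidean_space \<Rightarrow> real"
  assumes w: "test_fun w" and s: "0 < s" "s < 1" and p: "1 < p"
  shows "gagliardo_p s p w < \<infinity>"
proof -
  obtain R where R: "R > 0" "\<And>x. w x \<noteq> 0 \<Longrightarrow> norm x < R"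
    using test_funE[OF w] by blast
  obtain L where L: "L > 0" "\<And>x y. \<bar>w x - w y\<bar> \<le> L * norm (x - y)"
    using test_fun_lipschitz[OF w] by blast
  obtain B where B: "B > 0" "\<And>x. \<bar>w x\<bar> \<le> B"
    using test_fun_bounded[OF w] by blast
  define q where "q = real DIM('a) + s * p"
  \<comment> \<open>Near the diagonal the Lipschitz bound leaves |z|^(p - s p - N), integrable as s
    < 1; away from it boundedness of w leaves |z|^(-N - s p).\<close>
  define \<kappa> where "\<kappa> z = ennreal (L powr p) * (ennreal (norm z powr ((p - s * p) - real DIM('a))) * indicator (ball 0 1) z)
     + ennreal ((2 * B) powr p) * (ennreal (1 / norm z powr q) * indicator (- ball 0 1) z)" for z :: 'a
  have [measurable]: "ball (0::'a) R \<in> sets borel" "- ball (0::'a) R \<in> sets borel" for R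
    by auto
  have [measurable]: "\<kappa> \<in> borel_measurable borel"
    unfolding \<kappa>_def by measurable
  have "p - s * p > 0" using s p mult_strict_right_mono[of s 1 p] by simp
  then have \<kappa>fin: "(\<integral>\<^sup>+z. \<kappa> z \<partial>lborel) < \<infinity>"
    unfolding \<kappa>_def q_def
    using nn_integral_near_finite[where 'a='a, of "p - s * p"] nn_integral_far_finite[where 'a='a, of "s * p"] s p
    by (subst nn_integral_add) (auto simp: nn_integral_cmult ennreal_mult_less_top)
  define C where "C = (\<integral>\<^sup>+z. \<kappa> z \<partial>lborel)"
  have k1: "(\<integral>\<^sup>+y. \<kappa> (x - y) \<partial>lborel) = C" for x
    using nn_integral_lborel_affine[of \<kappa> "-1" x] by (simp add: C_def)
  have k2: "(\<integral>\<^sup>+x. \<kappa> (x - y) \<partial>lborel) = C" for y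
    using nn_integral_lborel_affine[of \<kappa> 1 "- y"] by (simp add: C_def)
  \<comment> \<open>The increment vanishes unless x or y lies in the support, so each term confines
    one variable to a ball while \<open>\<kappa>\<close> is integrated over the other.\<close>
  have pt: "ennreal (\<bar>w x - w y\<bar> powr p / norm (x - y) powr q) \<le> indicator (ball 0 R) x * \<kappa> (x - y) + indicator (ball 0 R) y * \<kappa> (x - y)" for x y
  proof (cases "w x = 0 \<and> w y = 0 \<or> x = y")
    case False
    have *: "ennreal (\<bar>w x - w y\<bar> powr p / norm (x - y) powr q) \<le> \<kappa> (x - y)"
    proof (cases "norm (x - y) < 1")
      case True
      have "\<bar>w x - w y\<bar> powr p / norm (x - y) powr q \<le> (L * norm (x - y)) powr p / norm (x - y) powr q"
        using p by (intro divide_right_mono powr_mono2 L) auto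
      also have "\<dots> = L powr p * norm (x - y) powr (p - s * p - real DIM('a))"
        using L False by (simp add: powr_mult powr_diff q_def powr_add field_simps)
      finally show ?thesis
        using True by (simp add: \<kappa>_def ennreal_mult[symmetric] ennreal_leI)
    next
      case far: False
      have "\<bar>w x - w y\<bar> \<le> 2 * B" using B(2)[of x] B(2)[of y] by linarith
      then have "\<bar>w x - w y\<bar> powr p / norm (x - y) powr q \<le> (2 * B) powr p / norm (x - y) powr q"
        using p by (intro divide_right_mono powr_mono2) auto
      then show ?thesis
        using far by (simp add: \<kappa>_def ennreal_mult[symmetric] ennreal_leI)
    qed
    have "norm x < R \<or> norm y < R" using False R(2) by blast
    then show ?thesis
    proof
      assume "norm x < R"
      then show ?thesis using * by (simp add: add_increasing2)
    next
      assume "norm y < R"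
      then show ?thesis using * by (simp add: add_increasing)
    qed
  qed auto
  have ballfin: "emeasure lborel (ball (0::'a) R) < \<infinity>"
    by (rule emeasure_lborel_ball_finite)
  have "gagliardo_p s p w \<le> (\<integral>\<^sup>+x. \<integral>\<^sup>+y. indicator (ball 0 R) x * \<kappa> (x - y) + indicator (ball 0 R) y * \<kappa> (x - y) \<partial>lborel \<partial>lborel)"
    unfolding gagliardo_p_def q_def[symmetric] by (intro nn_integral_mono pt)
  also have "\<dots> = (\<integral>\<^sup>+x. \<integral>\<^sup>+y. indicator (ball 0 R) x * \<kappa> (x - y) \<partial>lborel \<partial>lborel) + (\<integral>\<^sup>+x. \<integral>\<^sup>+y. indicator (ball 0 R) y * \<kappa> (x - y) \<partial>lborel \<partial>lborel)"
    by (simp add: nn_integral_add)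
  also have "(\<integral>\<^sup>+x. \<integral>\<^sup>+y. indicator (ball 0 R) y * \<kappa> (x - y) \<partial>lborel \<partial>lborel) =
      (\<integral>\<^sup>+y. \<integral>\<^sup>+x. indicator (ball 0 R) y * \<kappa> (x - y) \<partial>lborel \<partial>lborel)"
    by (rule lborel_pair.Fubini') measurable
  also have "(\<integral>\<^sup>+x. \<integral>\<^sup>+y. indicator (ball 0 R) x * \<kappa> (x - y) \<partial>lborel \<partial>lborel) + \<dots> = emeasure lborel (ball (0::'a) R) * C + emeasure lborel (ball (0::'a) R) * C"
    by (simp add: nn_integral_cmult k1 k2 nn_integral_multc)
  also have "\<dots> < \<infinity>"
    using ballfin \<kappa>fin by (simp add: C_def ennreal_mult_less_top)
  finally show ?thesis .
qed

section \<open>Hoelder seminorm and scaling\<close>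

lemma holder_seminorm_ge:
  "x \<noteq> y \<Longrightarrow> ennreal (\<bar>\<phi> x - \<phi> y\<bar> / norm (x - y) powr \<alpha>) \<le> holder_seminorm \<alpha> \<phi>"
  unfolding holder_seminorm_def by (rule SUP_upper2[where i="(x, y)"]) (simp_all add: dist_norm)

text \<open>The case x = y may be included on the right because \<open>0 powr \<alpha>\<close> is
  0.\<close>

lemma holder_seminorm_le_iff:
  fixes \<phi> :: "'a::euclidean_space \<Rightarrow> real"
  assumes "H \<ge> 0"
  shows "holder_seminorm \<alpha> \<phi> \<le> ennreal H \<longleftrightarrow> (\<forall>x y. \<bar>\<phi> x - \<phi> y\<bar> \<le> H * norm (x - y) powr \<alpha>)"
proof
  assume le: "holder_seminorm \<alpha> \<phi> \<le> ennreal H"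
  show "\<forall>x y. \<bar>\<phi> x - \<phi> y\<bar> \<le> H * norm (x - y) powr \<alpha>"
  proof (intro allI)
    fix x y
    show "\<bar>\<phi> x - \<phi> y\<bar> \<le> H * norm (x - y) powr \<alpha>"
    proof (cases "x = y")
      case False
      then have "\<bar>\<phi> x - \<phi> y\<bar> / norm (x - y) powr \<alpha> \<le> H"
        using order_trans[OF holder_seminorm_ge le] assms by (simp add: ennreal_le_iff)
      then show ?thesis using False by (simp add: divide_le_eq)
    qed simp
  qed
next
  assume *: "\<forall>x y. \<bar>\<phi> x - \<phi> y\<bar> \<le> H * norm (x - y) powr \<alpha>"
  show "holder_seminorm \<alpha> \<phi> \<le> ennreal H"
    unfolding holder_seminorm_def
  proof (rule SUP_least)
    fix xy :: "'a \<times> 'a" assume "xy \<in> {(x, y). x \<noteq> y}"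
    then have "\<bar>\<phi> (fst xy) - \<phi> (snd xy)\<bar> / dist (fst xy) (snd xy) powr \<alpha> \<le> H"
      using * by (simp add: divide_le_eq dist_norm case_prod_beta)
    then show "ennreal (\<bar>\<phi> (fst xy) - \<phi> (snd xy)\<bar> / dist (fst xy) (snd xy) powr \<alpha>) \<le> ennreal H"
      by (rule ennreal_leI)
  qed
qed

lemma holder_seminorm_cmult: "holder_seminorm \<alpha> (\<lambda>x. a * \<phi> x) = ennreal \<bar>a\<bar> * holder_seminorm \<alpha> \<phi>"
proof -
  have "\<bar>a * \<phi> x - a * \<phi> y\<bar> = \<bar>a\<bar> * \<bar>\<phi> x - \<phi> y\<bar>" for x y
    by (simp flip: right_diff_distrib add: abs_mult)
  then show ?thesis
    unfolding holder_seminorm_def by (simp add: SUP_mult_left_ennreal ennreal_mult[symmetric])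
qed

text \<open>At distances up to 1 the Lipschitz bound suffices, as r <= r^alpha there for alpha <= 1;
  at larger distances boundedness does.\<close>

lemma test_fun_holder_finite:
  assumes "test_fun u" "0 < \<alpha>" "\<alpha> \<le> 1"
  shows "holder_seminorm \<alpha> u < \<infinity>"
proof -
  obtain L where L: "L > 0" "\<And>x y. \<bar>u x - u y\<bar> \<le> L * norm (x - y)"
    using test_fun_lipschitz[OF assms(1)] by blast
  obtain B where B: "B > 0" "\<And>x. \<bar>u x\<bar> \<le> B"
    using test_fun_bounded[OF assms(1)] by blast
  have "\<bar>u x - u y\<bar> \<le> (L + 2 * B) * norm (x - y) powr \<alpha>" for x y
  proof (cases "norm (x - y) \<le> 1")
    case True
    have "norm (x - y) powr 1 \<le> norm (x - y) powr \<alpha>"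
      using True assms by (intro powr_mono') auto
    then have "L * norm (x - y) \<le> L * norm (x - y) powr \<alpha>"
      using L by (simp add: mult_left_mono)
    also have "\<dots> \<le> (L + 2 * B) * norm (x - y) powr \<alpha>"
      using B by (intro mult_right_mono) auto
    finally show ?thesis using L(2)[of x y] by linarith
  next
    case False
    then have "1 \<le> norm (x - y) powr \<alpha>"
      using assms by (simp add: ge_one_powr_ge_zero)
    then have "(L + 2 * B) * 1 \<le> (L + 2 * B) * norm (x - y) powr \<alpha>"
      using L B by (intro mult_left_mono) auto
    moreover have "\<bar>u x - u y\<bar> \<le> L + 2 * B" using B(2)[of x] B(2)[of y] L(1) by linarith
    ultimately show ?thesis by simp
  qed
  then have "holder_seminorm \<alpha> u \<le> ennreal (L + 2 * B)"
    using L B by (subst holder_seminorm_le_iff) auto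
  then show ?thesis
    by (rule le_less_trans) simp
qed

text \<open>The two substitutions give c^(2 N) and the kernel gives c^(N + s p), which leaves c^(s p
  - N).\<close>

lemma gagliardo_affine:
  fixes \<phi> :: "'a::euclidean_space \<Rightarrow> real"
  assumes \<phi>: "continuous_on UNIV \<phi>" and c: "c > 0"
  shows "gagliardo_p s p (\<lambda>x. a * (\<phi> (t + c *\<^sub>R x) - k)) =
    ennreal (\<bar>a\<bar> powr p * c powr (s * p - real DIM('a))) * gagliardo_p s p \<phi>"
proof -
  define n where "n = DIM('a)"
  define q where "q = real n + s * p"
  have [measurable]: "\<phi> \<in> borel_measurable borel"
    using \<phi> by (rule borel_measurable_continuous_onI)
  define F where "F x y = ennreal (\<bar>\<phi> x - \<phi> y\<bar> powr p / norm (x - y) powr q)" for x y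
  have [measurable]: "(\<lambda>u. F (f u) (g u)) \<in> borel_measurable M"
    if "f \<in> borel_measurable M" "g \<in> borel_measurable M" for f g and M :: "'b measure"
    unfolding F_def using that by measurable
  define K where "K = \<bar>a\<bar> powr p * c powr q"
  have K: "K \<ge> 0" by (simp add: K_def)
  have eq: "ennreal (\<bar>a * (\<phi> (t + c *\<^sub>R x) - k) - a * (\<phi> (t + c *\<^sub>R y) - k)\<bar> powr p / norm (x - y) powr q)
      = ennreal K * F (t + c *\<^sub>R x) (t + c *\<^sub>R y)" for x y
  proof -
    have "a * (\<phi> (t + c *\<^sub>R x) - k) - a * (\<phi> (t + c *\<^sub>R y) - k) = a * (\<phi> (t + c *\<^sub>R x) - \<phi> (t + c *\<^sub>R y))"
      by (simp add: algebra_simps)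
    moreover have "norm ((t + c *\<^sub>R x) - (t + c *\<^sub>R y)) = c * norm (x - y)"
      using c by (simp flip: scaleR_diff_right)
    ultimately show ?thesis
      using c K by (simp add: F_def K_def abs_mult powr_mult ennreal_mult[symmetric])
  qed
  have "gagliardo_p s p \<phi> = (\<integral>\<^sup>+x. \<integral>\<^sup>+y. F x y \<partial>lborel \<partial>lborel)"
    by (simp add: gagliardo_p_def F_def q_def n_def)
  also have "\<dots> = (\<integral>\<^sup>+x. ennreal (c ^ n) * (\<integral>\<^sup>+y. F x (t + c *\<^sub>R y) \<partial>lborel) \<partial>lborel)"
    using nn_integral_lborel_affine[of "F _" c t] c by (simp add: n_def)
  also have "\<dots> = ennreal (c ^ n) * (\<integral>\<^sup>+x. \<integral>\<^sup>+y. F x (t + c *\<^sub>R y) \<partial>lborel \<partial>lborel)"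
    by (rule nn_integral_cmult) measurable
  also have "\<dots> = ennreal (c ^ n) * (ennreal (c ^ n) * (\<integral>\<^sup>+x. \<integral>\<^sup>+y. F (t + c *\<^sub>R x) (t + c *\<^sub>R y) \<partial>lborel \<partial>lborel))"
    using nn_integral_lborel_affine[of "\<lambda>x. \<integral>\<^sup>+y. F x (t + c *\<^sub>R y) \<partial>lborel" c t] c by (simp add: n_def)
  finally have g: "gagliardo_p s p \<phi> = ennreal (c ^ n) * (ennreal (c ^ n) * (\<integral>\<^sup>+x. \<integral>\<^sup>+y. F (t + c *\<^sub>R x) (t + c *\<^sub>R y) \<partial>lborel \<partial>lborel))" .
  have "\<bar>a\<bar> powr p * c powr (s * p - real n) * (c ^ n * c ^ n) = K"
    using c by (simp add: K_def q_def powr_realpow[symmetric] powr_add[symmetric])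
  then have "ennreal K = ennreal (\<bar>a\<bar> powr p * c powr (s * p - real n)) * (ennreal (c ^ n) * ennreal (c ^ n))"
    using c by (simp flip: ennreal_mult)
  then have "ennreal (\<bar>a\<bar> powr p * c powr (s * p - real n)) * gagliardo_p s p \<phi> =
      ennreal K * (\<integral>\<^sup>+x. \<integral>\<^sup>+y. F (t + c *\<^sub>R x) (t + c *\<^sub>R y) \<partial>lborel \<partial>lborel)"
    by (simp add: g mult_ac)
  also have "\<dots> = (\<integral>\<^sup>+x. \<integral>\<^sup>+y. ennreal K * F (t + c *\<^sub>R x) (t + c *\<^sub>R y) \<partial>lborel \<partial>lborel)"
    by (simp add: nn_integral_cmult)
  also have "\<dots> = gagliardo_p s p (\<lambda>x. a * (\<phi> (t + c *\<^sub>R x) - k))"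
    unfolding gagliardo_p_def eq[symmetric] by (simp add: q_def n_def)
  finally show ?thesis by (simp add: n_def)
qed

lemma grad_Lp_affine_le:
  fixes \<phi> :: "'a::euclidean_space \<Rightarrow> real"
  assumes c: "c > 0" and a: "a \<noteq> 0"
  shows "grad_Lp_p p (\<lambda>x. a * (\<phi> (t + c *\<^sub>R x) - k)) \<le>
    ennreal (\<bar>a\<bar> powr p * c powr (p - real DIM('a))) * grad_Lp_p p \<phi>"
proof -
  define A where "A = \<bar>a\<bar> powr p * c powr (p - real DIM('a))"
  have A: "A > 0" using a c by (simp add: A_def)
  have *: "grad_Lp_p p (\<lambda>x. a * (\<phi> (t + c *\<^sub>R x) - k)) \<le> ennreal A * Lp_pow p lborel g"
    if g: "weak_gradient \<phi> g" for g
  proof -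
    have [measurable]: "g \<in> borel_measurable borel" using g by (simp add: weak_gradient_def)
    have "grad_Lp_p p (\<lambda>x. a * (\<phi> (t + c *\<^sub>R x) - k)) \<le> Lp_pow p lborel (\<lambda>x. (a * c) *\<^sub>R g (t + c *\<^sub>R x))"
      unfolding grad_Lp_p_def using weak_gradient_affine[OF g] c
      by (intro INF_lower) auto
    also have "\<dots> = (\<integral>\<^sup>+x. ennreal (\<bar>a\<bar> powr p * c powr p) * ennreal (norm (g (t + c *\<^sub>R x)) powr p) \<partial>lborel)"
      using c by (intro nn_integral_cong) (simp add: abs_mult powr_mult ennreal_mult[symmetric])
    also have "\<dots> = ennreal (\<bar>a\<bar> powr p * c powr p) * Lp_pow p lborel (\<lambda>x. g (t + c *\<^sub>R x))"
      by (rule nn_integral_cmult) measurable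
    also have "\<bar>a\<bar> powr p * c powr p = A * c ^ DIM('a)"
      using c by (simp add: A_def powr_realpow[symmetric] powr_add[symmetric])
    also have "ennreal (A * c ^ DIM('a)) * Lp_pow p lborel (\<lambda>x. g (t + c *\<^sub>R x))
        = ennreal A * Lp_pow p lborel g"
      using nn_integral_lborel_affine[of "\<lambda>x. ennreal (norm (g x) powr p)" c t] c A
      by (simp add: ennreal_mult mult.assoc)
    finally show ?thesis .
  qed
  \<comment> \<open>The factor is moved to the left so that the right-hand side becomes the bare
    energy of g, over which the infimum can be taken.\<close>
  have "ennreal (1 / A) * grad_Lp_p p (\<lambda>x. a * (\<phi> (t + c *\<^sub>R x) - k)) \<le> Lp_pow p lborel g"
    if "weak_gradient \<phi> g" for g
  proof -
    have "ennreal (1 / A) * grad_Lp_p p (\<lambda>x. a * (\<phi> (t + c *\<^sub>R x) - k)) \<le>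
       ennreal (1 / A) * (ennreal A * Lp_pow p lborel g)"
      using *[OF that] by (rule mult_left_mono) simp
    also have "\<dots> = Lp_pow p lborel g"
      using A by (simp add: mult.assoc[symmetric] ennreal_mult[symmetric])
    finally show ?thesis .
  qed
  then have "ennreal (1 / A) * grad_Lp_p p (\<lambda>x. a * (\<phi> (t + c *\<^sub>R x) - k)) \<le> grad_Lp_p p \<phi>"
    unfolding grad_Lp_p_def[of p \<phi>] by (intro INF_greatest) auto
  then have "ennreal A * (ennreal (1 / A) * grad_Lp_p p (\<lambda>x. a * (\<phi> (t + c *\<^sub>R x) - k))) \<le> ennreal A * grad_Lp_p p \<phi>"
    by (rule mult_left_mono) simp
  then show ?thesis
    using A by (simp add: A_def[symmetric] mult.assoc[symmetric] ennreal_mult[symmetric])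
qed

lemma Wsp_affine_le:
  fixes \<phi> :: "'a::euclidean_space \<Rightarrow> real"
  assumes "continuous_on UNIV \<phi>" "c > 0" "a \<noteq> 0"
  shows "Wsp_seminorm_p s p (\<lambda>x. a * (\<phi> (t + c *\<^sub>R x) - k)) \<le>
    ennreal (\<bar>a\<bar> powr p * c powr (s * p - real DIM('a))) * Wsp_seminorm_p s p \<phi>"
proof (cases "s = 1")
  case True
  then show ?thesis
    using grad_Lp_affine_le[OF assms(2,3), of p \<phi> t k] unfolding Wsp_seminorm_p_def by simp
next
  case False
  then show ?thesis
    using eq_refl[OF gagliardo_affine[OF assms(1,2), of s p a t k]] unfolding Wsp_seminorm_p_def by simp
qed

text \<open>If h >= a is the true seminorm of u, then u / h is normalised and the energy of u is at
  least h^p J >= a^p J. So a lower bound on the seminorm suffices. The premise \<open>low\<close>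
  speaks of multiples of u only, which makes the lemma usable for test functions and for midpoints
  alike.\<close>

lemma scaled_lower_bound:
  fixes u :: "'a::euclidean_space \<Rightarrow> real"
  assumes "continuous_on UNIV u" "holder_seminorm \<alpha> u < \<infinity>" "0 < a" "ennreal a \<le> holder_seminorm \<alpha> u" "0 < p"
    and low: "\<And>c. 0 < c \<Longrightarrow> holder_seminorm \<alpha> (\<lambda>x. c * u x) = 1 \<Longrightarrow> J \<le> Wsp_seminorm_p s p (\<lambda>x. c * u x)"
  shows "J * ennreal (a powr p) \<le> Wsp_seminorm_p s p u"
proof -
  obtain h where h: "holder_seminorm \<alpha> u = ennreal h" "h \<ge> 0"
    using assms(2) by (cases "holder_seminorm \<alpha> u") auto
  then have ah: "a \<le> h" using assms(4) by (simp add: ennreal_le_iff)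
  then have h0: "h > 0" using assms(3) by linarith
  have "holder_seminorm \<alpha> (\<lambda>x. (1 / h) * u x) = 1"
    unfolding holder_seminorm_cmult h(1) using h0 by (simp add: ennreal_mult[symmetric])
  then have "J \<le> Wsp_seminorm_p s p (\<lambda>x. (1 / h) * u x)"
    using h0 by (intro low) auto
  also have "\<dots> \<le> ennreal ((1 / h) powr p) * Wsp_seminorm_p s p u"
    using Wsp_affine_le[OF assms(1), of 1 "1 / h" s p 0 0] h0 by simp
  finally have "ennreal (h powr p) * J \<le> ennreal (h powr p) * (ennreal ((1 / h) powr p) * Wsp_seminorm_p s p u)"
    by (rule mult_left_mono) simp
  also have "\<dots> = Wsp_seminorm_p s p u"
    using h0 by (simp add: mult.assoc[symmetric] ennreal_mult[symmetric] powr_divide)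
  finally have "ennreal (h powr p) * J \<le> Wsp_seminorm_p s p u" .
  moreover have "ennreal (a powr p) * J \<le> ennreal (h powr p) * J"
    using ah assms(3,5) by (intro mult_right_mono ennreal_leI powr_mono2) auto
  ultimately show ?thesis by (simp add: mult.commute)
qed

section \<open>Perturbation of \<open>p\<close>-energies\<close>

lemma powr_one_plus_le:
  fixes p G e :: real
  assumes "0 \<le> G" "0 < e"
  obtains t :: real where "0 < t" "(1 + t) powr p * G \<le> G + e"
proof -
  have "((\<lambda>t. (1 + t) powr p * G) \<longlongrightarrow> (1 + 0) powr p * G) (at_right (0::real))"
    by (intro tendsto_intros) auto
  then have "eventually (\<lambda>t. (1 + t) powr p * G < G + e) (at_right (0::real))"
    using assms by (intro order_tendstoD) auto
  then have "eventually (\<lambda>t. (1 + t) powr p * G < G + e \<and> 0 < t) (at_right (0::real))"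
    using eventually_at_right_less eventually_conj by blast
  then obtain t :: real where "(1 + t) powr p * G < G + e" "0 < t"
    using eventually_happens'[OF trivial_limit_at_right_real] by blast
  then show ?thesis
    by (intro that[of t]) auto
qed

text \<open>The order of choices matters: t is fixed first, from the finite energy of f, so that (1
  + t)^p costs little; the large factor (1 + 1/t)^p is then a constant that meets only the average,
  which is chosen afterwards.\<close>

lemma banach_saks_perturb:
  fixes D :: "nat \<Rightarrow> 'b \<Rightarrow> 'e::{real_normed_vector, second_countable_topology}"
  assumes [measurable]: "\<And>k. D k \<in> borel_measurable M" "f \<in> borel_measurable M"
    and bound: "\<And>k. Lp_pow p M (D k) \<le> ennreal C"
    and lim: "\<And>x. x \<in> space M \<Longrightarrow> (\<lambda>k. D k x) \<longlonglongrightarrow> 0"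
    and p: "1 < p" and C: "C \<ge> 0" and e: "e > 0"
    and fin: "Lp_pow p M f < \<infinity>"
  obtains K :: nat and r :: "nat \<Rightarrow> nat" where "K > 0" "\<And>j. j < K \<Longrightarrow> n0 \<le> r j"
    "Lp_pow p M (\<lambda>x. (1 / real K) *\<^sub>R (\<Sum>j<K. D (r j) x) + f x)
      \<le> Lp_pow p M f + ennreal e"
proof -
  obtain G where G: "Lp_pow p M f = ennreal G" "G \<ge> 0"
    using fin by (cases "\<integral>\<^sup>+x. ennreal (norm (f x) powr p) \<partial>M") auto
  obtain t :: real where t: "0 < t" "(1 + t) powr p * G \<le> G + e / 2"
    using powr_one_plus_le[OF G(2), of "e / 2"] e by auto
  define A where "A = (1 + 1 / t) powr p"
  have "1 + 1 / t > 0" using t by (intro add_pos_pos) auto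
  then have A: "A > 0" by (simp add: A_def)
  \<comment> \<open>The average is multiplied by A and so contributes e / 2; the other half pays for
    (1 + t)^p.\<close>
  have "e / (2 * A) > 0" using e A by simp
  show ?thesis
  proof (rule banach_saks[OF assms(1) bound lim p C \<open>e / (2 * A) > 0\<close>, of n0])
    fix K :: nat and r :: "nat \<Rightarrow> nat"
    assume rK: "K > 0" "\<And>j. j < K \<Longrightarrow> n0 \<le> r j"
      "Lp_pow p M (\<lambda>x. (1 / real K) *\<^sub>R (\<Sum>j<K. D (r j) x)) \<le> ennreal (e / (2 * A))"
    have "Lp_pow p M (\<lambda>x. (1 / real K) *\<^sub>R (\<Sum>j<K. D (r j) x) + f x)
      \<le> ennreal ((1 + t) powr p) * Lp_pow p M f
        + ennreal A * Lp_pow p M (\<lambda>x. (1 / real K) *\<^sub>R (\<Sum>j<K. D (r j) x))"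
      unfolding A_def
    proof (rule nn_integral_powr_add_le[OF _ assms(2) t(1)])
      show "(\<lambda>x. (1 / real K) *\<^sub>R (\<Sum>j<K. D (r j) x)) \<in> borel_measurable M" by measurable
    qed (use p in simp)
    also have "\<dots> \<le> ennreal ((1 + t) powr p) * ennreal G + ennreal A * ennreal (e / (2 * A))"
      unfolding G(1) by (intro add_mono mult_left_mono rK(3)) auto
    also have "\<dots> = ennreal ((1 + t) powr p * G + e / 2)"
      using G A e by (simp add: ennreal_mult[symmetric])
    also have "\<dots> \<le> ennreal (G + e)"
      using t(2) by (intro ennreal_leI) simp
    also have "\<dots> = Lp_pow p M f + ennreal e"
      using G e by simp
    finally show ?thesis using rK(1,2) by (intro that[of K r])
  qed
qed

section \<open>Density of test functions, fractional case\<close>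

text \<open>The kernel is absorbed into a p-th root, so the Gagliardo energy becomes the p-th power
  of an L^p norm over the product measure of a quantity linear in phi, as the Banach-Saks argument
  requires.\<close>

definition dquot :: "real \<Rightarrow> real \<Rightarrow> ('a::euclidean_space \<Rightarrow> real) \<Rightarrow> 'a \<times> 'a \<Rightarrow> real" where
  "dquot s p \<phi> z = (\<phi> (fst z) - \<phi> (snd z)) * norm (fst z - snd z) powr (- ((real DIM('a) + s * p) / p))"

lemma dquot_measurable:
  fixes \<phi> :: "'a::euclidean_space \<Rightarrow> real"
  assumes "continuous_on UNIV \<phi>"
  shows "dquot s p \<phi> \<in> borel_measurable (lborel \<Otimes>\<^sub>M lborel)"
proof -
  have [measurable]: "\<phi> \<in> borel_measurable borel"
    using assms by (rule borel_measurable_continuous_onI)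
  show ?thesis unfolding dquot_def[abs_def] by measurable
qed

lemma norm_dquot_powr:
  fixes \<phi> :: "'a::euclidean_space \<Rightarrow> real"
  assumes "0 < p"
  shows "norm (dquot s p \<phi> (x, y)) powr p = \<bar>\<phi> x - \<phi> y\<bar> powr p / norm (x - y) powr (real DIM('a) + s * p)"
  using assms by (simp add: dquot_def abs_mult powr_mult powr_powr powr_minus_divide powr_divide)

lemma gagliardo_dquot:
  fixes \<phi> :: "'a::euclidean_space \<Rightarrow> real"
  assumes "continuous_on UNIV \<phi>" "0 < p"
  shows "gagliardo_p s p \<phi> = Lp_pow p (lborel \<Otimes>\<^sub>M lborel) (dquot s p \<phi>)"
proof -
  have [measurable]: "dquot s p \<phi> \<in> borel_measurable (lborel \<Otimes>\<^sub>M lborel)"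
    by (rule dquot_measurable[OF assms(1)])
  show ?thesis
    unfolding gagliardo_p_def norm_dquot_powr[OF assms(2), symmetric]
    by (rule lborel.nn_integral_fst) measurable
qed

text \<open>Made for clipping: the p-th power of a maximum is at most the sum of the p-th
  powers.\<close>

lemma gagliardo_bound_max:
  fixes \<phi> u v :: "'a::euclidean_space \<Rightarrow> real"
  assumes c: "continuous_on UNIV u" "continuous_on UNIV v" and p: "0 < p"
    and le: "\<And>x y. \<bar>\<phi> x - \<phi> y\<bar> \<le> max \<bar>u x - u y\<bar> \<bar>v x - v y\<bar>"
  shows "gagliardo_p s p \<phi> \<le> gagliardo_p s p u + gagliardo_p s p v"
proof -
  have [measurable]: "u \<in> borel_measurable borel" "v \<in> borel_measurable borel"
    using c by (auto intro: borel_measurable_continuous_onI)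
  let ?q = "real DIM('a) + s * p"
  have "\<bar>\<phi> x - \<phi> y\<bar> powr p / norm (x - y) powr ?q \<le>
      \<bar>u x - u y\<bar> powr p / norm (x - y) powr ?q + \<bar>v x - v y\<bar> powr p / norm (x - y) powr ?q" for x y
  proof -
    have "\<bar>\<phi> x - \<phi> y\<bar> powr p \<le> (max \<bar>u x - u y\<bar> \<bar>v x - v y\<bar>) powr p"
      using p le by (intro powr_mono2) auto
    also have "\<dots> \<le> \<bar>u x - u y\<bar> powr p + \<bar>v x - v y\<bar> powr p"
      by (auto simp: max_def)
    finally show ?thesis
      by (simp add: add_divide_distrib[symmetric] divide_right_mono)
  qed
  then have "gagliardo_p s p \<phi> \<le> (\<integral>\<^sup>+x. \<integral>\<^sup>+y. ennreal (\<bar>u x - u y\<bar> powr p / norm (x - y) powr ?q)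
      + ennreal (\<bar>v x - v y\<bar> powr p / norm (x - y) powr ?q) \<partial>lborel \<partial>lborel)"
    unfolding gagliardo_p_def by (intro nn_integral_mono) (simp add: ennreal_leI flip: ennreal_plus)
  also have "\<dots> = gagliardo_p s p u + gagliardo_p s p v"
    unfolding gagliardo_p_def by (simp add: nn_integral_add)
  finally show ?thesis .
qed

lemma mollifier_mono: "mollifier r \<eta> \<Longrightarrow> r \<le> r' \<Longrightarrow> mollifier r' \<eta>"
  unfolding mollifier_def by force

lemma fractional_density:
  fixes \<phi> :: "'a::euclidean_space \<Rightarrow> real"
  assumes \<phi>: "continuous_on UNIV \<phi>" and fin: "gagliardo_p s p \<phi> < \<infinity>"
    and s: "0 < s" "s < 1" and p: "1 < p" and sp: "s * p > real DIM('a)" and e: "0 < e"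
  obtains u where "test_fun u" "gagliardo_p s p u \<le> gagliardo_p s p \<phi> + ennreal e"
    "\<bar>u x0 - \<phi> x0\<bar> \<le> e" "\<bar>u y0 - \<phi> y0\<bar> \<le> e"
proof -
  have zero_less_p: "0 < p" using p by simp
  define \<alpha> where "\<alpha> = s - real DIM('a) / p"
  have \<alpha>: "\<alpha> > 0" "\<alpha> * p = s * p - real DIM('a)"
    using sp p by (auto simp: \<alpha>_def field_simps)
  define R where "R k = real (Suc k)" for k
  have R: "R k > 0" for k by (simp add: R_def)
  \<comment> \<open>Height R^alpha over width R makes the energy independent of k. The added 0 and
    the subtracted 0 bring the term into the shape of \<open>gagliardo_affine\<close>.\<close>
  define W where "W k x = R k powr \<alpha> * (bump 1 (0 + (1 / R k) *\<^sub>R x) - 0)" for k and x :: 'a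
  have b: "test_fun (bump 1 :: 'a \<Rightarrow> real)" by (rule test_fun_bump) simp
  have bc: "continuous_on UNIV (bump 1 :: 'a \<Rightarrow> real)" by (rule test_fun_continuous[OF b])
  have W0: "W k x \<ge> 0" for k x by (simp add: W_def bump_nonneg)
  have Wc: "continuous_on UNIV (W k)" for k
    unfolding W_def by (intro continuous_intros continuous_on_compose2[OF bc]) auto
  have Wg: "gagliardo_p s p (W k) = gagliardo_p s p (bump 1 :: 'a \<Rightarrow> real)" for k
  proof -
    have "gagliardo_p s p (W k) = ennreal (\<bar>R k powr \<alpha>\<bar> powr p * (1 / R k) powr (s * p - real DIM('a))) * gagliardo_p s p (bump 1 :: 'a \<Rightarrow> real)"
      unfolding W_def by (rule gagliardo_affine[OF bc]) (simp add: R)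
    also have "\<bar>R k powr \<alpha>\<bar> powr p * (1 / R k) powr (s * p - real DIM('a)) = 1"
      using R[of k] by (simp add: powr_powr \<alpha>(2)[symmetric] powr_divide)
    finally show ?thesis by simp
  qed
  define P where "P = gagliardo_p s p (bump 1 :: 'a \<Rightarrow> real)"
  have P: "P < \<infinity>" unfolding P_def by (rule gagliardo_test_fun_finite[OF b s p])
  \<comment> \<open>As W is nonnegative this is the median of phi, W and -W, and the median is
    1-Lipschitz in the maximum norm; this gives the bound on increments.\<close>
  define f where "f k x = max (min (\<phi> x) (W k x)) (- W k x)" for k x
  have fc: "continuous_on UNIV (f k)" for k
    unfolding f_def by (intro continuous_intros \<phi> Wc)
  have fdiff: "\<bar>f k x - f k y\<bar> \<le> max \<bar>\<phi> x - \<phi> y\<bar> \<bar>W k x - W k y\<bar>" for k x y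
    unfolding f_def using W0[of k x] W0[of k y] by linarith
  have fg: "gagliardo_p s p (f k) \<le> gagliardo_p s p \<phi> + P" for k
    using gagliardo_bound_max[OF \<phi> Wc[of k] _ fdiff, of p s] p by (simp add: Wg P_def)
  have fsupp: "norm x \<le> R k" if "f k x \<noteq> 0" for k x
  proof (rule ccontr)
    assume "\<not> norm x \<le> R k"
    then have "norm ((1 / R k) *\<^sub>R x) > 1" using R[of k] by (simp add: field_simps)
    then have "bump 1 ((1 / R k) *\<^sub>R x) = 0"
      using bump_support[of 1 "(1 / R k) *\<^sub>R x"] by force
    then have "W k x = 0" by (simp add: W_def)
    then show False using that by (simp add: f_def)
  qed
  \<comment> \<open>The bump is positive at 0 and alpha > 0, so the clipping levels at a fixed x
    tend to infinity and clipping becomes inactive there: the errors are eventually 0.\<close>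
  have ev: "eventually (\<lambda>k. f k x = \<phi> x) sequentially" for x
  proof -
    have Rlim: "filterlim R at_top sequentially"
      unfolding R_def[abs_def] using filterlim_real_sequentially filterlim_Suc by (rule filterlim_compose)
    have "(\<lambda>k. 1 / R k) \<longlonglongrightarrow> 0"
      using tendsto_divide_0[OF tendsto_const filterlim_at_top_imp_at_infinity[OF Rlim]] .
    then have "(\<lambda>k. (1 / R k) *\<^sub>R x) \<longlonglongrightarrow> 0 *\<^sub>R x"
      by (intro tendsto_scaleR tendsto_const)
    then have "(\<lambda>k. bump 1 ((1 / R k) *\<^sub>R x)) \<longlonglongrightarrow> bump 1 (0 *\<^sub>R x)"
      using continuous_on_tendsto_compose[OF bc] by auto
    moreover have "bump 1 (0 *\<^sub>R x) > 0" using bump_pos_iff[of 1 "0::'a"] by simp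
    moreover have "filterlim (\<lambda>k. R k powr \<alpha>) at_top sequentially"
      using filterlim_compose[OF exp_at_top filterlim_tendsto_pos_mult_at_top[OF tendsto_const \<alpha>(1)
            filterlim_compose[OF ln_at_top Rlim]]] R
      by (simp add: powr_def less_imp_neq[THEN not_sym])
    ultimately have "filterlim (\<lambda>k. bump 1 ((1 / R k) *\<^sub>R x) * R k powr \<alpha>) at_top sequentially"
      by (rule filterlim_tendsto_pos_mult_at_top)
    then have "eventually (\<lambda>k. \<bar>\<phi> x\<bar> \<le> bump 1 ((1 / R k) *\<^sub>R x) * R k powr \<alpha>) sequentially"
      by (simp add: filterlim_at_top)
    then show ?thesis
      by eventually_elim (auto simp: f_def W_def mult.commute abs_le_iff min_def max_def)
  qed
  let ?M = "lborel \<Otimes>\<^sub>M (lborel :: 'a measure)"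
  define D where "D k = dquot s p (\<lambda>x. f k x - \<phi> x)" for k
  have dc: "continuous_on UNIV (\<lambda>x. f k x - \<phi> x)" for k
    by (intro continuous_intros fc \<phi>)
  have Dm: "D k \<in> borel_measurable ?M" for k
    unfolding D_def by (rule dquot_measurable[OF dc])
  obtain C where C: "ennreal (2 powr p) * gagliardo_p s p \<phi> + ennreal (2 powr p) * (gagliardo_p s p \<phi> + P) = ennreal C" "C \<ge> 0"
  proof -
    have "ennreal (2 powr p) * gagliardo_p s p \<phi> + ennreal (2 powr p) * (gagliardo_p s p \<phi> + P) < top"
      using fin P by (simp add: ennreal_mult_less_top)
    then show ?thesis using that less_top_ennreal by metis
  qed
  have Db: "Lp_pow p ?M (D k) \<le> ennreal C" for k
  proof -
    have "Lp_pow p ?M (D k) = Lp_pow p ?M (\<lambda>z. dquot s p (f k) z + - dquot s p \<phi> z)"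
      by (simp add: D_def dquot_def algebra_simps)
    also have "\<dots> \<le> ennreal ((1 + 1) powr p) * Lp_pow p ?M (\<lambda>z. - dquot s p \<phi> z)
      + ennreal ((1 + 1 / 1) powr p) * Lp_pow p ?M (dquot s p (f k))"
      using p by (intro nn_integral_powr_add_le borel_measurable_uminus dquot_measurable fc \<phi>) auto
    also have "\<dots> = ennreal (2 powr p) * gagliardo_p s p \<phi> + ennreal (2 powr p) * gagliardo_p s p (f k)"
      using p by (simp add: gagliardo_dquot[OF \<phi>] gagliardo_dquot[OF fc])
    also have "\<dots> \<le> ennreal (2 powr p) * gagliardo_p s p \<phi> + ennreal (2 powr p) * (gagliardo_p s p \<phi> + P)"
      by (intro add_left_mono mult_left_mono fg) auto
    finally show ?thesis using C by simp
  qed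
  have Dl: "(\<lambda>k. D k z) \<longlonglongrightarrow> 0" for z
  proof -
    have "eventually (\<lambda>k. D k z = 0) sequentially"
      using ev[of "fst z"] ev[of "snd z"] by eventually_elim (simp add: D_def dquot_def)
    then show ?thesis by (rule tendsto_eventually)
  qed
  have "eventually (\<lambda>k. f k x0 = \<phi> x0 \<and> f k y0 = \<phi> y0) sequentially"
    using ev[of x0] ev[of y0] by eventually_elim simp
  then obtain n0 where n0: "\<And>k. k \<ge> n0 \<Longrightarrow> f k x0 = \<phi> x0" "\<And>k. k \<ge> n0 \<Longrightarrow> f k y0 = \<phi> y0"
    by (auto simp: eventually_sequentially)
  have fin': "Lp_pow p ?M (dquot s p \<phi>) < \<infinity>"
    using fin gagliardo_dquot[OF \<phi>, of p s] p by simp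
  show ?thesis
  proof (rule banach_saks_perturb[OF Dm dquot_measurable[OF \<phi>] Db Dl p C(2) e fin', of n0])
    fix K :: nat and r :: "nat \<Rightarrow> nat"
    assume K: "K > 0" and r: "\<And>j. j < K \<Longrightarrow> n0 \<le> r j"
      and le: "Lp_pow p ?M (\<lambda>z. (1 / real K) *\<^sub>R (\<Sum>j<K. D (r j) z) + dquot s p \<phi> z)
        \<le> Lp_pow p ?M (dquot s p \<phi>) + ennreal e"
    define v where "v x = (1 / real K) * (\<Sum>j<K. f (r j) x)" for x
    have vc: "continuous_on UNIV v"
      unfolding v_def by (intro continuous_intros fc)
    have "dquot s p v z = (1 / real K) *\<^sub>R (\<Sum>j<K. D (r j) z) + dquot s p \<phi> z" for z
    proof -
      define w where "w = norm (fst z - snd z) powr (- ((real DIM('a) + s * p) / p))"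
      have "D (r j) z = (f (r j) (fst z) - f (r j) (snd z)) * w - dquot s p \<phi> z" for j
        by (simp add: D_def dquot_def w_def algebra_simps)
      then have "(\<Sum>j<K. D (r j) z) = ((\<Sum>j<K. f (r j) (fst z)) - (\<Sum>j<K. f (r j) (snd z))) * w - real K * dquot s p \<phi> z"
        by (simp add: sum_subtractf sum_distrib_right[symmetric])
      moreover have "dquot s p v z = (1 / real K) * (((\<Sum>j<K. f (r j) (fst z)) - (\<Sum>j<K. f (r j) (snd z))) * w)"
        by (simp add: dquot_def v_def w_def left_diff_distrib diff_divide_distrib)
      ultimately show ?thesis
        using K by (simp add: diff_divide_distrib)
    qed
    then have vg: "gagliardo_p s p v \<le> gagliardo_p s p \<phi> + ennreal e"
      using le p unfolding gagliardo_dquot[OF vc zero_less_p] gagliardo_dquot[OF \<phi> zero_less_p] by simp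
    have vx: "v x0 = \<phi> x0" "v y0 = \<phi> y0"
      using K r n0 by (simp_all add: v_def)
    have vsupp: "norm x \<le> (\<Sum>j<K. R (r j))" if "v x \<noteq> 0" for x
    proof -
      have "\<exists>j<K. f (r j) x \<noteq> 0"
      proof (rule ccontr)
        assume "\<not> (\<exists>j<K. f (r j) x \<noteq> 0)"
        then have "v x = 0" by (simp add: v_def)
        then show False using that by simp
      qed
      then obtain j where j: "j < K" "f (r j) x \<noteq> 0" by blast
      have "norm x \<le> R (r j)" by (rule fsupp[OF j(2)])
      also have "\<dots> \<le> (\<Sum>j<K. R (r j))"
        using j(1) R by (intro member_le_sum) (auto intro: less_imp_le)
      finally show ?thesis .
    qed
    \<comment> \<open>The average v is continuous with compact support; mollifying it yields a test
      function without raising the energy. The smaller radius serves both points.\<close>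
    obtain r1 where r1: "r1 > 0" "\<And>\<eta> :: 'a \<Rightarrow> real. mollifier r1 \<eta> \<Longrightarrow> \<bar>conv v \<eta> x0 - v x0\<bar> \<le> e"
      using conv_close[OF vc e] by blast
    obtain r2 where r2: "r2 > 0" "\<And>\<eta> :: 'a \<Rightarrow> real. mollifier r2 \<eta> \<Longrightarrow> \<bar>conv v \<eta> y0 - v y0\<bar> \<le> e"
      using conv_close[OF vc e] by blast
    obtain \<eta> :: "'a \<Rightarrow> real" where \<eta>: "mollifier (min r1 r2) \<eta>"
      using mollifier_exists[of "min r1 r2"] r1 r2 by auto
    show ?thesis
    proof (rule that[of "conv v \<eta>"])
      show "test_fun (conv v \<eta>)"
        by (rule test_fun_conv[OF vc vsupp]) (use \<eta> in \<open>auto simp: mollifier_def\<close>)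
      show "gagliardo_p s p (conv v \<eta>) \<le> gagliardo_p s p \<phi> + ennreal e"
        using gagliardo_conv_le[OF vc \<eta> p] vg by (rule order_trans)
      show "\<bar>conv v \<eta> x0 - \<phi> x0\<bar> \<le> e"
        using r1(2)[OF mollifier_mono[OF \<eta>]] vx by simp
      show "\<bar>conv v \<eta> y0 - \<phi> y0\<bar> \<le> e"
        using r2(2)[OF mollifier_mono[OF \<eta>]] vx by simp
    qed
  qed
qed

section \<open>Density of test functions, local case\<close>

text \<open>The energy is an infimum over weak gradients, so a nearly optimal one is extracted;
  finiteness makes the added e a strict increase.\<close>

lemma grad_Lp_approx:
  assumes "grad_Lp_p p \<phi> < \<infinity>" "0 < e"
  obtains g where "weak_gradient \<phi> g" "Lp_pow p lborel g \<le> grad_Lp_p p \<phi> + ennreal e"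
proof -
  have "grad_Lp_p p \<phi> < grad_Lp_p p \<phi> + ennreal e"
    using assms by (cases "grad_Lp_p p \<phi>") (auto simp: ennreal_less_iff simp flip: ennreal_plus)
  then obtain g where "weak_gradient \<phi> g" "Lp_pow p lborel g < grad_Lp_p p \<phi> + ennreal e"
    unfolding grad_Lp_p_def[of p \<phi>] INF_less_iff by auto
  then show ?thesis using that less_imp_le by metis
qed

lemma gradient_mult:
  assumes "smooth_fun f" "smooth_fun g"
  shows "gradient (\<lambda>x. f x * g x) x = f x *\<^sub>R gradient g x + g x *\<^sub>R gradient f x"
  by (simp add: gradient_def frechet_derivative_mult[OF assms] scaleR_sum_right sum.distrib[symmetric]
      scaleR_add_left mult.commute)

lemma gradient_diff_const:
  assumes "smooth_fun f"
  shows "gradient (\<lambda>x. f x - c) x = gradient f x"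
proof -
  have "((\<lambda>x. f x - c) has_derivative frechet_derivative f (at x)) (at x)"
    using has_derivative_diff[OF smooth_fun_has_derivative[OF assms] has_derivative_const] by simp
  then have "frechet_derivative (\<lambda>x. f x - c) (at x) = frechet_derivative f (at x)"
    by (metis frechet_derivative_at)
  then show ?thesis by (simp add: gradient_def)
qed

lemma gradient_scale:
  assumes "smooth_fun f"
  shows "gradient (\<lambda>x. f (c *\<^sub>R x)) x = c *\<^sub>R gradient f (c *\<^sub>R x)"
  using frechet_derivative_affine[OF assms, of 0 c x] by (simp add: gradient_def scaleR_sum_right)

lemma test_fun_gradient_bounded:
  assumes "test_fun f"
  obtains B where "B > 0" "\<And>x. norm (gradient f x) \<le> B"
proof -
  obtain B where B: "B > 0" "\<And>x v. \<bar>frechet_derivative f (at x) v\<bar> \<le> B * norm v"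
    using test_fun_derivative_bounded[OF assms] by blast
  have "norm (gradient f x) \<le> (\<Sum>i\<in>(Basis::'a set). B)" for x
  proof -
    have "norm (gradient f x) \<le> (\<Sum>i\<in>Basis. \<bar>gradient f x \<bullet> i\<bar>)" by (rule norm_le_l1)
    also have "\<dots> \<le> (\<Sum>i\<in>(Basis::'a set). B)"
    proof (rule sum_mono)
      fix i :: 'a assume i: "i \<in> Basis"
      then show "\<bar>gradient f x \<bullet> i\<bar> \<le> B"
        using B(2)[of x i] by (simp add: gradient_inner)
    qed
    finally show ?thesis .
  qed
  moreover have "(\<Sum>i\<in>(Basis::'a set). B) > 0" using B by (intro sum_pos) auto
  ultimately show ?thesis using that by blast
qed

lemma weak_gradient_average:
  fixes u :: "nat \<Rightarrow> 'a::euclidean_space \<Rightarrow> real"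
  assumes "\<And>j. test_fun (u j)"
  shows "weak_gradient (\<lambda>x. c * (\<Sum>j<K. u j x)) (\<lambda>x. c *\<^sub>R (\<Sum>j<K. gradient (u j) x))"
proof (rule weak_gradient_cmult)
  show "weak_gradient (\<lambda>x. \<Sum>j<K. u j x) (\<lambda>x. \<Sum>j<K. gradient (u j) x)"
  proof (induction K)
    case 0
    have "gradient (\<lambda>x::'a. 0 :: real) = (\<lambda>x. 0)"
      by (simp add: gradient_def fun_eq_iff frechet_derivative_const)
    then show ?case using weak_gradient_test_fun[OF test_fun_zero[where 'a='a]] by simp
  next
    case (Suc K)
    then show ?case
      using weak_gradient_add[OF Suc weak_gradient_test_fun[OF assms]] by simp
  qed
qed

text \<open>The conclusion controls a difference of values, because a constant is subtracted before
  cutting off. The Hoelder bound is assumed because it limits the growth of the function on the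
  support of the bump.\<close>

lemma local_density:
  fixes \<phi> :: "'a::euclidean_space \<Rightarrow> real"
  assumes \<phi>: "continuous_on UNIV \<phi>" and fin: "grad_Lp_p p \<phi> < \<infinity>"
    and p: "1 < p" and \<alpha>: "\<alpha> > 0" "\<alpha> * p = p - real DIM('a)" and e: "0 < e"
    and hold: "\<And>x y. \<bar>\<phi> x - \<phi> y\<bar> \<le> norm (x - y) powr \<alpha>"
  obtains u where "test_fun u" "grad_Lp_p p u \<le> grad_Lp_p p \<phi> + ennreal e"
    "\<bar>(u x0 - u y0) - (\<phi> x0 - \<phi> y0)\<bar> \<le> e"
proof -
  \<comment> \<open>Budget: e/2 of energy each for the choice of g and for the averaging; in the
    values, e/4 for mollification and e/8 for averaging at each of the two points.\<close>
  have e2: "e / 2 > 0" "e / 4 > 0" "e / 8 > 0" using e by auto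
  obtain g where g: "weak_gradient \<phi> g" "Lp_pow p lborel g \<le> grad_Lp_p p \<phi> + ennreal (e / 2)"
    using grad_Lp_approx[OF fin e2(1)] by blast
  obtain r1 where r1: "r1 > 0" "\<And>\<eta> :: 'a \<Rightarrow> real. mollifier r1 \<eta> \<Longrightarrow> \<bar>conv \<phi> \<eta> x0 - \<phi> x0\<bar> \<le> e / 4"
    using conv_close[OF \<phi> e2(2)] by blast
  obtain r2 where r2: "r2 > 0" "\<And>\<eta> :: 'a \<Rightarrow> real. mollifier r2 \<eta> \<Longrightarrow> \<bar>conv \<phi> \<eta> y0 - \<phi> y0\<bar> \<le> e / 4"
    using conv_close[OF \<phi> e2(2)] by blast
  obtain \<eta> :: "'a \<Rightarrow> real" where \<eta>: "mollifier (min r1 r2) \<eta>"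
    using mollifier_exists[of "min r1 r2"] r1 r2 by auto
  then have \<eta>t: "test_fun \<eta>" and m1: "mollifier r1 \<eta>" and m2: "mollifier r2 \<eta>"
    unfolding mollifier_def by auto
  define h where "h = conv \<phi> \<eta>"
  have hs: "smooth_fun h" unfolding h_def by (rule smooth_fun_conv[OF \<phi> \<eta>t])
  \<comment> \<open>Vanishing at 0 turns the Hoelder bound into the growth bound |x|^alpha and
    leaves the gradient unchanged.\<close>
  define \<psi> where "\<psi> x = h x - h 0" for x
  have \<psi>s: "smooth_fun \<psi>"
    unfolding \<psi>_def using smooth_fun_add[OF hs smooth_fun_const[of "- h 0"]] by simp
  have G\<psi>: "gradient \<psi> x = gradient h x" for x
    unfolding \<psi>_def[abs_def] by (rule gradient_diff_const[OF hs])
  have G: "Lp_pow p lborel (gradient \<psi>) \<le> grad_Lp_p p \<phi> + ennreal (e / 2)"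
    unfolding G\<psi> h_def using gradient_conv_le[OF \<phi> g(1) \<eta> p] g(2) by (rule order_trans)
  have Gfin: "Lp_pow p lborel (gradient \<psi>) < \<infinity>"
    by (rule le_less_trans[OF G]) (use fin in simp)
  have \<psi>le: "\<bar>\<psi> x\<bar> \<le> norm x powr \<alpha>" for x
    using conv_holder[OF \<phi> \<eta>, of 1 \<alpha> x 0] hold by (simp add: \<psi>_def h_def)
  define \<zeta> where "\<zeta> x = (1 / bump 1 (0::'a)) * bump 1 x" for x :: 'a
  have b0: "bump 1 (0::'a) > 0" using bump_pos_iff[of 1 "0::'a"] by simp
  have \<zeta>t: "test_fun \<zeta>" unfolding \<zeta>_def by (intro test_fun_cmult test_fun_bump) simp
  have \<zeta>0: "\<zeta> 0 = 1" using b0 by (simp add: \<zeta>_def)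
  have \<zeta>supp: "norm x < 1" if "\<zeta> x \<noteq> 0" for x
    using that bump_support[of 1 x] by (auto simp: \<zeta>_def)
  obtain X where X: "X > 0" "\<And>x. \<bar>\<zeta> x\<bar> \<le> X" using test_fun_bounded[OF \<zeta>t] by blast
  obtain B where B: "B > 0" "\<And>x. norm (gradient \<zeta> x) \<le> B" using test_fun_gradient_bounded[OF \<zeta>t] by blast
  define R where "R k = real (Suc k)" for k
  have R: "R k > 0" for k by (simp add: R_def)
  have Rlim: "filterlim R at_top sequentially"
    unfolding R_def[abs_def] using filterlim_real_sequentially filterlim_Suc by (rule filterlim_compose)
  have Rinv: "(\<lambda>k. 1 / R k) \<longlonglongrightarrow> 0"
    using tendsto_divide_0[OF tendsto_const filterlim_at_top_imp_at_infinity[OF Rlim]] .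
  define \<zeta>' where "\<zeta>' k x = \<zeta> ((1 / R k) *\<^sub>R x)" for k x
  have \<zeta>'t: "test_fun (\<zeta>' k)" for k
    unfolding \<zeta>'_def using test_fun_affine[OF \<zeta>t, of "1 / R k" 0] R[of k] by simp
  have \<zeta>'lim: "(\<lambda>k. \<zeta>' k x) \<longlonglongrightarrow> 1" for x
  proof -
    have "(\<lambda>k. (1 / R k) *\<^sub>R x) \<longlonglongrightarrow> 0 *\<^sub>R x" using Rinv by (intro tendsto_scaleR tendsto_const)
    then have "(\<lambda>k. \<zeta> ((1 / R k) *\<^sub>R x)) \<longlonglongrightarrow> \<zeta> (0 *\<^sub>R x)"
      using continuous_on_tendsto_compose[OF test_fun_continuous[OF \<zeta>t, of UNIV]] by auto
    then show ?thesis by (simp add: \<zeta>'_def \<zeta>0)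
  qed
  have G\<zeta>: "norm (gradient (\<zeta>' k) x) \<le> B * (1 / R k)" for k x
    unfolding \<zeta>'_def[abs_def] gradient_scale[OF test_fun_smooth[OF \<zeta>t]]
    using B(2)[of "(1 / R k) *\<^sub>R x"] R[of k] by (simp add: divide_right_mono)
  have G\<zeta>0: "gradient (\<zeta>' k) x = 0" if "R k < norm x" for k x
  proof -
    have "frechet_derivative \<zeta> (at ((1 / R k) *\<^sub>R x)) v = 0" for v
      using that R[of k] by (intro frechet_derivative_eq_0_outside[where R=1] \<zeta>supp) (auto simp: field_simps)
    then show ?thesis
      unfolding \<zeta>'_def[abs_def] gradient_scale[OF test_fun_smooth[OF \<zeta>t]] by (simp add: gradient_def)
  qed
  define U where "U k x = \<psi> x * \<zeta>' k x" for k x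
  have Ut: "test_fun (U k)" for k unfolding U_def by (rule test_fun_mult_smooth[OF \<zeta>'t \<psi>s])
  have GU: "gradient (U k) x = \<psi> x *\<^sub>R gradient (\<zeta>' k) x + \<zeta>' k x *\<^sub>R gradient \<psi> x" for k x
    unfolding U_def[abs_def] by (rule gradient_mult[OF \<psi>s test_fun_smooth[OF \<zeta>'t]])
  \<comment> \<open>This is the gradient of \<open>U k\<close> minus that of \<open>\<psi>\<close>,
    so averages of D are the gradient errors of averaged cut-offs.\<close>
  define D where "D k x = \<psi> x *\<^sub>R gradient (\<zeta>' k) x + (\<zeta>' k x - 1) *\<^sub>R gradient \<psi> x" for k x
  have [measurable]: "\<psi> \<in> borel_measurable borel" "\<zeta>' k \<in> borel_measurable borel"
    "gradient \<psi> \<in> borel_measurable borel" "gradient (\<zeta>' k) \<in> borel_measurable borel" for k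
    by (auto intro: smooth_fun_measurable gradient_measurable \<psi>s test_fun_smooth \<zeta>'t)
  have Dm: "D k \<in> borel_measurable lborel" for k
    unfolding D_def by measurable
  \<comment> \<open>On a ball of volume proportional to R^N the integrand is at most (R^alpha B /
    R)^p, and alpha p - p + N = 0: the bound does not depend on k.\<close>
  have first: "Lp_pow p lborel (\<lambda>x. \<psi> x *\<^sub>R gradient (\<zeta>' k) x) \<le> ennreal (B powr p * unit_ball_vol (real DIM('a)))" for k
  proof -
    have "Lp_pow p lborel (\<lambda>x. \<psi> x *\<^sub>R gradient (\<zeta>' k) x)
        \<le> (\<integral>\<^sup>+x. ennreal ((R k powr \<alpha> * (B * (1 / R k))) powr p) * indicator (cball 0 (R k)) (x::'a) \<partial>lborel)"
    proof (rule nn_integral_mono)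
      fix x :: 'a
      show "ennreal (norm (\<psi> x *\<^sub>R gradient (\<zeta>' k) x) powr p) \<le> ennreal ((R k powr \<alpha> * (B * (1 / R k))) powr p) * indicator (cball 0 (R k)) x"
      proof (cases "norm x \<le> R k")
        case True
        have "\<bar>\<psi> x\<bar> \<le> R k powr \<alpha>"
          using True \<alpha> by (intro order_trans[OF \<psi>le powr_mono2]) auto
        then have "norm (\<psi> x *\<^sub>R gradient (\<zeta>' k) x) \<le> R k powr \<alpha> * (B * (1 / R k))"
          unfolding norm_scaleR by (intro mult_mono G\<zeta>) auto
        then have "norm (\<psi> x *\<^sub>R gradient (\<zeta>' k) x) powr p \<le> (R k powr \<alpha> * (B * (1 / R k))) powr p"
          using p by (intro powr_mono2) auto
        then show ?thesis using True by (simp add: ennreal_leI)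
      next
        case False
        then show ?thesis using G\<zeta>0[of k x] by simp
      qed
    qed
    also have "\<dots> = ennreal ((R k powr \<alpha> * (B * (1 / R k))) powr p) * ennreal (unit_ball_vol (real DIM('a)) * R k ^ DIM('a))"
      using R[of k] by (simp add: nn_integral_cmult_indicator emeasure_cball)
    also have "\<dots> = ennreal (B powr p * unit_ball_vol (real DIM('a)))"
    proof -
      have "(R k powr \<alpha> * (B * (1 / R k))) powr p = R k powr (\<alpha> * p) * B powr p / R k powr p"
        using R[of k] B(1) by (simp add: powr_mult powr_divide powr_powr)
      also have "\<dots> = B powr p / R k powr (real DIM('a))"
        using R[of k] by (simp add: \<alpha>(2) powr_diff field_simps)
      also have "R k powr (real DIM('a)) = R k ^ DIM('a)"
        using R[of k] by (simp add: powr_realpow)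
      finally have "(R k powr \<alpha> * (B * (1 / R k))) powr p * (unit_ball_vol (real DIM('a)) * R k ^ DIM('a)) = B powr p * unit_ball_vol (real DIM('a))"
        using R[of k] by simp
      then show ?thesis using R[of k] by (simp flip: ennreal_mult)
    qed
    finally show ?thesis .
  qed
  have second: "Lp_pow p lborel (\<lambda>x. (\<zeta>' k x - 1) *\<^sub>R gradient \<psi> x)
      \<le> ennreal ((X + 1) powr p) * Lp_pow p lborel (gradient \<psi>)" for k
  proof -
    have "norm ((\<zeta>' k x - 1) *\<^sub>R gradient \<psi> x) powr p \<le> (X + 1) powr p * norm (gradient \<psi> x) powr p" for x
    proof -
      have "\<bar>\<zeta>' k x - 1\<bar> \<le> X + 1" using X(2)[of "(1 / R k) *\<^sub>R x"] unfolding \<zeta>'_def by linarith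
      then have "norm ((\<zeta>' k x - 1) *\<^sub>R gradient \<psi> x) \<le> (X + 1) * norm (gradient \<psi> x)"
        by (simp add: mult_right_mono)
      then have "norm ((\<zeta>' k x - 1) *\<^sub>R gradient \<psi> x) powr p \<le> ((X + 1) * norm (gradient \<psi> x)) powr p"
        using p by (intro powr_mono2) auto
      then show ?thesis using X by (simp add: powr_mult)
    qed
    then have "Lp_pow p lborel (\<lambda>x. (\<zeta>' k x - 1) *\<^sub>R gradient \<psi> x)
       \<le> (\<integral>\<^sup>+x. ennreal ((X + 1) powr p) * ennreal (norm (gradient \<psi> x) powr p) \<partial>lborel)"
      by (intro nn_integral_mono) (simp add: ennreal_leI flip: ennreal_mult)
    then show ?thesis by (simp add: nn_integral_cmult)
  qed
  define Cb where "Cb = ennreal (2 powr p) * (ennreal ((X + 1) powr p) * Lp_pow p lborel (gradient \<psi>))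
     + ennreal (2 powr p) * ennreal (B powr p * unit_ball_vol (real DIM('a)))"
  have "Cb < top"
    using Gfin by (simp add: Cb_def ennreal_mult_less_top)
  then obtain C where C: "Cb = ennreal C" "C \<ge> 0"
    using less_top_ennreal by metis
  have Db: "Lp_pow p lborel (D k) \<le> ennreal C" for k
  proof -
    have "Lp_pow p lborel (D k) \<le>
        ennreal ((1 + 1) powr p) * Lp_pow p lborel (\<lambda>x. (\<zeta>' k x - 1) *\<^sub>R gradient \<psi> x)
      + ennreal ((1 + 1 / 1) powr p) * Lp_pow p lborel (\<lambda>x. \<psi> x *\<^sub>R gradient (\<zeta>' k) x)"
      unfolding D_def using p by (intro nn_integral_powr_add_le) auto
    also have "\<dots> \<le> Cb"
      unfolding Cb_def using first[of k] second[of k] by (intro add_mono mult_mono) auto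
    finally show ?thesis using C by simp
  qed
  have Dl: "(\<lambda>k. D k x) \<longlonglongrightarrow> 0" for x
  proof -
    have "(\<lambda>k. gradient (\<zeta>' k) x) \<longlonglongrightarrow> 0"
    proof (rule Lim_null_comparison)
      show "eventually (\<lambda>k. norm (gradient (\<zeta>' k) x) \<le> B * (1 / R k)) sequentially"
        using G\<zeta> by simp
      show "(\<lambda>k. B * (1 / R k)) \<longlonglongrightarrow> 0"
        using tendsto_mult[OF tendsto_const Rinv, of B] by simp
    qed
    then have "(\<lambda>k. D k x) \<longlonglongrightarrow> \<psi> x *\<^sub>R 0 + (1 - 1) *\<^sub>R gradient \<psi> x"
      unfolding D_def by (intro tendsto_intros \<zeta>'lim)
    then show ?thesis by simp
  qed
  have Ul: "(\<lambda>k. U k x) \<longlonglongrightarrow> \<psi> x" for x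
    unfolding U_def using tendsto_mult[OF tendsto_const \<zeta>'lim, of "\<psi> x" x] by simp
  have "eventually (\<lambda>k. dist (U k x0) (\<psi> x0) < e / 8 \<and> dist (U k y0) (\<psi> y0) < e / 8) sequentially"
    using tendstoD[OF Ul e2(3), of x0] tendstoD[OF Ul e2(3), of y0] by eventually_elim simp
  then obtain n0 where n0: "\<And>k. k \<ge> n0 \<Longrightarrow> \<bar>U k x0 - \<psi> x0\<bar> \<le> e / 8" "\<And>k. k \<ge> n0 \<Longrightarrow> \<bar>U k y0 - \<psi> y0\<bar> \<le> e / 8"
    by (force simp: eventually_sequentially dist_real_def)
  have G\<psi>m: "gradient \<psi> \<in> borel_measurable lborel" by simp
  show ?thesis
  proof (rule banach_saks_perturb[OF Dm G\<psi>m Db Dl p C(2) e2(1) Gfin, of n0])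
    fix K :: nat and r :: "nat \<Rightarrow> nat"
    assume K: "K > 0" and r: "\<And>j. j < K \<Longrightarrow> n0 \<le> r j"
      and le: "Lp_pow p lborel (\<lambda>x. (1 / real K) *\<^sub>R (\<Sum>j<K. D (r j) x) + gradient \<psi> x)
        \<le> Lp_pow p lborel (gradient \<psi>) + ennreal (e / 2)"
    define v where "v x = (1 / real K) * (\<Sum>j<K. U (r j) x)" for x
    have vt: "test_fun v"
      unfolding v_def by (intro test_fun_cmult test_fun_sum Ut) auto
    have wg: "weak_gradient v (\<lambda>x. (1 / real K) *\<^sub>R (\<Sum>j<K. gradient (U (r j)) x))"
      unfolding v_def by (rule weak_gradient_average[OF Ut])
    have eq: "(1 / real K) *\<^sub>R (\<Sum>j<K. gradient (U (r j)) x) = (1 / real K) *\<^sub>R (\<Sum>j<K. D (r j) x) + gradient \<psi> x" for x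
    proof -
      have "gradient (U (r j)) x = D (r j) x + gradient \<psi> x" for j
        by (simp add: GU D_def algebra_simps)
      then show ?thesis
        using K by (simp add: sum.distrib scaleR_add_right sum_constant_scaleR)
    qed
    have "grad_Lp_p p v \<le> Lp_pow p lborel (\<lambda>x. (1 / real K) *\<^sub>R (\<Sum>j<K. D (r j) x) + gradient \<psi> x)"
      unfolding grad_Lp_p_def eq[symmetric] using wg by (intro INF_lower) auto
    also note le
    also have "Lp_pow p lborel (gradient \<psi>) + ennreal (e / 2) \<le> (grad_Lp_p p \<phi> + ennreal (e / 2)) + ennreal (e / 2)"
      by (intro add_right_mono G)
    also have "\<dots> = grad_Lp_p p \<phi> + ennreal e"
      using e by (simp add: add.assoc flip: ennreal_plus)
    finally have vg: "grad_Lp_p p v \<le> grad_Lp_p p \<phi> + ennreal e" .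
    have avg: "\<bar>v x - \<psi> x\<bar> \<le> e / 8" if "\<And>k. k \<ge> n0 \<Longrightarrow> \<bar>U k x - \<psi> x\<bar> \<le> e / 8" for x
    proof -
      have "v x - \<psi> x = (1 / real K) * (\<Sum>j<K. U (r j) x - \<psi> x)"
        using K by (simp add: v_def sum_subtractf field_simps)
      also have "\<bar>\<dots>\<bar> \<le> (1 / real K) * (\<Sum>j<K. e / 8)"
        unfolding abs_mult using that r by (intro mult_mono order_trans[OF sum_abs] sum_mono) auto
      also have "\<dots> = e / 8" using K by simp
      finally show ?thesis .
    qed
    have "\<bar>v x0 - \<psi> x0\<bar> \<le> e / 8" "\<bar>v y0 - \<psi> y0\<bar> \<le> e / 8"
      using avg n0 by blast+
    moreover have "\<bar>h x0 - \<phi> x0\<bar> \<le> e / 4" "\<bar>h y0 - \<phi> y0\<bar> \<le> e / 4"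
      unfolding h_def using r1(2)[OF m1] r2(2)[OF m2] .
    ultimately have "\<bar>(v x0 - v y0) - (\<phi> x0 - \<phi> y0)\<bar> \<le> e"
      unfolding \<psi>_def by linarith
    then show ?thesis by (intro that[OF vt vg])
  qed
qed

section \<open>Limits of sequences with bounded energy\<close>

lemma fatou_powr:
  fixes f :: "nat \<Rightarrow> 'b \<Rightarrow> 'e::{real_normed_vector, second_countable_topology}"
  assumes [measurable]: "\<And>n. f n \<in> borel_measurable M"
    and lim: "AE x in M. (\<lambda>n. f n x) \<longlonglongrightarrow> g x" and p: "0 < p"
    and le: "eventually (\<lambda>n. Lp_pow p M (f n) \<le> c n) sequentially" and c: "c \<longlonglongrightarrow> C"
  shows "Lp_pow p M g \<le> C"
proof -
  have "AE x in M. ennreal (norm (g x) powr p) = liminf (\<lambda>n. ennreal (norm (f n x) powr p))"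
    using lim
  proof eventually_elim
    case (elim x)
    then have "(\<lambda>n. norm (f n x) powr p) \<longlonglongrightarrow> norm (g x) powr p"
      using p by (intro tendsto_powr' tendsto_norm tendsto_const) auto
    then have "(\<lambda>n. ennreal (norm (f n x) powr p)) \<longlonglongrightarrow> ennreal (norm (g x) powr p)"
      by (rule tendsto_ennrealI)
    then show ?case by (intro lim_imp_Liminf[symmetric]) auto
  qed
  then have "Lp_pow p M g = (\<integral>\<^sup>+x. liminf (\<lambda>n. ennreal (norm (f n x) powr p)) \<partial>M)"
    by (rule nn_integral_cong_AE)
  also have "\<dots> \<le> liminf (\<lambda>n. \<integral>\<^sup>+x. ennreal (norm (f n x) powr p) \<partial>M)"
    by (rule nn_integral_liminf) measurable
  also have "\<dots> \<le> liminf c"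
    by (rule Liminf_mono[OF le])
  also have "\<dots> = C"
    using c by (intro lim_imp_Liminf) auto
  finally show ?thesis .
qed

text \<open>The Riesz-Fischer argument, arranged to integrate a sum of p-th powers of weighted
  increments instead of using Minkowski's inequality.\<close>

lemma Lp_cauchy_AE_limit:
  fixes g :: "nat \<Rightarrow> 'b \<Rightarrow> 'e::euclidean_space"
  assumes [measurable]: "\<And>n. g n \<in> borel_measurable M" and p: "0 < p"
    and cauchy: "\<And>e. e > 0 \<Longrightarrow> \<exists>N. \<forall>n\<ge>N. \<forall>k\<ge>N. Lp_pow p M (\<lambda>x. g n x - g k x) \<le> ennreal e"
  obtains r G where "strict_mono (r :: nat \<Rightarrow> nat)" "G \<in> borel_measurable M" "AE x in M. (\<lambda>n. g (r n) x) \<longlonglongrightarrow> G x"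
proof -
  \<comment> \<open>The factor 2^(-j p) offsets the weight 2^j put on the j-th increment, and 2^(-j)
    makes the integrals summable. Finiteness of the sum at x then forces the increments there to
    decay like 2^(-j).\<close>
  define \<epsilon> where "\<epsilon> j = (1/2) ^ j * ((1/2) ^ j) powr p" for j :: nat
  have \<epsilon>: "\<epsilon> j > 0" for j by (simp add: \<epsilon>_def)
  have "\<forall>j. \<exists>N. \<forall>n\<ge>N. \<forall>k\<ge>N. Lp_pow p M (\<lambda>x. g n x - g k x) \<le> ennreal (\<epsilon> j)"
    by (intro allI cauchy \<epsilon>)
  from choice[OF this] obtain N where N: "\<And>j n k. n \<ge> N j \<Longrightarrow> k \<ge> N j \<Longrightarrow> (Lp_pow p M (\<lambda>x. g n x - g k x)) \<le> ennreal (\<epsilon> j)"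
    by auto
  \<comment> \<open>The maximum keeps the indices strictly increasing while placing the j-th one
    beyond \<open>N j\<close>.\<close>
  define r where "r = rec_nat (N 0) (\<lambda>j m. max (Suc m) (N (Suc j)))"
  have r0: "r 0 = N 0" and rS: "r (Suc j) = max (Suc (r j)) (N (Suc j))" for j
    by (simp_all add: r_def)
  have mono: "strict_mono r"
    by (rule strict_monoI_Suc) (simp add: rS less_Suc_eq_le)
  have rN: "r j \<ge> N j" for j
    by (cases j) (simp_all add: r0 rS)
  define d where "d j x = g (r (Suc j)) x - g (r j) x" for j x
  have [measurable]: "d j \<in> borel_measurable M" for j unfolding d_def by measurable
  have dle: "Lp_pow p M (d j) \<le> ennreal (\<epsilon> j)" for j
  proof -
    have "r (Suc j) \<ge> r j" using mono by (simp add: strict_mono_less_eq)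
    then show ?thesis
      unfolding d_def using rN[of j] by (intro N) auto
  qed
  define s where "s x = (\<Sum>j. ennreal ((2 ^ j * norm (d j x)) powr p))" for x
  have [measurable]: "s \<in> borel_measurable M" unfolding s_def by measurable
  have "(\<integral>\<^sup>+x. s x \<partial>M) = (\<Sum>j. \<integral>\<^sup>+x. ennreal ((2 ^ j * norm (d j x)) powr p) \<partial>M)"
    unfolding s_def by (rule nn_integral_suminf) measurable
  also have "\<dots> \<le> (\<Sum>j. ennreal ((1/2) ^ j))"
  proof (rule suminf_le)
    fix j
    have "(\<integral>\<^sup>+x. ennreal ((2 ^ j * norm (d j x)) powr p) \<partial>M) = ennreal ((2 ^ j) powr p) * Lp_pow p M (d j)"
      by (simp add: powr_mult ennreal_mult nn_integral_cmult)
    also have "\<dots> \<le> ennreal ((2 ^ j) powr p) * ennreal (\<epsilon> j)"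
      by (intro mult_left_mono dle) auto
    also have "\<dots> = ennreal ((1/2) ^ j)"
      by (simp add: \<epsilon>_def power_divide powr_divide flip: ennreal_mult)
    finally show "(\<integral>\<^sup>+x. ennreal ((2 ^ j * norm (d j x)) powr p) \<partial>M) \<le> ennreal ((1/2) ^ j)" .
  qed auto
  also have "\<dots> = ennreal (\<Sum>j. (1/2) ^ j)"
    by (rule suminf_ennreal2) (auto intro: summable_geometric)
  finally have "(\<integral>\<^sup>+x. s x \<partial>M) \<noteq> \<infinity>"
    by (auto simp: top_unique)
  then have "AE x in M. s x \<noteq> \<infinity>"
    by (rule nn_integral_noteq_infinite[rotated]) measurable
  then have conv: "AE x in M. convergent (\<lambda>n. g (r n) x)"
  proof eventually_elim
    case (elim x)
    then obtain T where T: "s x = ennreal T" "T \<ge> 0" by (cases "s x") auto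
    have dn: "norm (d j x) \<le> T powr (1 / p) * (1/2) ^ j" for j
    proof -
      have "ennreal ((2 ^ j * norm (d j x)) powr p) = (\<Sum>i\<in>{j}. ennreal ((2 ^ i * norm (d i x)) powr p))"
        by simp
      also have "\<dots> \<le> s x"
        unfolding s_def by (rule sum_le_suminf) auto
      finally have "(2 ^ j * norm (d j x)) powr p \<le> T"
        using T by (simp add: ennreal_le_iff)
      then have "((2 ^ j * norm (d j x)) powr p) powr (1 / p) \<le> T powr (1 / p)"
        using p by (intro powr_mono2) auto
      then have "2 ^ j * norm (d j x) \<le> T powr (1 / p)"
        using p by (simp add: powr_powr)
      then show ?thesis
        by (simp add: power_divide pos_le_divide_eq mult.commute)
    qed
    have sg: "summable (\<lambda>j. T powr (1 / p) * (1/2) ^ j)"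
      by (intro summable_mult summable_geometric) simp
    have "summable (\<lambda>j. d j x)"
      by (rule summable_comparison_test'[where N=0, OF sg]) (rule dn)
    then have "convergent (\<lambda>n. g (r 0) x + (\<Sum>j<n. d j x))"
      unfolding summable_iff_convergent by (rule convergent_add[OF convergent_const])
    moreover have "g (r 0) x + (\<Sum>j<n. d j x) = g (r n) x" for n
      unfolding d_def using sum_lessThan_telescope[of "\<lambda>n. g (r n) x" n] by simp
    ultimately show ?case by simp
  qed
  define G where "G x = lim (\<lambda>n. g (r n) x)" for x
  have "G \<in> borel_measurable M"
    unfolding G_def by (rule borel_measurable_lim_metric) measurable
  moreover have "AE x in M. (\<lambda>n. g (r n) x) \<longlonglongrightarrow> G x"
    using conv unfolding G_def by eventually_elim (simp add: convergent_LIMSEQ_iff)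
  ultimately show ?thesis by (rule that[OF mono])
qed

text \<open>Takes the place of Hoelder's inequality: where |d| <= t the first term suffices,
  elsewhere |d| <= t^(1-p) |d|^p. Fixing a small t and then making the L^p energy small gives
  convergence against f.\<close>

lemma nn_integral_mult_test_le:
  fixes d :: "'a::euclidean_space \<Rightarrow> 'e::euclidean_space"
  assumes [measurable]: "d \<in> borel_measurable lborel" and f: "test_fun f" and B: "\<And>x. \<bar>f x\<bar> \<le> B"
    and t: "0 < t" and p: "1 < p"
  shows "(\<integral>\<^sup>+x. ennreal (norm (d x) * \<bar>f x\<bar>) \<partial>lborel) \<le>
    ennreal t * (\<integral>\<^sup>+x. ennreal \<bar>f x\<bar> \<partial>lborel) + ennreal (t powr (1 - p) * B) * Lp_pow p lborel d"
proof -
  have [measurable]: "f \<in> borel_measurable borel" by (rule test_fun_measurable[OF f])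
  have B0: "B \<ge> 0" using B[of 0] by linarith
  have "norm (d x) * \<bar>f x\<bar> \<le> t * \<bar>f x\<bar> + t powr (1 - p) * B * norm (d x) powr p" for x
  proof (cases "norm (d x) \<le> t")
    case True
    then have "norm (d x) * \<bar>f x\<bar> \<le> t * \<bar>f x\<bar>" by (rule mult_right_mono) simp
    then show ?thesis using B0 by (simp add: add_increasing2)
  next
    case False
    have "1 \<le> (norm (d x) / t) powr (p - 1)"
      using False t p by (intro ge_one_powr_ge_zero) auto
    then have "norm (d x) * 1 \<le> norm (d x) * (norm (d x) / t) powr (p - 1)"
      by (rule mult_left_mono) simp
    then have "norm (d x) \<le> norm (d x) * (norm (d x) / t) powr (p - 1)"
      by simp
    also have "\<dots> = t powr (1 - p) * norm (d x) powr p"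
    proof -
      have "norm (d x) > 0" using False t by linarith
      then have "norm (d x) * norm (d x) powr (p - 1) = norm (d x) powr p"
        using powr_add[of "norm (d x)" 1 "p - 1"] by simp
      moreover have "t powr (1 - p) = 1 / t powr (p - 1)"
        using powr_minus_divide[of t "p - 1"] by simp
      ultimately show ?thesis using t by (simp add: powr_divide)
    qed
    finally have "norm (d x) * \<bar>f x\<bar> \<le> (t powr (1 - p) * norm (d x) powr p) * B"
      using B[of x] by (intro mult_mono) auto
    then show ?thesis using t by (simp add: mult_ac add_increasing)
  qed
  then have "(\<integral>\<^sup>+x. ennreal (norm (d x) * \<bar>f x\<bar>) \<partial>lborel) \<le>
     (\<integral>\<^sup>+x. ennreal t * ennreal \<bar>f x\<bar> + ennreal (t powr (1 - p) * B) * ennreal (norm (d x) powr p) \<partial>lborel)"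
    using t B0 by (intro nn_integral_mono) (simp add: ennreal_leI flip: ennreal_plus ennreal_mult)
  also have "\<dots> = ennreal t * (\<integral>\<^sup>+x. ennreal \<bar>f x\<bar> \<partial>lborel) + ennreal (t powr (1 - p) * B) * Lp_pow p lborel d"
    by (simp add: nn_integral_add nn_integral_cmult)
  finally show ?thesis .
qed

text \<open>Both sides of the defining identity pass to the limit: the side with the functions by
  dominated convergence on the support of the test function, the side with the gradients by L^p
  convergence.\<close>

lemma weak_gradient_limit:
  fixes \<psi> :: "nat \<Rightarrow> 'a::euclidean_space \<Rightarrow> real"
  assumes wg: "\<And>n. weak_gradient (\<psi> n) (g n)" and \<psi>: "\<And>n. continuous_on UNIV (\<psi> n)" and \<phi>: "continuous_on UNIV \<phi>"
    and lim: "\<And>x. (\<lambda>n. \<psi> n x) \<longlonglongrightarrow> \<phi> x" and dom: "\<And>n x. \<bar>\<psi> n x\<bar> \<le> w x" and w: "continuous_on UNIV w"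
    and G: "G \<in> borel_measurable lborel" "Lp_pow p lborel G < \<infinity>"
    and Lp: "\<And>e. e > 0 \<Longrightarrow> eventually (\<lambda>n. Lp_pow p lborel (\<lambda>x. g n x - G x) \<le> ennreal e) sequentially"
    and p: "1 < p"
  shows "weak_gradient \<phi> G"
  unfolding weak_gradient_def
proof (intro conjI allI impI ballI)
  show "G \<in> borel_measurable lborel" by (rule G)
  fix f :: "'a \<Rightarrow> real" and i :: 'a assume f: "test_fun f" and i: "i \<in> Basis"
  have [measurable]: "f \<in> borel_measurable borel" by (rule test_fun_measurable[OF f])
  have [measurable]: "G \<in> borel_measurable borel" using G by simp
  have [measurable]: "g n \<in> borel_measurable borel" for n using wg[of n] by (simp add: weak_gradient_def)
  let ?D = "\<lambda>x. frechet_derivative f (at x) i"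
  have D: "test_fun ?D" by (rule test_fun_derivative[OF f])
  obtain B where B: "B > 0" "\<And>x. \<bar>f x\<bar> \<le> B" using test_fun_bounded[OF f] by blast
  show "integrable lborel (\<lambda>x. \<phi> x * ?D x)"
    by (rule integrable_continuous_mult_test_fun[OF \<phi> D])
  have n: "integrable lborel (\<lambda>x. \<psi> n x * ?D x)" "integrable lborel (\<lambda>x. (g n x \<bullet> i) * f x)"
    "(\<integral>x. \<psi> n x * ?D x \<partial>lborel) = - (\<integral>x. (g n x \<bullet> i) * f x \<partial>lborel)" for n
    using wg[of n] f i by (auto simp: weak_gradient_def)
  have l1: "(\<lambda>n. \<integral>x. \<psi> n x * ?D x \<partial>lborel) \<longlonglongrightarrow> (\<integral>x. \<phi> x * ?D x \<partial>lborel)"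
  proof (rule integral_dominated_convergence[where w="\<lambda>x. \<bar>w x * ?D x\<bar>"])
    show "integrable lborel (\<lambda>x. \<bar>w x * ?D x\<bar>)"
      by (intro integrable_abs integrable_continuous_mult_test_fun w D)
    show "AE x in lborel. (\<lambda>n. \<psi> n x * ?D x) \<longlonglongrightarrow> \<phi> x * ?D x"
      by (intro AE_I2 tendsto_mult tendsto_const lim)
    have "\<bar>\<psi> n x\<bar> \<le> \<bar>w x\<bar>" for n x using dom[of n x] by linarith
    then show "AE x in lborel. norm (\<psi> n x * ?D x) \<le> \<bar>w x * ?D x\<bar>" for n
      by (intro AE_I2) (simp add: abs_mult mult_right_mono)
    show "(\<lambda>x. \<phi> x * ?D x) \<in> borel_measurable lborel"
      by (rule borel_measurable_integrable[OF integrable_continuous_mult_test_fun[OF \<phi> D]])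
    show "(\<lambda>x. \<psi> n x * ?D x) \<in> borel_measurable lborel" for n
      by (rule borel_measurable_integrable[OF n(1)])
  qed
  have fI: "(\<integral>\<^sup>+x. ennreal \<bar>f x\<bar> \<partial>lborel) < \<infinity>"
    using integrable_test_fun[OF f] by (simp add: integrable_iff_bounded)
  have comp: "norm ((v \<bullet> i) * c) \<le> norm v * \<bar>c\<bar>" for v c
    using Basis_le_norm[OF i, of v] by (simp add: abs_mult mult_right_mono)
  show iG: "integrable lborel (\<lambda>x. (G x \<bullet> i) * f x)"
    unfolding integrable_iff_bounded
  proof
    have "(\<integral>\<^sup>+x. ennreal (norm ((G x \<bullet> i) * f x)) \<partial>lborel) \<le> (\<integral>\<^sup>+x. ennreal (norm (G x) * \<bar>f x\<bar>) \<partial>lborel)"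
      by (intro nn_integral_mono ennreal_leI comp)
    also have "\<dots> \<le> ennreal 1 * (\<integral>\<^sup>+x. ennreal \<bar>f x\<bar> \<partial>lborel) + ennreal (1 powr (1 - p) * B) * Lp_pow p lborel G"
      by (rule nn_integral_mult_test_le[OF G(1) f B(2) _ p]) simp
    also have "\<dots> < \<infinity>"
      using fI G(2) by (simp add: ennreal_mult_less_top)
    finally show "(\<integral>\<^sup>+x. ennreal (norm ((G x \<bullet> i) * f x)) \<partial>lborel) < \<infinity>" .
  qed measurable
  obtain F where F: "(\<integral>\<^sup>+x. ennreal \<bar>f x\<bar> \<partial>lborel) = ennreal F" "F \<ge> 0"
    using fI by (cases "\<integral>\<^sup>+x. ennreal \<bar>f x\<bar> \<partial>lborel") auto
  have l2: "(\<lambda>n. \<integral>x. (g n x \<bullet> i) * f x \<partial>lborel) \<longlonglongrightarrow> (\<integral>x. (G x \<bullet> i) * f x \<partial>lborel)"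
  proof (rule tendsto_L1_int[OF n(2) iG])
    show "((\<lambda>n. \<integral>\<^sup>+x. ennreal (norm ((g n x \<bullet> i) * f x - (G x \<bullet> i) * f x)) \<partial>lborel) \<longlongrightarrow> 0) sequentially"
    proof (rule order_tendstoI)
      fix a :: ennreal assume "0 < a"
      have "\<exists>e>0. ennreal e < a"
      proof (cases a)
        case (real b)
        then show ?thesis using \<open>0 < a\<close> by (intro exI[of _ "b / 2"]) (auto simp: ennreal_less_iff)
      next
        case top
        then show ?thesis by (intro exI[of _ 1]) simp
      qed
      then obtain e where e: "0 < e" "ennreal e < a" by blast
      \<comment> \<open>Makes t F at most e/2; the added 1 keeps the denominator positive when F =
        0.\<close>
      define t where "t = e / (2 * (F + 1))"
      have t: "t > 0" using e F by (simp add: t_def)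
      define A where "A = t powr (1 - p) * B"
      have A: "A > 0" using t B by (simp add: A_def)
      have "eventually (\<lambda>n. Lp_pow p lborel (\<lambda>x. g n x - G x) \<le> ennreal (e / (2 * A))) sequentially"
        using e A by (intro Lp) simp
      then show "eventually (\<lambda>n. (\<integral>\<^sup>+x. ennreal (norm ((g n x \<bullet> i) * f x - (G x \<bullet> i) * f x)) \<partial>lborel) < a) sequentially"
      proof eventually_elim
        case (elim n)
        have "(\<integral>\<^sup>+x. ennreal (norm ((g n x \<bullet> i) * f x - (G x \<bullet> i) * f x)) \<partial>lborel)
            = (\<integral>\<^sup>+x. ennreal (norm (((g n x - G x) \<bullet> i) * f x)) \<partial>lborel)"
          by (simp add: inner_diff_left left_diff_distrib)
        also have "\<dots> \<le> (\<integral>\<^sup>+x. ennreal (norm (g n x - G x) * \<bar>f x\<bar>) \<partial>lborel)"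
          by (intro nn_integral_mono ennreal_leI comp)
        also have "\<dots> \<le> ennreal t * (\<integral>\<^sup>+x. ennreal \<bar>f x\<bar> \<partial>lborel) + ennreal A * Lp_pow p lborel (\<lambda>x. g n x - G x)"
          unfolding A_def by (rule nn_integral_mult_test_le[OF _ f B(2) t p]) measurable
        also have "\<dots> \<le> ennreal t * ennreal F + ennreal A * ennreal (e / (2 * A))"
          unfolding F(1) by (intro add_left_mono mult_left_mono elim) simp
        also have "\<dots> = ennreal (t * F + e / 2)"
          using t F(2) A e by (simp flip: ennreal_mult ennreal_plus)
        also have "\<dots> \<le> ennreal e"
        proof (rule ennreal_leI)
          have "t * F \<le> t * (F + 1)" using t by (intro mult_left_mono) auto
          also have "\<dots> = e / 2" using F(2) by (simp add: t_def field_simps)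
          finally show "t * F + e / 2 \<le> e" by simp
        qed
        also have "\<dots> < a" by (rule e)
        finally show ?case .
      qed
    qed simp
  qed
  have "(\<lambda>n. - (\<integral>x. (g n x \<bullet> i) * f x \<partial>lborel)) \<longlonglongrightarrow> - (\<integral>x. (G x \<bullet> i) * f x \<partial>lborel)"
    by (intro tendsto_minus l2)
  then show "(\<integral>x. \<phi> x * ?D x \<partial>lborel) = - (\<integral>x. (G x \<bullet> i) * f x \<partial>lborel)"
    using l1 unfolding n(3) by (rule LIMSEQ_unique[rotated])
qed

text \<open>Arzela-Ascoli without local uniformity: a diagonal subsequence converges on a countable
  dense set, and equicontinuity carries the Cauchy property to every point.\<close>

lemma holder_pointwise_subsequence:
  fixes \<psi> :: "nat \<Rightarrow> 'a::euclidean_space \<Rightarrow> real"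
  assumes hold: "\<And>n x y. \<bar>\<psi> n x - \<psi> n y\<bar> \<le> norm (x - y) powr \<alpha>" and zero: "\<And>n. \<psi> n 0 = 0" and \<alpha>: "0 < \<alpha>"
  obtains k \<phi> where "strict_mono (k :: nat \<Rightarrow> nat)" "\<And>x. (\<lambda>n. \<psi> (k n) x) \<longlonglongrightarrow> \<phi> x"
proof -
  obtain D :: "'a set" where D: "countable D" "\<And>X. open X \<Longrightarrow> X \<noteq> {} \<Longrightarrow> \<exists>d\<in>D. d \<in> X"
    by (rule countable_dense_setE) blast
  \<comment> \<open>The diagonal argument is applied under one uniform bound, whereas the functions
    may grow like |x|^alpha; hence the normalisation by 1 + |x|^alpha.\<close>
  have b: "norm (\<psi> n x / (1 + norm x powr \<alpha>)) \<le> 1" for n x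
    using hold[of n x 0] zero[of n] by (simp add: divide_le_eq add_pos_nonneg)
  have "\<exists>k. strict_mono (k :: nat \<Rightarrow> nat) \<and> (\<forall>x\<in>D. \<exists>l. (\<lambda>n. \<psi> (k n) x / (1 + norm x powr \<alpha>)) \<longlonglongrightarrow> l)"
    by (rule function_convergent_subsequence[OF D(1), of "\<lambda>n x. \<psi> n x / (1 + norm x powr \<alpha>)" 1]) (use b in auto)
  then obtain k :: "nat \<Rightarrow> nat" where k: "strict_mono k" "\<And>x. x \<in> D \<Longrightarrow> \<exists>l. (\<lambda>n. \<psi> (k n) x / (1 + norm x powr \<alpha>)) \<longlonglongrightarrow> l"
    by blast
  have convD: "Cauchy (\<lambda>n. \<psi> (k n) x)" if x: "x \<in> D" for x
  proof -
    obtain l where "(\<lambda>n. \<psi> (k n) x / (1 + norm x powr \<alpha>)) \<longlonglongrightarrow> l" using k(2)[OF x] by blast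
    then have "(\<lambda>n. (1 + norm x powr \<alpha>) * (\<psi> (k n) x / (1 + norm x powr \<alpha>))) \<longlonglongrightarrow> (1 + norm x powr \<alpha>) * l"
      by (intro tendsto_mult tendsto_const)
    moreover have "1 + norm x powr \<alpha> \<noteq> 0" using powr_ge_zero[of "norm x" \<alpha>] by linarith
    ultimately show ?thesis by (intro LIMSEQ_imp_Cauchy) simp
  qed
  have "Cauchy (\<lambda>n. \<psi> (k n) x)" for x
  proof (rule metric_CauchyI)
    fix e :: real assume e: "e > 0"
    define \<delta> where "\<delta> = (e / 4) powr (1 / \<alpha>)"
    have "\<delta> > 0" using e by (simp add: \<delta>_def)
    then obtain d where d: "d \<in> D" "d \<in> ball x \<delta>" using D(2)[of "ball x \<delta>"] by auto
    have "norm (x - d) powr \<alpha> \<le> \<delta> powr \<alpha>"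
      using d \<alpha> by (intro powr_mono2) (auto simp: dist_norm)
    also have "\<dots> = e / 4" using e \<alpha> by (simp add: \<delta>_def powr_powr)
    finally have xd: "norm (x - d) powr \<alpha> \<le> e / 4" .
    obtain N where N: "\<And>m n. m \<ge> N \<Longrightarrow> n \<ge> N \<Longrightarrow> dist (\<psi> (k m) d) (\<psi> (k n) d) < e / 4"
      using metric_CauchyD[OF convD[OF d(1)], of "e / 4"] e by auto
    have "dist (\<psi> (k m) x) (\<psi> (k n) x) < e" if "m \<ge> N" "n \<ge> N" for m n
      using N[OF that] hold[of "k m" x d] hold[of "k n" x d] xd e unfolding dist_real_def by linarith
    then show "\<exists>N. \<forall>m\<ge>N. \<forall>n\<ge>N. dist (\<psi> (k m) x) (\<psi> (k n) x) < e" by blast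
  qed
  then have "\<exists>l. (\<lambda>n. \<psi> (k n) x) \<longlonglongrightarrow> l" for x
    using real_Cauchy_convergent convergent_def by blast
  then obtain \<phi> where "\<And>x. (\<lambda>n. \<psi> (k n) x) \<longlonglongrightarrow> \<phi> x" by metis
  then show ?thesis using that k(1) by blast
qed

section \<open>Equality of the two infima\<close>

lemma alpha_sp_facts:
  assumes "0 < s" "s \<le> 1" "1 < p" "s * p > real DIM('a::euclidean_space)"
  shows "0 < alpha_sp s p TYPE('a)" "alpha_sp s p TYPE('a) < 1"
    "alpha_sp s p TYPE('a) * p = s * p - real DIM('a)"
proof -
  have "real DIM('a) / p < s" "0 < real DIM('a) / p"
    using assms by (simp_all add: divide_less_eq)
  then show "0 < alpha_sp s p TYPE('a)" "alpha_sp s p TYPE('a) < 1"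
    using assms unfolding alpha_sp_def by linarith+
  show "alpha_sp s p TYPE('a) * p = s * p - real DIM('a)"
    using assms by (simp add: alpha_sp_def left_diff_distrib)
qed

lemma test_fun_density:
  fixes \<phi> :: "'a::euclidean_space \<Rightarrow> real"
  assumes sp: "0 < s" "s \<le> 1" "1 < p" "s * p > real DIM('a)"
    and \<phi>: "\<phi> \<in> W_space s p" "holder_seminorm (alpha_sp s p TYPE('a)) \<phi> = 1" and e: "0 < e"
  obtains u where "test_fun u" "Wsp_seminorm_p s p u \<le> Wsp_seminorm_p s p \<phi> + ennreal e"
    "\<bar>(u x0 - u y0) - (\<phi> x0 - \<phi> y0)\<bar> \<le> e"
proof (cases "s = 1")
  case True
  have c: "continuous_on UNIV \<phi>" and fin: "grad_Lp_p p \<phi> < \<infinity>"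
    using \<phi>(1) True by (auto simp: W_space_def Wsp_seminorm_p_def)
  have hold: "\<bar>\<phi> x - \<phi> y\<bar> \<le> norm (x - y) powr alpha_sp s p TYPE('a)" for x y
    using holder_seminorm_le_iff[of 1 "alpha_sp s p TYPE('a)" \<phi>] \<phi>(2) by simp
  have ap: "alpha_sp s p TYPE('a) * p = p - real DIM('a)"
    using alpha_sp_facts(3)[OF sp] True by simp
  show ?thesis
    by (rule local_density[OF c fin sp(3) alpha_sp_facts(1)[OF sp] ap e hold, of x0 y0])
       (use that True in \<open>simp add: Wsp_seminorm_p_def\<close>)
next
  case False
  have c: "continuous_on UNIV \<phi>" and fin: "gagliardo_p s p \<phi> < \<infinity>"
    using \<phi>(1) False by (auto simp: W_space_def Wsp_seminorm_p_def)
  have s1: "s < 1" and e2: "e / 2 > 0" using sp False e by auto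
  show ?thesis
  proof (rule fractional_density[OF c fin sp(1) s1 sp(3,4) e2, of x0 y0])
    fix u :: "'a \<Rightarrow> real"
    assume u: "test_fun u" "gagliardo_p s p u \<le> gagliardo_p s p \<phi> + ennreal (e / 2)"
      "\<bar>u x0 - \<phi> x0\<bar> \<le> e / 2" "\<bar>u y0 - \<phi> y0\<bar> \<le> e / 2"
    note u(2)
    also have "gagliardo_p s p \<phi> + ennreal (e / 2) \<le> gagliardo_p s p \<phi> + ennreal e"
      using e by (intro add_left_mono ennreal_leI) simp
    finally have "Wsp_seminorm_p s p u \<le> Wsp_seminorm_p s p \<phi> + ennreal e"
      using False by (simp add: Wsp_seminorm_p_def)
    moreover have "\<bar>(u x0 - u y0) - (\<phi> x0 - \<phi> y0)\<bar> \<le> e"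
      using u(3,4) by linarith
    ultimately show ?thesis by (rule that[OF u(1)])
  qed
qed

lemma m_sp_scaled_le:
  fixes u :: "'a::euclidean_space \<Rightarrow> real"
  assumes sp: "0 < s" "s \<le> 1" "1 < p" "s * p > real DIM('a)"
    and u: "test_fun u" "0 < a" "ennreal a \<le> holder_seminorm (alpha_sp s p TYPE('a)) u"
  shows "m_sp s p TYPE('a) * ennreal (a powr p) \<le> Wsp_seminorm_p s p u"
proof (rule scaled_lower_bound[where \<alpha>="alpha_sp s p TYPE('a)"])
  show "holder_seminorm (alpha_sp s p TYPE('a)) u < \<infinity>"
    using alpha_sp_facts[OF sp] by (intro test_fun_holder_finite u) auto
  show "m_sp s p TYPE('a) \<le> Wsp_seminorm_p s p (\<lambda>x. c * u x)"
    if "holder_seminorm (alpha_sp s p TYPE('a)) (\<lambda>x. c * u x) = 1" for c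
    unfolding m_sp_def using that test_fun_cmult[OF u(1)] by (intro INF_lower) auto
qed (use u sp in \<open>auto intro: test_fun_continuous\<close>)

text \<open>For each a < 1 a pair of points has Hoelder quotient above a, and a test function close
  to phi at just these two points inherits it. This gives a^p m <= energy, and a tends to 1.\<close>

lemma m_sp_le_Wsp:
  fixes \<phi> :: "'a::euclidean_space \<Rightarrow> real"
  assumes sp: "0 < s" "s \<le> 1" "1 < p" "s * p > real DIM('a)"
    and \<phi>: "\<phi> \<in> W_space s p" "holder_seminorm (alpha_sp s p TYPE('a)) \<phi> = 1"
  shows "m_sp s p TYPE('a) \<le> Wsp_seminorm_p s p \<phi>"
proof -
  let ?\<alpha> = "alpha_sp s p TYPE('a)"
  let ?m = "m_sp s p TYPE('a)"
  obtain w where w: "Wsp_seminorm_p s p \<phi> = ennreal w" "w \<ge> 0"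
    using \<phi>(1) by (cases "Wsp_seminorm_p s p \<phi>") (auto simp: W_space_def)
  have key: "?m * ennreal z \<le> ennreal w" if z: "0 < z" "z < 1" for z
  proof -
    define a where "a = z powr (1 / p)"
    have az: "a powr p = z" using z sp by (simp add: a_def powr_powr)
    have a: "0 < a" "a < 1"
      using z sp powr_less_mono2[of "1 / p" z 1] by (auto simp: a_def)
    have "ennreal a < holder_seminorm ?\<alpha> \<phi>"
      using a by (simp add: \<phi>(2) ennreal_less_one_iff)
    then obtain x y where xy: "x \<noteq> y" "ennreal a < ennreal (\<bar>\<phi> x - \<phi> y\<bar> / norm (x - y) powr ?\<alpha>)"
      unfolding holder_seminorm_def less_SUP_iff by (auto simp: dist_norm)
    define d where "d = norm (x - y) powr ?\<alpha>"
    have d: "d > 0" using xy by (simp add: d_def)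
    have ad: "a < \<bar>\<phi> x - \<phi> y\<bar> / d"
      using xy a by (simp add: ennreal_less_iff d_def)
    then have gap: "\<bar>\<phi> x - \<phi> y\<bar> - a * d > 0" using d by (simp add: field_simps)
    show ?thesis
    proof (rule ennreal_le_epsilon)
      fix e :: real assume e: "0 < e"
      \<comment> \<open>The gap is what the increment may lose while its quotient stays at least
        a.\<close>
      define e' where "e' = min e (\<bar>\<phi> x - \<phi> y\<bar> - a * d)"
      have e': "e' > 0" using e gap by (simp add: e'_def)
      obtain u where u: "test_fun u" "Wsp_seminorm_p s p u \<le> Wsp_seminorm_p s p \<phi> + ennreal e'"
        "\<bar>(u x - u y) - (\<phi> x - \<phi> y)\<bar> \<le> e'"
        using test_fun_density[OF sp \<phi> e'] by blast
      have "a * d \<le> \<bar>u x - u y\<bar>"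
        using u(3) unfolding e'_def by linarith
      then have "ennreal a \<le> ennreal (\<bar>u x - u y\<bar> / d)"
        using d by (intro ennreal_leI) (simp add: pos_le_divide_eq)
      also have "\<dots> \<le> holder_seminorm ?\<alpha> u"
        unfolding d_def by (rule holder_seminorm_ge[OF xy(1)])
      finally have "?m * ennreal (a powr p) \<le> Wsp_seminorm_p s p u"
        using a by (intro m_sp_scaled_le[OF sp u(1)])
      also have "\<dots> \<le> ennreal w + ennreal e'" using u(2) w by simp
      also have "\<dots> \<le> ennreal w + ennreal e"
        by (intro add_left_mono ennreal_leI) (simp add: e'_def)
      finally show "?m * ennreal z \<le> ennreal w + ennreal e" by (simp add: az)
    qed
  qed
  \<comment> \<open>An infinite m would survive every factor z, so finiteness comes first; letting z
    tend to 1 then takes place in the reals.\<close>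
  have "?m \<noteq> top"
    using key[of "1/2"] by (auto simp: ennreal_top_mult top_unique)
  then obtain m where m: "?m = ennreal m" "m \<ge> 0" by (cases ?m) auto
  have "m \<le> w"
  proof (rule field_le_mult_one_interval)
    fix z :: real assume z: "0 < z" "z < 1"
    then have "ennreal (m * z) \<le> ennreal w" using key[of z] m by (simp add: ennreal_mult)
    then show "z * m \<le> w" using w(2) by (simp add: ennreal_le_iff mult.commute)
  qed
  then show ?thesis using m w by (simp add: ennreal_leI)
qed

lemma m_sp_eq_INF_W_space:
  assumes sp: "0 < s" "s \<le> 1" "1 < p" "s * p > real DIM('a::euclidean_space)"
  shows "m_sp s p TYPE('a) =
    (INF \<phi> \<in> {\<phi> :: 'a \<Rightarrow> real. \<phi> \<in> W_space s p \<and> holder_seminorm (alpha_sp s p TYPE('a)) \<phi> = 1}. Wsp_seminorm_p s p \<phi>)"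
    (is "_ = ?I")
proof (rule antisym)
  show "m_sp s p TYPE('a) \<le> ?I"
    by (intro INF_greatest m_sp_le_Wsp[OF sp]) auto
  show "?I \<le> m_sp s p TYPE('a)"
    unfolding m_sp_def
  proof (rule INF_greatest)
    fix u :: "'a \<Rightarrow> real" assume "u \<in> {\<phi>. test_fun \<phi> \<and> holder_seminorm (alpha_sp s p TYPE('a)) \<phi> = 1}"
    then have u: "test_fun u" "holder_seminorm (alpha_sp s p TYPE('a)) u = 1" by auto
    show "?I \<le> Wsp_seminorm_p s p u"
    \<comment> \<open>Membership in \<open>W_space\<close> requires finite energy; a competitor of
      infinite energy satisfies the bound trivially.\<close>
    proof (cases "Wsp_seminorm_p s p u < \<infinity>")
      case True
      then have "u \<in> W_space s p"
        using u by (simp add: W_space_def test_fun_continuous)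
      then show ?thesis using u by (intro INF_lower) auto
    next
      case False
      then show ?thesis by (simp add: not_less top_unique)
    qed
  qed
qed

text \<open>A bump has finite energy, and its positive increment between 0 and a unit vector bounds
  its Hoelder seminorm from below. Finiteness is what makes m + e exceed m, so that nearly minimal
  competitors exist.\<close>

lemma m_sp_finite:
  assumes sp: "0 < s" "s \<le> 1" "1 < p" "s * p > real DIM('a::euclidean_space)"
  shows "m_sp s p TYPE('a) < \<infinity>"
proof -
  let ?b = "bump 1 :: 'a \<Rightarrow> real"
  have b: "test_fun ?b" by (rule test_fun_bump) simp
  have b0: "?b 0 > 0" using bump_pos_iff[of 1 "0::'a"] by simp
  obtain i :: 'a where i: "i \<in> Basis" using nonempty_Basis by blast
  have bi: "?b i = 0" using bump_support[of 1 i] i by auto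
  have "ennreal (?b 0) \<le> holder_seminorm (alpha_sp s p TYPE('a)) ?b"
    using holder_seminorm_ge[of 0 i ?b "alpha_sp s p TYPE('a)"] i bi b0 nonzero_Basis[OF i] by auto
  from m_sp_scaled_le[OF sp b b0 this]
  have le: "m_sp s p TYPE('a) * ennreal (?b 0 powr p) \<le> Wsp_seminorm_p s p ?b" .
  have "Wsp_seminorm_p s p ?b < \<infinity>"
  proof (cases "s = 1")
    case True
    obtain B where B: "B > 0" "\<And>x. norm (gradient ?b x) \<le> B"
      using test_fun_gradient_bounded[OF b] by blast
    have "grad_Lp_p p ?b \<le> Lp_pow p lborel (\<lambda>x. gradient ?b x)"
      unfolding grad_Lp_p_def using weak_gradient_test_fun[OF b] by (intro INF_lower) auto
    also have "\<dots> \<le> (\<integral>\<^sup>+x. ennreal (B powr p) * indicator (cball 0 1) (x::'a) \<partial>lborel)"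
    proof (rule nn_integral_mono)
      fix x :: 'a
      show "ennreal (norm (gradient ?b x) powr p) \<le> ennreal (B powr p) * indicator (cball 0 1) x"
      proof (cases "norm x \<le> 1")
        case True
        then show ?thesis using B sp by (simp add: ennreal_leI powr_mono2)
      next
        case False
        have "frechet_derivative ?b (at x) v = 0" for v
          by (rule frechet_derivative_eq_0_outside[where R=1]) (use False bump_support[of 1] in auto)
        then show ?thesis by (simp add: gradient_def)
      qed
    qed
    also have "\<dots> < \<infinity>"
      by (simp add: nn_integral_cmult_indicator ennreal_mult_less_top emeasure_cball)
    finally show ?thesis using True by (simp add: Wsp_seminorm_p_def)
  next
    case False
    then show ?thesis
      using gagliardo_test_fun_finite[OF b sp(1) _ sp(3)] sp by (simp add: Wsp_seminorm_p_def)
  qed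
  with le have "m_sp s p TYPE('a) * ennreal (?b 0 powr p) < \<infinity>"
    by (rule le_less_trans)
  then show ?thesis
    using b0 by (auto simp: ennreal_mult_less_top less_top)
qed

section \<open>Normalised minimising sequences\<close>

text \<open>Removes the noncompact symmetries of the problem: the pair (x, y) is moved to (0, z)
  with |z| = 1, where z ranges over a compact sphere.\<close>

lemma normalise:
  fixes \<phi> :: "'a::euclidean_space \<Rightarrow> real"
  assumes sp: "0 < s" "s \<le> 1" "1 < p" "s * p > real DIM('a)"
    and \<phi>: "\<phi> \<in> W_space s p" "holder_seminorm (alpha_sp s p TYPE('a)) \<phi> = 1" and xy: "x \<noteq> y"
  obtains \<psi> :: "'a \<Rightarrow> real" and z :: 'a where "continuous_on UNIV \<psi>" "\<And>v w. \<bar>\<psi> v - \<psi> w\<bar> \<le> norm (v - w) powr alpha_sp s p TYPE('a)"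
    "\<psi> 0 = 0" "Wsp_seminorm_p s p \<psi> \<le> Wsp_seminorm_p s p \<phi>" "norm z = 1"
    "\<psi> z = \<bar>\<phi> x - \<phi> y\<bar> / norm (x - y) powr alpha_sp s p TYPE('a)"
proof -
  define \<alpha> where "\<alpha> = alpha_sp s p TYPE('a)"
  have \<alpha>p: "\<alpha> * p = s * p - real DIM('a)" using alpha_sp_facts(3)[OF sp] by (simp add: \<alpha>_def)
  have c: "continuous_on UNIV \<phi>" using \<phi>(1) by (simp add: W_space_def)
  have hold: "\<bar>\<phi> v - \<phi> w\<bar> \<le> norm (v - w) powr \<alpha>" for v w
    using holder_seminorm_le_iff[of 1 \<alpha> \<phi>] \<phi>(2) by (simp add: \<alpha>_def)
  define r where "r = norm (x - y)"
  have r: "r > 0" using xy by (simp add: r_def)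
  \<comment> \<open>The sign makes the value at z nonnegative for every member, so that midpoints of
    two members do not cancel.\<close>
  define \<sigma> :: real where "\<sigma> = (if \<phi> y \<ge> \<phi> x then 1 else - 1)"
  define a where "a = \<sigma> * r powr (- \<alpha>)"
  have a: "a \<noteq> 0" "\<bar>a\<bar> = r powr (- \<alpha>)" using r by (auto simp: a_def \<sigma>_def abs_mult)
  define \<psi> where "\<psi> v = a * (\<phi> (x + r *\<^sub>R v) - \<phi> x)" for v
  define z where "z = (1 / r) *\<^sub>R (y - x)"
  show ?thesis
  proof (rule that[of \<psi> z])
    show "continuous_on UNIV \<psi>"
      unfolding \<psi>_def by (intro continuous_intros continuous_on_compose2[OF c]) auto
    show "\<bar>\<psi> v - \<psi> w\<bar> \<le> norm (v - w) powr alpha_sp s p TYPE('a)" for v w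
    proof -
      have "\<psi> v - \<psi> w = a * (\<phi> (x + r *\<^sub>R v) - \<phi> (x + r *\<^sub>R w))"
        by (simp add: \<psi>_def algebra_simps)
      then have "\<bar>\<psi> v - \<psi> w\<bar> = r powr (- \<alpha>) * \<bar>\<phi> (x + r *\<^sub>R v) - \<phi> (x + r *\<^sub>R w)\<bar>"
        by (simp add: abs_mult a(2))
      also have "\<dots> \<le> r powr (- \<alpha>) * norm ((x + r *\<^sub>R v) - (x + r *\<^sub>R w)) powr \<alpha>"
        by (intro mult_left_mono hold) simp
      also have "norm ((x + r *\<^sub>R v) - (x + r *\<^sub>R w)) = r * norm (v - w)"
        using r by (simp flip: scaleR_diff_right)
      also have "r powr (- \<alpha>) * (r * norm (v - w)) powr \<alpha> = norm (v - w) powr \<alpha>"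
        using r by (simp add: powr_mult powr_minus_divide)
      finally show ?thesis by (simp add: \<alpha>_def)
    qed
    show "\<psi> 0 = 0" by (simp add: \<psi>_def)
    \<comment> \<open>The amplitude r^(-alpha), chosen to preserve the Hoelder quotient, also
      cancels the scaling factor of the energy, since alpha p = s p - N.\<close>
    have "\<bar>a\<bar> powr p * r powr (s * p - real DIM('a)) = 1"
      using r by (simp add: a(2) powr_powr \<alpha>p[symmetric] flip: powr_add)
    then show "Wsp_seminorm_p s p \<psi> \<le> Wsp_seminorm_p s p \<phi>"
      using Wsp_affine_le[OF c r a(1), of s p x "\<phi> x"] by (simp add: \<psi>_def[abs_def])
    show "norm z = 1" using r by (simp add: z_def r_def norm_minus_commute)
    have "x + r *\<^sub>R z = y" using r by (simp add: z_def)
    then have "\<psi> z = r powr (- \<alpha>) * (\<sigma> * (\<phi> y - \<phi> x))" by (simp add: \<psi>_def a_def)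
    also have "\<sigma> * (\<phi> y - \<phi> x) = \<bar>\<phi> x - \<phi> y\<bar>" by (simp add: \<sigma>_def)
    finally show "\<psi> z = \<bar>\<phi> x - \<phi> y\<bar> / norm (x - y) powr alpha_sp s p TYPE('a)"
      using r by (simp add: \<alpha>_def r_def powr_minus_divide)
  qed
qed

lemma minimising_sequence_member:
  assumes sp: "0 < s" "s \<le> 1" "1 < p" "s * p > real DIM('a::euclidean_space)" and e: "0 < e" "e < 1"
  obtains \<psi> :: "'a::euclidean_space \<Rightarrow> real" and z where "continuous_on UNIV \<psi>"
    "\<And>v w. \<bar>\<psi> v - \<psi> w\<bar> \<le> norm (v - w) powr alpha_sp s p TYPE('a)" "\<psi> 0 = 0"
    "Wsp_seminorm_p s p \<psi> \<le> m_sp s p TYPE('a) + ennreal e" "norm z = 1" "1 - e \<le> \<psi> z"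
proof -
  let ?\<alpha> = "alpha_sp s p TYPE('a)"
  have "m_sp s p TYPE('a) < m_sp s p TYPE('a) + ennreal e"
    using m_sp_finite[OF sp] e by (cases "m_sp s p TYPE('a)") (auto simp: ennreal_less_iff simp flip: ennreal_plus)
  then have "\<exists>\<phi> :: 'a \<Rightarrow> real. \<phi> \<in> W_space s p \<and> holder_seminorm ?\<alpha> \<phi> = 1 \<and> Wsp_seminorm_p s p \<phi> < m_sp s p TYPE('a) + ennreal e"
    using m_sp_eq_INF_W_space[OF sp] by (simp add: INF_less_iff)
  then obtain \<phi> :: "'a \<Rightarrow> real" where \<phi>: "\<phi> \<in> W_space s p" "holder_seminorm ?\<alpha> \<phi> = 1"
    "Wsp_seminorm_p s p \<phi> < m_sp s p TYPE('a) + ennreal e" by blast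
  have "ennreal (1 - e) < holder_seminorm ?\<alpha> \<phi>"
    using e by (simp add: \<phi>(2) ennreal_less_one_iff)
  then obtain x y where xy: "x \<noteq> y" "ennreal (1 - e) < ennreal (\<bar>\<phi> x - \<phi> y\<bar> / norm (x - y) powr ?\<alpha>)"
    unfolding holder_seminorm_def less_SUP_iff by (auto simp: dist_norm)
  then have le: "1 - e \<le> \<bar>\<phi> x - \<phi> y\<bar> / norm (x - y) powr ?\<alpha>"
    using e by (simp add: ennreal_less_iff)
  show ?thesis
  proof (rule normalise[OF sp \<phi>(1,2) xy(1)])
    fix \<psi> :: "'a \<Rightarrow> real" and z
    assume *: "continuous_on UNIV \<psi>" "\<And>v w. \<bar>\<psi> v - \<psi> w\<bar> \<le> norm (v - w) powr ?\<alpha>"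
      "\<psi> 0 = 0" "Wsp_seminorm_p s p \<psi> \<le> Wsp_seminorm_p s p \<phi>" "norm z = 1"
      "\<psi> z = \<bar>\<phi> x - \<phi> y\<bar> / norm (x - y) powr ?\<alpha>"
    show ?thesis
      by (rule that[of \<psi> z]) (use * le \<phi>(3) in \<open>auto intro: order_trans[OF _ less_imp_le]\<close>)
  qed
qed

section \<open>Existence of a minimiser\<close>

text \<open>The unit vectors at which the members nearly attain the quotient vary; compactness of
  the sphere lets a subsequence use their limit instead.\<close>

lemma minimising_sequence:
  assumes sp: "0 < s" "s \<le> 1" "1 < p" "s * p > real DIM('a::euclidean_space)"
  obtains \<psi> :: "nat \<Rightarrow> 'a::euclidean_space \<Rightarrow> real" and \<phi> :: "'a \<Rightarrow> real" and \<omega> :: 'a and b :: "nat \<Rightarrow> real"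
  where "\<And>n. continuous_on UNIV (\<psi> n)" "\<And>n v w. \<bar>\<psi> n v - \<psi> n w\<bar> \<le> norm (v - w) powr alpha_sp s p TYPE('a)"
    "\<And>n. \<psi> n 0 = 0" "\<And>n. Wsp_seminorm_p s p (\<psi> n) \<le> m_sp s p TYPE('a) + ennreal (b n)" "\<And>n. b n > 0" "b \<longlonglongrightarrow> 0"
    "norm \<omega> = 1" "\<And>n. 1 - b n \<le> \<psi> n \<omega>" "\<And>x. (\<lambda>n. \<psi> n x) \<longlonglongrightarrow> \<phi> x"
proof -
  let ?\<alpha> = "alpha_sp s p TYPE('a)"
  note \<alpha> = alpha_sp_facts[OF sp]
  \<comment> \<open>Starts at 1/2, because \<open>minimising_sequence_member\<close> needs a
    tolerance below 1.\<close>
  define e where "e n = 1 / real (Suc (Suc n))" for n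
  have e: "0 < e n" "e n < 1" for n by (auto simp: e_def)
  have elim: "e \<longlonglongrightarrow> 0"
    unfolding e_def using LIMSEQ_Suc[OF LIMSEQ_inverse_real_of_nat] by (simp add: inverse_eq_divide)
  let ?P = "\<lambda>n \<psi> z. continuous_on UNIV \<psi> \<and> (\<forall>v w. \<bar>\<psi> v - \<psi> w\<bar> \<le> norm (v - w) powr ?\<alpha>) \<and> \<psi> 0 = 0 \<and>
     Wsp_seminorm_p s p \<psi> \<le> m_sp s p TYPE('a) + ennreal (e n) \<and> norm z = 1 \<and> 1 - e n \<le> \<psi> z"
  have "\<exists>f :: ('a \<Rightarrow> real) \<times> 'a. ?P n (fst f) (snd f)" for n
  proof (rule minimising_sequence_member[OF sp e[of n]])
    fix \<psi> :: "'a \<Rightarrow> real" and z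
    assume "continuous_on UNIV \<psi>" "\<And>v w. \<bar>\<psi> v - \<psi> w\<bar> \<le> norm (v - w) powr ?\<alpha>" "\<psi> 0 = 0"
      "Wsp_seminorm_p s p \<psi> \<le> m_sp s p TYPE('a) + ennreal (e n)" "norm z = 1" "1 - e n \<le> \<psi> z"
    then show ?thesis by (intro exI[of _ "(\<psi>, z)"]) simp
  qed
  then obtain f :: "nat \<Rightarrow> ('a \<Rightarrow> real) \<times> 'a" where f: "\<And>n. ?P n (fst (f n)) (snd (f n))"
    by metis
  define \<psi> where "\<psi> n = fst (f n)" for n
  define z where "z n = snd (f n)" for n
  have F: "?P n (\<psi> n) (z n)" for n unfolding \<psi>_def z_def by (rule f)
  have "\<And>n. z n \<in> sphere 0 1" using F by simp
  then obtain \<omega> r where \<omega>: "\<omega> \<in> sphere 0 1" and r: "strict_mono r" "(z \<circ> r) \<longlonglongrightarrow> \<omega>"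
    using compact_sphere[of "0::'a" 1] unfolding compact_def by metis
  have h: "\<bar>\<psi> (r n) x - \<psi> (r n) y\<bar> \<le> norm (x - y) powr ?\<alpha>" "\<psi> (r n) 0 = 0" for n x y using F by auto
  obtain k \<phi> where k: "strict_mono k" "\<And>x. (\<lambda>n. \<psi> (r (k n)) x) \<longlonglongrightarrow> \<phi> x"
    using holder_pointwise_subsequence[of "\<lambda>n. \<psi> (r n)" ?\<alpha>, OF h \<alpha>(1)] by metis
  define q where "q n = r (k n)" for n
  have q: "strict_mono q"
    using strict_mono_o[OF r(1) k(1)] by (simp add: q_def[abs_def] comp_def)
  \<comment> \<open>The second term is the Hoelder cost of replacing the vector of the n-th member
    by the common \<open>\<omega>\<close>.\<close>
  define b where "b n = e (q n) + norm (z (q n) - \<omega>) powr ?\<alpha>" for n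
  have "(\<lambda>n. z (q n)) \<longlonglongrightarrow> \<omega>"
    using LIMSEQ_subseq_LIMSEQ[OF r(2) k(1)] by (simp add: comp_def q_def)
  then have "(\<lambda>n. norm (z (q n) - \<omega>)) \<longlonglongrightarrow> 0"
    by (simp add: LIM_zero tendsto_norm_zero)
  then have "(\<lambda>n. norm (z (q n) - \<omega>) powr ?\<alpha>) \<longlonglongrightarrow> 0 powr ?\<alpha>"
    using \<alpha>(1) by (intro tendsto_powr' tendsto_const) auto
  moreover have "(\<lambda>n. e (q n)) \<longlonglongrightarrow> 0"
    using LIMSEQ_subseq_LIMSEQ[OF elim q] by (simp add: comp_def)
  ultimately have blim: "b \<longlonglongrightarrow> 0"
    unfolding b_def using tendsto_add by fastforce
  have b0: "b n > 0" for n
    unfolding b_def by (intro add_pos_nonneg e) simp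
  have eb: "e (q n) \<le> b n" for n unfolding b_def by simp
  show ?thesis
  proof (rule that[of "\<lambda>n. \<psi> (q n)" b \<omega> \<phi>])
    fix n v w
    show "continuous_on UNIV (\<psi> (q n))" "\<bar>\<psi> (q n) v - \<psi> (q n) w\<bar> \<le> norm (v - w) powr ?\<alpha>" "\<psi> (q n) 0 = 0"
      using F by auto
    have "Wsp_seminorm_p s p (\<psi> (q n)) \<le> m_sp s p TYPE('a) + ennreal (e (q n))" using F by auto
    also have "\<dots> \<le> m_sp s p TYPE('a) + ennreal (b n)" by (intro add_left_mono ennreal_leI eb)
    finally show "Wsp_seminorm_p s p (\<psi> (q n)) \<le> m_sp s p TYPE('a) + ennreal (b n)" .
    show "b n > 0" by (rule b0)
    have "1 - e (q n) \<le> \<psi> (q n) (z (q n))" "\<bar>\<psi> (q n) (z (q n)) - \<psi> (q n) \<omega>\<bar> \<le> norm (z (q n) - \<omega>) powr ?\<alpha>"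
      using F by auto
    then show "1 - b n \<le> \<psi> (q n) \<omega>" unfolding b_def by linarith
  qed (use \<omega> k(2) blim in \<open>auto simp: q_def\<close>)
qed

text \<open>Both functions vanish at 0 and are at least a at the same \<open>\<omega>\<close>, so
  their midpoint has Hoelder quotient at least a there; the lower bound over \<open>W_space\<close>
  then applies after rescaling.\<close>

lemma midpoint_energy_bound:
  fixes \<psi> \<psi>' :: "'a::euclidean_space \<Rightarrow> real"
  assumes sp: "0 < s" "s \<le> 1" "1 < p" "s * p > real DIM('a)"
    and c: "continuous_on UNIV \<psi>" "continuous_on UNIV \<psi>'"
    and hold: "\<And>v w. \<bar>\<psi> v - \<psi> w\<bar> \<le> norm (v - w) powr alpha_sp s p TYPE('a)"
      "\<And>v w. \<bar>\<psi>' v - \<psi>' w\<bar> \<le> norm (v - w) powr alpha_sp s p TYPE('a)"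
    and zero: "\<psi> 0 = 0" "\<psi>' 0 = 0" and \<omega>: "norm \<omega> = 1" "a \<le> \<psi> \<omega>" "a \<le> \<psi>' \<omega>" and a: "0 < a"
  shows "m_sp s p TYPE('a) * ennreal (a powr p) \<le> Wsp_seminorm_p s p (\<lambda>x. (1/2) * (\<psi> x + \<psi>' x))"
proof (rule scaled_lower_bound[where \<alpha>="alpha_sp s p TYPE('a)"])
  let ?\<alpha> = "alpha_sp s p TYPE('a)"
  let ?v = "\<lambda>x. (1/2) * (\<psi> x + \<psi>' x)"
  show cv: "continuous_on UNIV ?v" by (intro continuous_intros c)
  have "\<bar>?v x - ?v y\<bar> \<le> 1 * norm (x - y) powr ?\<alpha>" for x y
  proof -
    have eq: "?v x - ?v y = ((\<psi> x - \<psi> y) + (\<psi>' x - \<psi>' y)) / 2" by (simp add: field_simps)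
    have "\<bar>(\<psi> x - \<psi> y) + (\<psi>' x - \<psi>' y)\<bar> \<le> 2 * norm (x - y) powr ?\<alpha>"
      using abs_triangle_ineq[of "\<psi> x - \<psi> y" "\<psi>' x - \<psi>' y"] hold(1)[of x y] hold(2)[of x y] by linarith
    then show ?thesis unfolding eq by simp
  qed
  then have "holder_seminorm ?\<alpha> ?v \<le> ennreal 1"
    by (subst holder_seminorm_le_iff) auto
  then show "holder_seminorm ?\<alpha> ?v < \<infinity>" by (rule le_less_trans) simp
  have "a \<le> \<bar>?v \<omega> - ?v 0\<bar> / norm (\<omega> - 0) powr ?\<alpha>"
    using \<omega> zero by simp
  then have "ennreal a \<le> ennreal (\<bar>?v \<omega> - ?v 0\<bar> / norm (\<omega> - 0) powr ?\<alpha>)"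
    by (rule ennreal_leI)
  also have "\<dots> \<le> holder_seminorm ?\<alpha> ?v"
    by (rule holder_seminorm_ge) (use \<omega> in auto)
  finally show "ennreal a \<le> holder_seminorm ?\<alpha> ?v" .
  show "m_sp s p TYPE('a) \<le> Wsp_seminorm_p s p (\<lambda>x. c * ?v x)"
    if "holder_seminorm ?\<alpha> (\<lambda>x. c * ?v x) = 1" for c
  proof (cases "Wsp_seminorm_p s p (\<lambda>x. c * ?v x) < \<infinity>")
    case True
    have "continuous_on UNIV (\<lambda>x. c * ?v x)" by (intro continuous_on_mult_left cv)
    with True that have "(\<lambda>x. c * ?v x) \<in> W_space s p" by (simp add: W_space_def)
    then show ?thesis using that by (rule m_sp_le_Wsp[OF sp])
  next
    case False
    then show ?thesis by (simp add: not_less top_unique)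
  qed
qed (use a sp in auto)

text \<open>The convexity defect has integral at most B - A: half the sum of the energies is at most
  B and the midpoint has at least A. The argument adds the defect to the midpoint energy instead of
  subtracting in \<open>ennreal\<close>.\<close>

lemma almost_minimal_midpoint_close:
  fixes g h :: "'b \<Rightarrow> 'e::euclidean_space"
  assumes [measurable]: "g \<in> borel_measurable M" "h \<in> borel_measurable M"
    and g: "Lp_pow p M g \<le> ennreal B" and h: "Lp_pow p M h \<le> ennreal B"
    and mid: "ennreal A \<le> Lp_pow p M (\<lambda>x. (1/2) *\<^sub>R (g x + h x))"
    and AB: "0 \<le> A" "0 \<le> B" "0 \<le> e" "0 \<le> C" and p: "1 < p"
    and uc: "\<And>a b :: 'e. norm (a - b) powr p \<le> e * (norm a powr p + norm b powr p)
      + C * ((norm a powr p + norm b powr p) / 2 - norm ((1/2) *\<^sub>R (a + b)) powr p)"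
  shows "A \<le> B" "Lp_pow p M (\<lambda>x. g x - h x) \<le> ennreal (e * (2 * B) + C * (B - A))"
proof -
  define Q where "Q x = norm (g x) powr p + norm (h x) powr p" for x
  define N where "N x = norm ((1/2) *\<^sub>R (g x + h x)) powr p" for x
  define \<Phi> where "\<Phi> x = Q x / 2 - N x" for x
  have [measurable]: "Q \<in> borel_measurable M" "N \<in> borel_measurable M" "\<Phi> \<in> borel_measurable M"
    unfolding \<Phi>_def Q_def N_def by measurable
  have Q0: "Q x \<ge> 0" and N0: "N x \<ge> 0" and \<Phi>0: "\<Phi> x \<ge> 0" for x
    using powr_midpoint[OF p, of "g x" "h x"] by (auto simp: Q_def N_def \<Phi>_def)
  have Qle: "(\<integral>\<^sup>+x. ennreal (Q x) \<partial>M) \<le> ennreal (2 * B)"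
  proof -
    have "(\<integral>\<^sup>+x. ennreal (Q x) \<partial>M) = Lp_pow p M g + Lp_pow p M h"
      unfolding Q_def by (simp add: nn_integral_add)
    also have "\<dots> \<le> ennreal B + ennreal B" by (intro add_mono g h)
    finally show ?thesis using AB by (simp flip: ennreal_plus)
  qed
  have sum: "(\<integral>\<^sup>+x. ennreal (\<Phi> x) \<partial>M) + (\<integral>\<^sup>+x. ennreal (N x) \<partial>M) \<le> ennreal B"
  proof -
    have "(\<integral>\<^sup>+x. ennreal (\<Phi> x) \<partial>M) + (\<integral>\<^sup>+x. ennreal (N x) \<partial>M) = (\<integral>\<^sup>+x. ennreal (\<Phi> x) + ennreal (N x) \<partial>M)"
      by (rule nn_integral_add[symmetric]) measurable
    also have "\<dots> = (\<integral>\<^sup>+x. ennreal (1/2) * ennreal (Q x) \<partial>M)"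
    proof (rule nn_integral_cong)
      fix x
      have "ennreal (\<Phi> x) + ennreal (N x) = ennreal (\<Phi> x + N x)" using \<Phi>0 N0 by simp
      also have "\<Phi> x + N x = (1/2) * Q x" by (simp add: \<Phi>_def)
      also have "ennreal \<dots> = ennreal (1/2) * ennreal (Q x)" using Q0 by (intro ennreal_mult) auto
      finally show "ennreal (\<Phi> x) + ennreal (N x) = ennreal (1/2) * ennreal (Q x)" .
    qed
    also have "\<dots> = ennreal (1/2) * (\<integral>\<^sup>+x. ennreal (Q x) \<partial>M)"
      by (rule nn_integral_cmult) measurable
    also have "\<dots> \<le> ennreal (1/2) * ennreal (2 * B)" by (intro mult_left_mono Qle) auto
    also have "\<dots> = ennreal B" using AB by (subst ennreal_mult[symmetric]) simp_all
    finally show ?thesis .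
  qed
  then obtain X where X: "(\<integral>\<^sup>+x. ennreal (\<Phi> x) \<partial>M) = ennreal X" "X \<ge> 0"
    by (cases "\<integral>\<^sup>+x. ennreal (\<Phi> x) \<partial>M") (auto simp: top_unique)
  have "ennreal X + ennreal A \<le> ennreal B"
    using order_trans[OF add_left_mono[OF mid] sum[unfolded N_def]] X by simp
  then have XA: "X + A \<le> B" using X AB by (simp add: ennreal_le_iff flip: ennreal_plus)
  then show "A \<le> B" using X by simp
  have "Lp_pow p M (\<lambda>x. g x - h x) \<le> (\<integral>\<^sup>+x. ennreal e * ennreal (Q x) + ennreal C * ennreal (\<Phi> x) \<partial>M)"
  proof (rule nn_integral_mono)
    fix x
    have "norm (g x - h x) powr p \<le> e * Q x + C * \<Phi> x"
      using uc[of "g x" "h x"] by (simp add: Q_def \<Phi>_def N_def)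
    then have "ennreal (norm (g x - h x) powr p) \<le> ennreal (e * Q x + C * \<Phi> x)" by (rule ennreal_leI)
    also have "\<dots> = ennreal e * ennreal (Q x) + ennreal C * ennreal (\<Phi> x)"
      using AB Q0[of x] \<Phi>0[of x] by (simp add: ennreal_mult)
    finally show "ennreal (norm (g x - h x) powr p) \<le> ennreal e * ennreal (Q x) + ennreal C * ennreal (\<Phi> x)" .
  qed
  also have "\<dots> = ennreal e * (\<integral>\<^sup>+x. ennreal (Q x) \<partial>M) + ennreal C * ennreal X"
    by (simp add: nn_integral_add nn_integral_cmult X(1)[symmetric])
  also have "\<dots> \<le> ennreal e * ennreal (2 * B) + ennreal C * ennreal (B - A)"
    using XA by (intro add_mono mult_left_mono Qle ennreal_leI) auto
  also have "\<dots> = ennreal (e * (2 * B) + C * (B - A))"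
    using AB X XA by (simp flip: ennreal_mult ennreal_plus)
  finally show "Lp_pow p M (\<lambda>x. g x - h x) \<le> ennreal (e * (2 * B) + C * (B - A))" .
qed

text \<open>The bracket is the gap B - A for almost minimal members with Hoelder quotient at least 1
  - \<open>\<theta>\<close>; it vanishes continuously at \<open>\<theta>\<close> = 0.\<close>

lemma small_defect:
  fixes m C p e :: real
  assumes "0 < e"
  obtains \<theta> where "0 < \<theta>" "\<theta> < 1" "C * ((m + 2 * \<theta>) - m * (1 - \<theta>) powr p) \<le> e"
proof -
  have "((\<lambda>\<theta>. C * ((m + 2 * \<theta>) - m * (1 - \<theta>) powr p)) \<longlongrightarrow> C * ((m + 2 * 0) - m * (1 - 0) powr p)) (at_right (0::real))"
    by (intro tendsto_intros) auto
  then have "eventually (\<lambda>\<theta>. C * ((m + 2 * \<theta>) - m * (1 - \<theta>) powr p) < e) (at_right (0::real))"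
    using assms by (intro order_tendstoD) auto
  moreover have "eventually (\<lambda>\<theta>. \<theta> < 1) (at_right (0::real))"
    by (rule eventually_at_rightI[of 0 1]) auto
  moreover have "eventually (\<lambda>\<theta>. 0 < \<theta>) (at_right (0::real))"
    by (rule eventually_at_right_less)
  ultimately have "eventually (\<lambda>\<theta>. C * ((m + 2 * \<theta>) - m * (1 - \<theta>) powr p) < e \<and> \<theta> < 1 \<and> 0 < \<theta>) (at_right (0::real))"
    by eventually_elim simp
  then obtain \<theta> :: real where "C * ((m + 2 * \<theta>) - m * (1 - \<theta>) powr p) < e \<and> \<theta> < 1 \<and> 0 < \<theta>"
    using eventually_happens'[OF trivial_limit_at_right_real] by blast
  then show ?thesis by (intro that[of \<theta>]) auto
qed

lemma local_minimising_limit: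
  fixes \<psi> :: "nat \<Rightarrow> 'a::euclidean_space \<Rightarrow> real" and p :: real
  assumes p: "1 < p" "p > real DIM('a)"
    and c: "\<And>n. continuous_on UNIV (\<psi> n)" and hold: "\<And>n v w. \<bar>\<psi> n v - \<psi> n w\<bar> \<le> norm (v - w) powr alpha_sp 1 p TYPE('a)"
    and zero: "\<And>n. \<psi> n 0 = 0" and energy: "\<And>n. grad_Lp_p p (\<psi> n) \<le> m_sp 1 p TYPE('a) + ennreal (b n)"
    and b: "\<And>n. b n > 0" "b \<longlonglongrightarrow> 0" and \<omega>: "norm \<omega> = 1" "\<And>n. 1 - b n \<le> \<psi> n \<omega>"
    and lim: "\<And>x. (\<lambda>n. \<psi> n x) \<longlonglongrightarrow> \<phi> x" and \<phi>: "continuous_on UNIV \<phi>"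
  shows "grad_Lp_p p \<phi> \<le> m_sp 1 p TYPE('a)"
proof -
  let ?\<alpha> = "alpha_sp 1 p TYPE('a)"
  have sp: "0 < (1::real)" "(1::real) \<le> 1" "1 < p" "1 * p > real DIM('a)" using p by auto
  obtain m where m: "m_sp 1 p TYPE('a) = ennreal m" "m \<ge> 0"
    using m_sp_finite[OF sp] by (cases "m_sp 1 p TYPE('a)") auto
  \<comment> \<open>One \<open>b n\<close> is the excess energy of the n-th member, the other the
    price of choosing a single weak gradient.\<close>
  have "\<exists>g. weak_gradient (\<psi> n) g \<and> Lp_pow p lborel g \<le> ennreal (m + 2 * b n)" for n
  proof -
    have "grad_Lp_p p (\<psi> n) < \<infinity>"
      by (rule le_less_trans[OF energy]) (simp add: m)
    then obtain g where g: "weak_gradient (\<psi> n) g" "Lp_pow p lborel g \<le> grad_Lp_p p (\<psi> n) + ennreal (b n)"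
      using grad_Lp_approx[OF _ b(1)] by blast
    note g(2)
    also have "grad_Lp_p p (\<psi> n) + ennreal (b n) \<le> (ennreal m + ennreal (b n)) + ennreal (b n)"
      using energy[of n] m by (intro add_right_mono) simp
    also have "\<dots> = ennreal (m + 2 * b n)"
      using m(2) b(1)[of n] by (simp flip: ennreal_plus)
    finally show ?thesis using g(1) by blast
  qed
  then obtain g where g: "\<And>n. weak_gradient (\<psi> n) (g n)"
    "\<And>n. Lp_pow p lborel (g n) \<le> ennreal (m + 2 * b n)" by metis
  have gm: "g n \<in> borel_measurable lborel" for n using g(1)[of n] by (simp add: weak_gradient_def)
  have cauchy: "\<exists>N. \<forall>n\<ge>N. \<forall>k\<ge>N. Lp_pow p lborel (\<lambda>x. g n x - g k x) \<le> ennreal e" if e: "e > 0" for e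
  proof -
    \<comment> \<open>Chosen so that 2 eta (m + 2) = e / 2. The constant C depends on eta, so
      \<open>\<theta>\<close> and then N are chosen only after it.\<close>
    define \<eta> where "\<eta> = e / (4 * (m + 2))"
    have \<eta>: "\<eta> > 0" using e m by (simp add: \<eta>_def)
    have e2: "e / 2 > 0" using e by simp
    show ?thesis
    proof (rule uniform_convexity_powr[OF p(1) \<eta>, where 'e='a])
      fix C :: real assume C: "C \<ge> 0" and uc: "\<And>a b :: 'a. norm (a - b) powr p \<le> \<eta> * (norm a powr p + norm b powr p)
        + C * ((norm a powr p + norm b powr p) / 2 - norm ((1/2) *\<^sub>R (a + b)) powr p)"
      obtain \<theta> where \<theta>: "0 < \<theta>" "\<theta> < 1" "C * ((m + 2 * \<theta>) - m * (1 - \<theta>) powr p) \<le> e / 2"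
        using small_defect[OF e2] by blast
      obtain N where N: "\<And>n. n \<ge> N \<Longrightarrow> b n < \<theta>"
        using order_tendstoD(2)[OF b(2) \<theta>(1)] by (auto simp: eventually_sequentially)
      have "Lp_pow p lborel (\<lambda>x. g n x - g k x) \<le> ennreal e" if "n \<ge> N" "k \<ge> N" for n k
      proof -
        have bn: "b n < \<theta>" "b k < \<theta>" using N that by auto
        have le: "Lp_pow p lborel (g j) \<le> ennreal (m + 2 * \<theta>)" if "b j < \<theta>" for j
          using that by (intro order_trans[OF g(2)] ennreal_leI) simp
        have "m_sp 1 p TYPE('a) * ennreal ((1 - \<theta>) powr p) \<le> Wsp_seminorm_p 1 p (\<lambda>x. (1/2) * (\<psi> n x + \<psi> k x))"
          using bn \<omega>(2)[of n] \<omega>(2)[of k] \<theta>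
          by (intro midpoint_energy_bound[OF sp c c hold hold zero zero \<omega>(1)]) auto
        also have "\<dots> = grad_Lp_p p (\<lambda>x. (1/2) * (\<psi> n x + \<psi> k x))" by (simp add: Wsp_seminorm_p_def)
        also have "\<dots> \<le> Lp_pow p lborel (\<lambda>x. (1/2) *\<^sub>R (g n x + g k x))"
          unfolding grad_Lp_p_def
          using weak_gradient_cmult[OF weak_gradient_add[OF g(1)[of n] g(1)[of k]], of "1/2"]
          by (intro INF_lower) simp
        finally have mid: "ennreal (m * (1 - \<theta>) powr p) \<le> Lp_pow p lborel (\<lambda>x. (1/2) *\<^sub>R (g n x + g k x))"
          using m by (simp add: ennreal_mult)
        have "Lp_pow p lborel (\<lambda>x. g n x - g k x) \<le>
            ennreal (\<eta> * (2 * (m + 2 * \<theta>)) + C * ((m + 2 * \<theta>) - m * (1 - \<theta>) powr p))"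
          using m \<theta> \<eta> by (intro almost_minimal_midpoint_close(2)[OF gm gm le[OF bn(1)] le[OF bn(2)] mid _ _ _ C p(1) uc]) auto
        also have "\<dots> \<le> ennreal e"
        proof (rule ennreal_leI)
          have "\<eta> * (2 * (m + 2 * \<theta>)) \<le> \<eta> * (2 * (m + 2))"
            using \<theta> \<eta> by (intro mult_left_mono) auto
          also have "\<dots> = e / 2" using m by (simp add: \<eta>_def field_simps)
          finally show "\<eta> * (2 * (m + 2 * \<theta>)) + C * ((m + 2 * \<theta>) - m * (1 - \<theta>) powr p) \<le> e"
            using \<theta>(3) by linarith
        qed
        finally show ?thesis .
      qed
      then show ?thesis by blast
    qed
  qed
  have p0: "0 < p" using p by simp
  show ?thesis
  proof (rule Lp_cauchy_AE_limit[OF gm p0 cauchy])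
    fix r :: "nat \<Rightarrow> nat" and G :: "'a \<Rightarrow> 'a"
    assume r: "strict_mono r" and Gm: "G \<in> borel_measurable lborel" and ae: "AE x in lborel. (\<lambda>n. g (r n) x) \<longlonglongrightarrow> G x"
    have br: "(\<lambda>n. b (r n)) \<longlonglongrightarrow> 0"
      using LIMSEQ_subseq_LIMSEQ[OF b(2) r] by (simp add: comp_def)
    have "(\<lambda>n. m + 2 * b (r n)) \<longlonglongrightarrow> m + 2 * 0"
      by (intro tendsto_intros br)
    then have cl: "(\<lambda>n. ennreal (m + 2 * b (r n))) \<longlonglongrightarrow> ennreal m"
      by (intro tendsto_ennrealI) simp
    have GE: "Lp_pow p lborel G \<le> ennreal m"
      by (rule fatou_powr[OF gm ae p0 _ cl]) (simp add: g(2))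
    have "weak_gradient \<phi> G"
    proof (rule weak_gradient_limit[where \<psi>="\<lambda>n. \<psi> (r n)" and g="\<lambda>n. g (r n)" and w="\<lambda>x. norm x powr ?\<alpha>" and p=p])
      show "(\<lambda>n. \<psi> (r n) x) \<longlonglongrightarrow> \<phi> x" for x
        using LIMSEQ_subseq_LIMSEQ[OF lim r] by (simp add: comp_def)
      show "\<bar>\<psi> (r n) x\<bar> \<le> norm x powr ?\<alpha>" for n x
        using hold[of "r n" x 0] zero by simp
      show "continuous_on UNIV (\<lambda>x::'a. norm x powr ?\<alpha>)"
        using alpha_sp_facts(1)[OF sp] by (intro continuous_on_powr' continuous_intros) auto
      show "Lp_pow p lborel G < \<infinity>"
        by (rule le_less_trans[OF GE]) simp
      show "eventually (\<lambda>n. Lp_pow p lborel (\<lambda>x. g (r n) x - G x) \<le> ennreal e) sequentially" if e: "e > 0" for e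
      proof -
        obtain N where N: "\<And>n k. n \<ge> N \<Longrightarrow> k \<ge> N \<Longrightarrow> (Lp_pow p lborel (\<lambda>x. g n x - g k x)) \<le> ennreal e"
          using cauchy[OF e] by blast
        have rN: "r n \<ge> N" if "n \<ge> N" for n
          using seq_suble[OF r, of n] that by linarith
        \<comment> \<open>Fatou in the second index k turns the Cauchy estimate into closeness to
          the limit G.\<close>
        have "Lp_pow p lborel (\<lambda>x. g (r n) x - G x) \<le> ennreal e" if n: "n \<ge> N" for n
        proof (rule fatou_powr[where f="\<lambda>k x. g (r n) x - g (r k) x" and c="\<lambda>_. ennreal e"])
          show "AE x in lborel. (\<lambda>k. g (r n) x - g (r k) x) \<longlonglongrightarrow> g (r n) x - G x"
            using ae by eventually_elim (intro tendsto_intros)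
          show "eventually (\<lambda>k. Lp_pow p lborel (\<lambda>x. g (r n) x - g (r k) x) \<le> ennreal e) sequentially"
            using eventually_ge_at_top[of N] by eventually_elim (intro N rN n)
        qed (use gm p0 in auto)
        then show ?thesis
          by (intro eventually_sequentiallyI[of N])
      qed
    qed (use g c \<phi> Gm p in auto)
    then have "grad_Lp_p p \<phi> \<le> Lp_pow p lborel G"
      unfolding grad_Lp_p_def by (intro INF_lower) simp
    also note GE
    finally show ?thesis by (simp add: m)
  qed
qed

lemma fractional_minimising_limit:
  fixes \<psi> :: "nat \<Rightarrow> 'a::euclidean_space \<Rightarrow> real" and p :: real
  assumes p: "0 < p" and c: "\<And>n. continuous_on UNIV (\<psi> n)" and energy: "\<And>n. gagliardo_p s p (\<psi> n) \<le> m + ennreal (b n)"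
    and b: "b \<longlonglongrightarrow> 0" and lim: "\<And>x. (\<lambda>n. \<psi> n x) \<longlonglongrightarrow> \<phi> x" and \<phi>: "continuous_on UNIV \<phi>"
  shows "gagliardo_p s p \<phi> \<le> m"
  unfolding gagliardo_dquot[OF \<phi> p]
proof (rule fatou_powr[where f="\<lambda>n. dquot s p (\<psi> n)" and c="\<lambda>n. m + ennreal (b n)"])
  show "dquot s p (\<psi> n) \<in> borel_measurable (lborel \<Otimes>\<^sub>M lborel)" for n
    by (rule dquot_measurable[OF c])
  show "AE x in lborel \<Otimes>\<^sub>M lborel. (\<lambda>n. dquot s p (\<psi> n) x) \<longlonglongrightarrow> dquot s p \<phi> x"
    unfolding dquot_def by (intro AE_I2 tendsto_intros lim)
  show "eventually (\<lambda>n. Lp_pow p (lborel \<Otimes>\<^sub>M lborel) (dquot s p (\<psi> n)) \<le> m + ennreal (b n)) sequentially"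
    using energy unfolding gagliardo_dquot[OF c p] by simp
  have "(\<lambda>n. ennreal (b n)) \<longlonglongrightarrow> ennreal 0" by (rule tendsto_ennrealI[OF b])
  then show "(\<lambda>n. m + ennreal (b n)) \<longlonglongrightarrow> m"
    using tendsto_add[OF tendsto_const, of "\<lambda>n. ennreal (b n)" 0 sequentially m] by simp
qed (rule p)

lemma holder_imp_continuous:
  fixes \<phi> :: "'a::euclidean_space \<Rightarrow> real"
  assumes hold: "\<And>x y. \<bar>\<phi> x - \<phi> y\<bar> \<le> norm (x - y) powr \<alpha>" and \<alpha>: "0 < \<alpha>"
  shows "continuous_on UNIV \<phi>"
proof -
  have "(\<phi> \<longlongrightarrow> \<phi> x) (at x)" for x
  proof (rule LIM_zero_cancel, rule Lim_null_comparison)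
    show "eventually (\<lambda>y. norm (\<phi> y - \<phi> x) \<le> norm (y - x) powr \<alpha>) (at x)"
      using hold by simp
    have "((\<lambda>y. norm (y - x) powr \<alpha>) \<longlongrightarrow> norm (x - x) powr \<alpha>) (at x)"
      using \<alpha> by (intro tendsto_powr' tendsto_intros) auto
    then show "((\<lambda>y. norm (y - x) powr \<alpha>) \<longlongrightarrow> 0) (at x)" by simp
  qed
  then show ?thesis by (simp add: continuous_on_def)
qed

lemma minimiser_exists:
  assumes sp: "0 < s" "s \<le> 1" "1 < p" "s * p > real DIM('a::euclidean_space)"
  shows "\<exists>\<phi> :: 'a \<Rightarrow> real. \<phi> \<in> W_space s p \<and> holder_seminorm (alpha_sp s p TYPE('a)) \<phi> = 1 \<and>
    Wsp_seminorm_p s p \<phi> = m_sp s p TYPE('a)"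
proof (rule minimising_sequence[OF sp])
  let ?\<alpha> = "alpha_sp s p TYPE('a)"
  fix \<psi> :: "nat \<Rightarrow> 'a \<Rightarrow> real" and \<phi> :: "'a \<Rightarrow> real" and \<omega> :: 'a and b :: "nat \<Rightarrow> real"
  assume c: "\<And>n. continuous_on UNIV (\<psi> n)" and hold: "\<And>n v w. \<bar>\<psi> n v - \<psi> n w\<bar> \<le> norm (v - w) powr ?\<alpha>"
    and zero: "\<And>n. \<psi> n 0 = 0" and energy: "\<And>n. Wsp_seminorm_p s p (\<psi> n) \<le> m_sp s p TYPE('a) + ennreal (b n)"
    and b: "\<And>n. b n > 0" "b \<longlonglongrightarrow> 0" and \<omega>: "norm \<omega> = 1" "\<And>n. 1 - b n \<le> \<psi> n \<omega>"
    and lim: "\<And>x. (\<lambda>n. \<psi> n x) \<longlonglongrightarrow> \<phi> x"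
  have \<phi>hold: "\<bar>\<phi> x - \<phi> y\<bar> \<le> norm (x - y) powr ?\<alpha>" for x y
  proof (rule LIMSEQ_le_const2)
    show "(\<lambda>n. \<bar>\<psi> n x - \<psi> n y\<bar>) \<longlonglongrightarrow> \<bar>\<phi> x - \<phi> y\<bar>" by (intro tendsto_intros lim)
  qed (use hold in blast)
  have \<phi>c: "continuous_on UNIV \<phi>"
    by (rule holder_imp_continuous[OF \<phi>hold alpha_sp_facts(1)[OF sp]])
  have "\<phi> 0 = 0"
    using LIMSEQ_unique[OF lim[of 0]] zero by simp
  \<comment> \<open>The fixed pair (0, \<open>\<omega>\<close>) keeps the Hoelder seminorm from
    dropping below 1 under pointwise convergence.\<close>
  moreover have "1 - 0 \<le> \<phi> \<omega>"
    by (rule LIMSEQ_le[OF tendsto_diff[OF tendsto_const b(2)] lim]) (use \<omega>(2) in auto)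
  ultimately have "ennreal 1 \<le> ennreal (\<bar>\<phi> \<omega> - \<phi> 0\<bar> / norm (\<omega> - 0) powr ?\<alpha>)"
    using \<omega>(1) by (intro ennreal_leI) simp
  also have "\<dots> \<le> holder_seminorm ?\<alpha> \<phi>"
    by (rule holder_seminorm_ge) (use \<omega> in auto)
  finally have h1: "1 \<le> holder_seminorm ?\<alpha> \<phi>" by simp
  have "holder_seminorm ?\<alpha> \<phi> \<le> ennreal 1"
    using \<phi>hold by (subst holder_seminorm_le_iff) auto
  with h1 have \<phi>h: "holder_seminorm ?\<alpha> \<phi> = 1" by simp
  have le: "Wsp_seminorm_p s p \<phi> \<le> m_sp s p TYPE('a)"
  proof (cases "s = 1")
    case True
    then show ?thesis
      using local_minimising_limit[OF _ _ c _ zero _ b \<omega> lim \<phi>c, of p] hold energy sp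
      by (simp add: Wsp_seminorm_p_def)
  next
    case False
    then show ?thesis
      using fractional_minimising_limit[OF _ c _ b(2) lim \<phi>c, of p s "m_sp s p TYPE('a)"] energy sp
      by (simp add: Wsp_seminorm_p_def)
  qed
  have "\<phi> \<in> W_space s p"
    using \<phi>c \<phi>h le_less_trans[OF le m_sp_finite[OF sp]] by (simp add: W_space_def)
  moreover from this \<phi>h le have "Wsp_seminorm_p s p \<phi> = m_sp s p TYPE('a)"
    using m_sp_le_Wsp[OF sp] by (intro antisym) blast+
  ultimately show ?thesis using \<phi>h by blast
qed

theorem theorem6p1:
  fixes s p :: real
  assumes "0 < s" "s \<le> 1" "1 < p" "s * p > real DIM('a::euclidean_space)"
  shows "m_sp s p TYPE('a) =
           (INF \<phi> \<in> {\<phi> :: 'a \<Rightarrow> real. \<phi> \<in> W_space s p \<and> holder_seminorm (alpha_sp s p TYPE('a)) \<phi> = 1}.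
              Wsp_seminorm_p s p \<phi>)
       \<and> (\<exists>\<phi> :: 'a \<Rightarrow> real. \<phi> \<in> W_space s p \<and> holder_seminorm (alpha_sp s p TYPE('a)) \<phi> = 1 \<and>
              Wsp_seminorm_p s p \<phi> = m_sp s p TYPE('a))"
  using m_sp_eq_INF_W_space[OF assms] minimiser_exists[OF assms] by (rule conjI)

end
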